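(* Suppose that $m\ge n^{\frac{d(1+\gamma)}{d-1}}$. There exists a constant $C>0$ (not depending on $n$ or $m$) such that $$R_S=\inf_{\hat f\in\mathcal{S}_n}\ \sup_{P\in\mathcal{P}_n}R_P(\hat f)\ \ge\ \left(\frac{C}{n}\right)^{\frac{2}{d-1}}.$$
   Context: Data: $\mathcal{X}=[0,1]^d$. $(X_1,Y_1),\dots,(X_n,Y_n)$ are i.i.d. from a distribution $P$ on $\mathcal X\times\mathbb{R}$ (labeled data), and $X_{n+1},\dots,X_N$ are i.i.d. from the $X$-marginal $P_X$ of $P$ (unlabeled data), independent of the labeled data; $N=N(n)$, $m=m(n)=N-n$. Throughout $|Y|\le M$ for a fixed finite constant $M>0$. The regression function is $f_P(x)=\mathbb{E}(Y|X=x)$. $S_P$ denotes the support of $P_X$. $\mathcal{S}_n$ is the set of supervised estimators of $f_P$, i.e. estimators that are functions of the labeled data only. The risk is $R_P(\hat f)=\mathbb{E}_P\left[\int(\hat f(x)-f_P(x))^2\,dP_X(x)\right]$, the expectation being over the data. Smoothed density and metric: $K$ is a fixed symmetric kernel (probability density) on $\mathbb{R}^d$ with compact support, $C_0$ is the diameter of the support of $K$, and $p_{X,\sigma}(x)=\int \sigma^{-d}K(\|x-u\|/\sigma)\,dP_X(u)$ for $\sigma>0$. Let $\Gamma(x_1,x_2)$ be the set of continuous finite-length curves $\gamma$ from $x_1$ to $x_2$ with unit speed everywhere, $L(\gamma)$ the length of $\gamma$, and for $\alpha\ge0$ let $D_{P,\alpha,\sigma}(x_1,x_2)=\inf_{\gamma\in\Gamma(x_1,x_2)}\int_0^{L(\gamma)}\exp[-\alpha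 p_{X,\sigma}(\gamma(t))]\,dt$. For $L>0$, $\mathcal{P}(\alpha,\sigma,L)$ is the set of joint distributions $P$ of $(X,Y)$ such that $P_X$ is supported on $\mathcal{X}$ and $|f_P(x_1)-f_P(x_2)|\le L\,D_{P,\alpha,\sigma}(x_1,x_2)$ for all $x_1,x_2\in\mathcal{X}$. $\mathcal{N}(P,\alpha,\sigma,\varepsilon)$ is the smallest number of balls $\{z: D_{P,\alpha,\sigma}(x,z)\le\varepsilon\}$ required to cover $S_P$. The class $\mathcal{P}_n$: fix $\xi\in[0,d-3)$, $\gamma>0$, $L>0$ and constants $C_1,C_2>0$, and let $\varepsilon(m,\sigma)=\sqrt{C_2\log m/(m\sigma^d)}$. Then $\mathcal{P}_n=\bigcup_{(\alpha,\sigma)}\mathcal{Q}(\alpha,\sigma,L)$, where (C1) $\mathcal{Q}(\alpha,\sigma,L)=\{P\in\mathcal{P}(\alpha,\sigma,L):\ \mathcal{N}(P,\alpha,\sigma,\varepsilon)\le(C_1/\varepsilon)^\xi\ \text{ for all }\varepsilon\ge n^{-1/(2+\xi)}\}$, and the union is over all pairs $(\alpha,\sigma)$, $\alpha\ge0$, $\sigma>0$, satisfying (C2) $\alpha\le \log 2/\varepsilon(m,\sigma)$; (C3) $\left(\frac1m\right)^{\frac{1}{d(1+\gamma)}}\le\sigma\le\frac{1}{4C_0}\left(\frac1n\right)^{\frac{1}{d-1}}$.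
   Formalization: In (C1) the bound is max{1,(C_1/ε)^ξ}, as otherwise the class is empty for ξ>0; ξ=0 is excluded, since there the mean of the labels has risk O(1/n); and some pair (α,σ) is assumed to satisfy (C2),(C3), since otherwise P_n is empty. *)

theory Defs
  imports "HOL-Probability.Probability"
begin

section \<open>Data distributions and the regression function\<close>

definition cube :: "(real^'d) set" where
  "cube = {x. \<forall>i. 0 \<le> x $ i \<and> x $ i \<le> 1}"

definition marginal_X :: "((real^'d) \<times> real) measure \<Rightarrow> (real^'d) measure" where
  "marginal_X P = distr P borel fst"

definition measure_support :: "'a::topological_space measure \<Rightarrow> 'a set" where
  "measure_support \<mu> = {x. \<forall>U. open U \<and> x \<in> U \<longrightarrow> emeasure \<mu> U > 0}"

text \<open>\<open>f\<close> is a version of \<open>x \<mapsto> E(Y | X = x)\<close>, where \<open>X = fst\<close> and \<open>Y = snd\<close>; the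
  conditioning sigma-algebra is the one generated by \<open>X\<close>.\<close>

definition is_regression ::
    "((real^'d) \<times> real) measure \<Rightarrow> (real^'d \<Rightarrow> real) \<Rightarrow> bool" where
  "is_regression P f \<longleftrightarrow> f \<in> borel_measurable borel \<and>
     (AE z in P. real_cond_exp P (vimage_algebra UNIV fst borel) snd z = f (fst z))"

text \<open>Versions agree almost everywhere with respect to the \<open>X\<close>-marginal, so the choice
  of version does not affect the risk.\<close>

definition regression :: "((real^'d) \<times> real) measure \<Rightarrow> real^'d \<Rightarrow> real" where
  "regression P = (SOME f. is_regression P f)"


section \<open>Kernel, smoothed density and density-sensitive metric\<close>

text \<open>The kernel is given by a radial profile \<open>K :: real \<Rightarrow> real\<close>; the density on
  the whole space is \<open>x \<mapsto> K (norm x)\<close>, which makes it symmetric by construction.\<close>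

definition radial :: "(real \<Rightarrow> real) \<Rightarrow> real^'d \<Rightarrow> real" where
  "radial K x = K (norm x)"

definition kernel_support :: "(real^'d \<Rightarrow> real) \<Rightarrow> (real^'d) set" where
  "kernel_support \<kappa> = closure {x. \<kappa> x \<noteq> 0}"

definition is_kernel :: "(real^'d \<Rightarrow> real) \<Rightarrow> bool" where
  "is_kernel \<kappa> \<longleftrightarrow> \<kappa> \<in> borel_measurable borel \<and> (\<forall>x. \<kappa> x \<ge> 0) \<and>
     (\<integral>\<^sup>+x. ennreal (\<kappa> x) \<partial>lborel) = 1 \<and> compact (kernel_support \<kappa>)"

text \<open>The value may be \<open>\<infinity>\<close> at some points if the kernel is unbounded.\<close>

definition smoothed_density ::
    "(real \<Rightarrow> real) \<Rightarrow> ((real^'d) \<times> real) measure \<Rightarrow> real \<Rightarrow> real^'d \<Rightarrow> ennreal" where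
  "smoothed_density K P \<sigma> x =
     (\<integral>\<^sup>+u. ennreal (K (norm (x - u) / \<sigma>) / \<sigma> ^ CARD('d)) \<partial>marginal_X P)"

text \<open>\<open>exp (- \<alpha> q)\<close> for \<open>\<alpha> \<ge> 0\<close> and \<open>q \<in> [0, \<infinity>]\<close>, with \<open>0 \<cdot> \<infinity> = 0\<close>.\<close>

definition exp_weight :: "real \<Rightarrow> ennreal \<Rightarrow> real" where
  "exp_weight \<alpha> q =
     (if q = \<infinity> then (if \<alpha> = 0 then 1 else 0) else exp (- \<alpha> * enn2real q))"

definition curve_length :: "(real \<Rightarrow> real^'d) \<Rightarrow> real \<Rightarrow> real \<Rightarrow> ennreal" where
  "curve_length \<gamma> a b =
     (SUP ts \<in> {ts. sorted ts \<and> set ts \<subseteq> {a..b}}.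
        \<Sum>i < length ts - 1. ennreal (dist (\<gamma> (ts ! i)) (\<gamma> (ts ! Suc i))))"

text \<open>Continuous finite-length curves of unit speed: the piece over any parameter interval
  \<open>[s, t]\<close> has length \<open>t - s\<close>, so the total length is \<open>l\<close>. Corners are allowed, hence
  curves can be concatenated. A curve is only looked at on \<open>[0, l]\<close>.\<close>

definition unit_speed_curves ::
    "real^'d \<Rightarrow> real^'d \<Rightarrow> (real \<times> (real \<Rightarrow> real^'d)) set" where
  "unit_speed_curves x1 x2 =
     {(l, \<gamma>). 0 \<le> l \<and> continuous_on {0..l} \<gamma> \<and> \<gamma> 0 = x1 \<and> \<gamma> l = x2 \<and>
        (\<forall>s t. 0 \<le> s \<and> s \<le> t \<and> t \<le> l \<longrightarrow> curve_length \<gamma> s t = ennreal (t - s))}"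

definition density_dist ::
    "(real \<Rightarrow> real) \<Rightarrow> ((real^'d) \<times> real) measure \<Rightarrow> real \<Rightarrow> real \<Rightarrow> real^'d \<Rightarrow> real^'d \<Rightarrow> real"
    where
  "density_dist K P \<alpha> \<sigma> x1 x2 =
     (INF (l, \<gamma>) \<in> unit_speed_curves x1 x2.
        LINT t:{0..l}|lborel. exp_weight \<alpha> (smoothed_density K P \<sigma> (\<gamma> t)))"

text \<open>The metric is bounded by the Euclidean one, so for \<open>\<epsilon> > 0\<close> and \<open>P\<close> supported in
  the cube finite covers exist and the infimum over \<open>nat\<close> is the true covering number.\<close>

definition covering_number ::
    "(real \<Rightarrow> real) \<Rightarrow> ((real^'d) \<times> real) measure \<Rightarrow> real \<Rightarrow> real \<Rightarrow> real \<Rightarrow> nat" where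
  "covering_number K P \<alpha> \<sigma> \<epsilon> =
     Inf {card A | A. finite A \<and> A \<subseteq> cube \<and>
       measure_support (marginal_X P) \<subseteq> (\<Union>x\<in>A. {z. density_dist K P \<alpha> \<sigma> x z \<le> \<epsilon>})}"


section \<open>Classes of distributions\<close>

text \<open>\<open>M\<close> is the uniform bound on \<open>\<bar>Y\<bar>\<close>.\<close>

definition lipschitz_class ::
    "(real \<Rightarrow> real) \<Rightarrow> real \<Rightarrow> real \<Rightarrow> real \<Rightarrow> real \<Rightarrow> ((real^'d) \<times> real) measure set" where
  "lipschitz_class K M \<alpha> \<sigma> L =
     {P. sets P = sets borel \<and> prob_space P \<and>
         (AE z in P. fst z \<in> cube) \<and> (AE z in P. \<bar>snd z\<bar> \<le> M) \<and>
         (\<exists>f. is_regression P f \<and>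
            (\<forall>x1\<in>cube. \<forall>x2\<in>cube. \<bar>f x1 - f x2\<bar> \<le> L * density_dist K P \<alpha> \<sigma> x1 x2))}"

text \<open>A covering number is at least 1, while \<open>(C1 / \<epsilon>) powr \<xi> < 1\<close> for \<open>\<epsilon> > C1\<close> and
  \<open>\<xi> > 0\<close>; without the maximum the class would therefore be empty.\<close>

definition covering_class ::
    "(real \<Rightarrow> real) \<Rightarrow> real \<Rightarrow> real \<Rightarrow> real \<Rightarrow> nat \<Rightarrow> real \<Rightarrow> real \<Rightarrow> real \<Rightarrow>
     ((real^'d) \<times> real) measure set" where
  "covering_class K M C1 \<xi> n \<alpha> \<sigma> L =
     {P \<in> lipschitz_class K M \<alpha> \<sigma> L.
        \<forall>\<epsilon> \<ge> real n powr (- 1 / (2 + \<xi>)).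
          real (covering_number K P \<alpha> \<sigma> \<epsilon>) \<le> max 1 ((C1 / \<epsilon>) powr \<xi>)}"

definition eps_rate :: "nat \<Rightarrow> real \<Rightarrow> nat \<Rightarrow> real \<Rightarrow> real" where
  "eps_rate d C2 m \<sigma> = sqrt (C2 * ln (real m) / (real m * \<sigma> ^ d))"

text \<open>The bound on \<open>\<alpha>\<close> is \<open>\<alpha> \<le> ln 2 / eps_rate d C2 m \<sigma>\<close>, multiplied out so that it is void
  when the rate vanishes (\<open>m = 1\<close>). The parameter \<open>C0\<close> is the diameter of the kernel's
  support.\<close>

definition tuning_pairs ::
    "nat \<Rightarrow> real \<Rightarrow> real \<Rightarrow> real \<Rightarrow> nat \<Rightarrow> nat \<Rightarrow> (real \<times> real) set" where
  "tuning_pairs d C0 C2 \<gamma> n m =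
     {(\<alpha>, \<sigma>). \<alpha> \<ge> 0 \<and> \<sigma> > 0 \<and> \<alpha> * eps_rate d C2 m \<sigma> \<le> ln 2 \<and>
        (1 / real m) powr (1 / (real d * (1 + \<gamma>))) \<le> \<sigma> \<and>
        \<sigma> \<le> 1 / (4 * C0) * (1 / real n) powr (1 / (real d - 1))}"

definition distribution_class ::
    "(real \<Rightarrow> real) \<Rightarrow> real \<Rightarrow> real \<Rightarrow> real \<Rightarrow> real \<Rightarrow> real \<Rightarrow> real \<Rightarrow> nat \<Rightarrow> nat \<Rightarrow>
     ((real^'d) \<times> real) measure set" where
  "distribution_class K M L \<xi> \<gamma> C1 C2 n m =
     (\<Union>(\<alpha>, \<sigma>) \<in> tuning_pairs CARD('d)
                   (diameter (kernel_support (radial K :: real^'d \<Rightarrow> real))) C2 \<gamma> n m.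
        covering_class K M C1 \<xi> n \<alpha> \<sigma> L)"


section \<open>Estimators and risk\<close>

text \<open>A sample consists of \<open>n\<close> labeled points and \<open>m\<close> unlabeled ones, all independent.\<close>

type_synonym 'd sample = "(nat \<Rightarrow> (real^'d) \<times> real) \<times> (nat \<Rightarrow> real^'d)"

definition sample_law ::
    "nat \<Rightarrow> nat \<Rightarrow> ((real^'d) \<times> real) measure \<Rightarrow> 'd sample measure" where
  "sample_law n m P =
     (\<Pi>\<^sub>M i\<in>{..<n}. P) \<Otimes>\<^sub>M (\<Pi>\<^sub>M i\<in>{..<m}. marginal_X P)"

definition supervised_estimators :: "nat \<Rightarrow> ('d sample \<Rightarrow> real^'d \<Rightarrow> real) set" where
  "supervised_estimators n =
     {\<lambda>(z, u). g z | g.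
        (\<lambda>(z, x). g z x) \<in> borel_measurable ((\<Pi>\<^sub>M i\<in>{..<n}. borel) \<Otimes>\<^sub>M borel)}"

definition risk ::
    "nat \<Rightarrow> nat \<Rightarrow> ((real^'d) \<times> real) measure \<Rightarrow> ('d sample \<Rightarrow> real^'d \<Rightarrow> real) \<Rightarrow> ennreal"
    where
  "risk n m P F =
     (\<integral>\<^sup>+\<omega>. (\<integral>\<^sup>+x. ennreal ((F \<omega> x - regression P x)\<^sup>2) \<partial>marginal_X P) \<partial>sample_law n m P)"

definition supervised_minimax_risk ::
    "nat \<Rightarrow> nat \<Rightarrow> ((real^'d) \<times> real) measure set \<Rightarrow> ennreal" where
  "supervised_minimax_risk n m \<P> =
     (INF F \<in> supervised_estimators n. SUP P \<in> \<P>. risk n m P F)"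

end

theory Submission
  imports Defs "HOL-Real_Asymp.Real_Asymp"
begin

text \<open>
  The lower bound comes from distributions whose geometry encodes the regression function: the
  unlabeled marginal reveals it, the labeled sample alone does not.

  Write \<open>d\<close> for the dimension. Take a grid \<open>G\<close> of \<open>q ^ (d - 1)\<close> points in the base of the cube, with
  \<open>q\<close> of order \<open>n powr (1 / (d - 1))\<close>, and erect a vertical spine over each of them. For
  \<open>T \<subseteq> G\<close> the spines over \<open>T\<close> reach the top face and end at height \<open>1 / q\<close> above the bottom
  face; the other spines stand on the bottom face and end at distance \<open>1 / q\<close> below the top.
  Together with the grid lines of the two faces they form two connected pieces at distance
  \<open>1 / q\<close>. The marginal is uniform on all these segments, and the label is \<open>h\<close> on the upper piece
  and \<open>- h\<close> on the lower one, with \<open>h\<close> of order \<open>1 / q\<close>.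

  These distributions lie in the class (\<open>spiked_covering_class\<close>). Smoothing spreads mass over a
  distance of at most \<open>1 / (4 * q)\<close>, so the regression function can be constant near each piece
  and change, with Euclidean slope \<open>L\<close>, only where the smoothed density vanishes and the metric
  is Euclidean; this makes it Lipschitz for the density-sensitive metric
  (\<open>lipschitz_weighted_dist\<close>). On the segments the smoothed density is bounded below by a constant
  \<open>\<rho>\<close> (\<open>smoothed_density_segment_ge\<close>), and every support point is joined to a corner of its own
  piece by a path of at most \<open>d\<close> segments. Hence each piece has diameter of order
  \<open>exp (- \<alpha> * \<rho>)\<close>, where \<open>\<alpha>\<close> may be a positive power of \<open>n\<close> (\<open>eps_rate_bounds\<close>): two balls suffice
  at every admissible scale, and a single one suffices at scales bounded away from zero because
  the two pieces come within \<open>1 / q\<close> of each other.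

  They are hard to tell apart from labels (\<open>spiked_minimax_bound\<close>). Moving a single grid point
  in or out of \<open>T\<close> alters one spine only, of probability of order \<open>1 / n\<close>, so with probability at
  least one half no labeled point shows the change. Both positions of the spine share its
  middle part, where the regression values are \<open>h\<close> and \<open>- h\<close>. Averaging over all \<open>T\<close>
  (\<open>assouad_bound\<close>) gives a risk of order \<open>h\<^sup>2\<close>, that is of order \<open>n powr (- 2 / (d - 1))\<close>.

  The estimates above hold for all large \<open>n\<close>. For the finitely many remaining \<open>n\<close> it is enough to
  have a positive bound, which two nearby atoms provide (\<open>two_atom_minimax_bound\<close>).
\<close>

section \<open>Unit-speed curves and weighted path distances\<close>

lemma unit_speed_dist_le:
  assumes "(l, \<gamma>) \<in> unit_speed_curves x y" "0 \<le> s" "s \<le> t" "t \<le> l"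
  shows "dist (\<gamma> s) (\<gamma> t) \<le> t - s"
proof -
  have "ennreal (dist (\<gamma> s) (\<gamma> t)) \<le> curve_length \<gamma> s t"
    unfolding curve_length_def
    by (rule SUP_upper2[where i = "[s, t]"]) (use assms in auto)
  also have "\<dots> = ennreal (t - s)"
    using assms by (auto simp: unit_speed_curves_def)
  finally show ?thesis using assms by simp
qed

lemma partition_sum_le:
  assumes "sorted ts" "set ts \<subseteq> {a..b}" "a \<le> b"
    and lip: "\<And>u v. a \<le> u \<Longrightarrow> u \<le> v \<Longrightarrow> v \<le> b \<Longrightarrow> dist (\<gamma> u) (\<gamma> v) \<le> v - u"
  shows "(\<Sum>i < length ts - 1. ennreal (dist (\<gamma> (ts ! i)) (\<gamma> (ts ! Suc i)))) \<le> ennreal (b - a)"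
proof (cases "ts = []")
  case True
  then show ?thesis by simp
next
  case False
  have "(\<Sum>i < length ts - 1. dist (\<gamma> (ts ! i)) (\<gamma> (ts ! Suc i)))
      \<le> (\<Sum>i < length ts - 1. ts ! Suc i - ts ! i)"
  proof (rule sum_mono)
    fix i assume "i \<in> {..<length ts - 1}"
    then have i: "Suc i < length ts" by auto
    then have "ts ! i \<in> {a..b}" "ts ! Suc i \<in> {a..b}"
      using assms(2) by (meson Suc_lessD nth_mem subsetD)+
    moreover have "ts ! i \<le> ts ! Suc i"
      using i assms(1) by (simp add: sorted_iff_nth_Suc)
    ultimately show "dist (\<gamma> (ts ! i)) (\<gamma> (ts ! Suc i)) \<le> ts ! Suc i - ts ! i"
      using lip by auto
  qed
  also have "\<dots> = ts ! (length ts - 1) - ts ! 0"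
    by (rule sum_lessThan_telescope)
  also have "\<dots> \<le> b - a"
  proof -
    have "ts ! (length ts - 1) \<in> {a..b}" "ts ! 0 \<in> {a..b}"
      using False assms(2) by (meson diff_less length_greater_0_conv nth_mem subsetD zero_less_one)+
    then show ?thesis by auto
  qed
  finally have "(\<Sum>i < length ts - 1. dist (\<gamma> (ts ! i)) (\<gamma> (ts ! Suc i))) \<le> b - a" .
  then show ?thesis
    by (subst sum_ennreal) (auto intro: ennreal_leI)
qed

lemma curve_length_le:
  assumes "a \<le> b"
    and lip: "\<And>u v. a \<le> u \<Longrightarrow> u \<le> v \<Longrightarrow> v \<le> b \<Longrightarrow> dist (\<gamma> u) (\<gamma> v) \<le> v - u"
  shows "curve_length \<gamma> a b \<le> ennreal (b - a)"
  unfolding curve_length_def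
proof (rule SUP_least)
  fix ts assume "ts \<in> {ts. sorted ts \<and> set ts \<subseteq> {a..b}}"
  then show "(\<Sum>i < length ts - 1. ennreal (dist (\<gamma> (ts ! i)) (\<gamma> (ts ! Suc i)))) \<le> ennreal (b - a)"
    by (intro partition_sum_le[OF _ _ assms]) auto
qed

text \<open>Joining two partitions adds at most one further term, the one that bridges the gap between
  them.\<close>

lemma partition_sum_append:
  fixes D :: "real \<Rightarrow> real \<Rightarrow> ennreal"
  shows "(\<Sum>i < length ts - 1. D (ts ! i) (ts ! Suc i)) + (\<Sum>i < length us - 1. D (us ! i) (us ! Suc i))
    \<le> (\<Sum>i < length (ts @ us) - 1. D ((ts @ us) ! i) ((ts @ us) ! Suc i))"
proof -
  let ?F = "\<lambda>i. D ((ts @ us) ! i) ((ts @ us) ! Suc i)"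
  have "(\<Sum>i < length ts - 1. D (ts ! i) (ts ! Suc i)) = (\<Sum>i < length ts - 1. ?F i)"
    by (rule sum.cong) (auto simp: nth_append)
  moreover have "(\<Sum>i < length us - 1. D (us ! i) (us ! Suc i))
      = (\<Sum>i \<in> {length ts..<length ts + (length us - 1)}. ?F i)"
  proof -
    have "(\<Sum>i \<in> {length ts..<length ts + (length us - 1)}. ?F i)
        = (\<Sum>i \<in> {0 + length ts..<(length us - 1) + length ts}. ?F i)"
      by (simp add: add.commute)
    also have "\<dots> = (\<Sum>i \<in> {0..<length us - 1}. ?F (i + length ts))"
      by (rule sum.shift_bounds_nat_ivl)
    also have "\<dots> = (\<Sum>i < length us - 1. D (us ! i) (us ! Suc i))"
      by (rule sum.cong) (auto simp: nth_append)
    finally show ?thesis by simp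
  qed
  moreover have "(\<Sum>i < length ts - 1. ?F i) + (\<Sum>i \<in> {length ts..<length ts + (length us - 1)}. ?F i)
      = (\<Sum>i \<in> {..<length ts - 1} \<union> {length ts..<length ts + (length us - 1)}. ?F i)"
    by (rule sum.union_disjoint[symmetric]) auto
  moreover have "\<dots> \<le> (\<Sum>i < length (ts @ us) - 1. ?F i)"
    by (rule sum_mono2) auto
  ultimately show ?thesis by simp
qed

lemma curve_length_superadditive:
  assumes "a \<le> b" "b \<le> c"
  shows "curve_length \<gamma> a b + curve_length \<gamma> b c \<le> curve_length \<gamma> a c"
proof -
  let ?S = "\<lambda>ts. \<Sum>i < length ts - 1. ennreal (dist (\<gamma> (ts ! i)) (\<gamma> (ts ! Suc i)))"
  have "curve_length \<gamma> a b + curve_length \<gamma> b c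
      = (SUP ts\<in>{ts. sorted ts \<and> set ts \<subseteq> {a..b}}. ?S ts + curve_length \<gamma> b c)"
    unfolding curve_length_def
    by (subst ennreal_SUP_add_left) (auto intro!: exI[of _ "[]"])
  also have "\<dots> \<le> curve_length \<gamma> a c"
  proof (rule SUP_least)
    fix ts assume ts: "ts \<in> {ts. sorted ts \<and> set ts \<subseteq> {a..b}}"
    have "?S ts + curve_length \<gamma> b c
      = (SUP us\<in>{us. sorted us \<and> set us \<subseteq> {b..c}}. ?S ts + ?S us)"
      unfolding curve_length_def
      by (subst ennreal_SUP_add_right) (auto intro!: exI[of _ "[]"])
    also have "\<dots> \<le> curve_length \<gamma> a c"
    proof (rule SUP_least)
      fix us assume us: "us \<in> {us. sorted us \<and> set us \<subseteq> {b..c}}"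
      have "?S ts + ?S us \<le> ?S (ts @ us)"
        by (rule partition_sum_append)
      also have "\<dots> \<le> curve_length \<gamma> a c"
        unfolding curve_length_def
      proof (rule SUP_upper)
        have "sorted (ts @ us)" using ts us by (fastforce simp: sorted_append)
        then show "ts @ us \<in> {ts. sorted ts \<and> set ts \<subseteq> {a..c}}"
          using ts us assms by fastforce
      qed
      finally show "?S ts + ?S us \<le> curve_length \<gamma> a c" .
    qed
    finally show "?S ts + curve_length \<gamma> b c \<le> curve_length \<gamma> a c" .
  qed
  finally show ?thesis .
qed

lemma curve_length_cong:
  assumes "\<And>t. t \<in> {a..b} \<Longrightarrow> \<gamma> t = \<gamma>' t"
  shows "curve_length \<gamma> a b = curve_length \<gamma>' a b"
  unfolding curve_length_def
proof (rule SUP_cong[OF refl], rule sum.cong[OF refl], goal_cases)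
  case (1 ts i)
  then have "ts ! i \<in> set ts" "ts ! Suc i \<in> set ts" by auto
  then show ?case using 1 assms by (simp add: subset_iff)
qed

lemma curve_length_shift:
  "curve_length (\<lambda>t. \<gamma> (t - c)) (a + c) (b + c) = curve_length \<gamma> a b"
proof (rule antisym)
  have *: "curve_length (\<lambda>t. \<gamma> (t - c)) (a + c) (b + c) \<le> curve_length \<gamma> a b" for \<gamma> :: "real \<Rightarrow> real^'a" and a b c
    unfolding curve_length_def
  proof (rule SUP_least)
    fix ts assume ts: "ts \<in> {ts. sorted ts \<and> set ts \<subseteq> {a + c..b + c}}"
    let ?us = "map (\<lambda>t. t - c) ts"
    have "(\<Sum>i<length ts - 1. ennreal (dist (\<gamma> (ts ! i - c)) (\<gamma> (ts ! Suc i - c))))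
       = (\<Sum>i<length ?us - 1. ennreal (dist (\<gamma> (?us ! i)) (\<gamma> (?us ! Suc i))))"
      by (rule sum.cong) auto
    also have "\<dots> \<le> (SUP ts\<in>{ts. sorted ts \<and> set ts \<subseteq> {a..b}}. \<Sum>i<length ts - 1. ennreal (dist (\<gamma> (ts ! i)) (\<gamma> (ts ! Suc i))))"
    proof (rule SUP_upper)
      have "sorted ?us" using ts by (auto simp: sorted_iff_nth_mono)
      then show "?us \<in> {ts. sorted ts \<and> set ts \<subseteq> {a..b}}"
        using ts by (auto simp: subset_iff algebra_simps)
    qed
    finally show "(\<Sum>i<length ts - 1. ennreal (dist (\<gamma> (ts ! i - c)) (\<gamma> (ts ! Suc i - c)))) \<le> \<dots>" .
  qed
  show "curve_length (\<lambda>t. \<gamma> (t - c)) (a + c) (b + c) \<le> curve_length \<gamma> a b" by (rule *)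
  show "curve_length \<gamma> a b \<le> curve_length (\<lambda>t. \<gamma> (t - c)) (a + c) (b + c)"
    using *[of "\<lambda>t. \<gamma> (t - c)" "- c" "a + c" "b + c"] by simp
qed

text \<open>Upper bounds on the length of a piece of the joined curve follow from its being 1-Lipschitz;
  the lower bound for a piece that contains the junction is superadditivity of length.\<close>

lemma unit_speed_curves_join:
  assumes 1: "(l, \<gamma>) \<in> unit_speed_curves x y" and 2: "(k, \<delta>) \<in> unit_speed_curves y z"
  shows "(l + k, \<lambda>t. if t \<le> l then \<gamma> t else \<delta> (t - l)) \<in> unit_speed_curves x z"
proof -
  let ?j = "\<lambda>t. if t \<le> l then \<gamma> t else \<delta> (t - l)"
  have l: "0 \<le> l" and k: "0 \<le> k" and join: "\<gamma> l = \<delta> 0"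
    using 1 2 by (auto simp: unit_speed_curves_def)
  have cont: "continuous_on {0..l + k} ?j"
  proof -
    have "{0..l + k} = {0..l} \<union> {l..l + k}" using l k by auto
    moreover have "continuous_on ({0..l} \<union> {l..l + k}) ?j"
    proof (rule continuous_on_If)
      show "continuous_on {0..l} \<gamma>" using 1 by (auto simp: unit_speed_curves_def)
      have "continuous_on {0..k} \<delta>" using 2 by (auto simp: unit_speed_curves_def)
      then show "continuous_on {l..l + k} (\<lambda>t. \<delta> (t - l))"
        by (rule continuous_on_compose2) (auto intro!: continuous_intros)
    qed (use join in auto)
    ultimately show ?thesis by simp
  qed
  have len1: "curve_length ?j s t = ennreal (t - s)" if "0 \<le> s" "s \<le> t" "t \<le> l" for s t
  proof -
    have "curve_length ?j s t = curve_length \<gamma> s t"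
      by (rule curve_length_cong) (use that in auto)
    then show ?thesis using 1 that by (auto simp: unit_speed_curves_def)
  qed
  have len2: "curve_length ?j s t = ennreal (t - s)" if "l \<le> s" "s \<le> t" "t \<le> l + k" for s t
  proof -
    have "curve_length ?j s t = curve_length (\<lambda>t. \<delta> (t - l)) s t"
    proof (rule curve_length_cong)
      fix u assume "u \<in> {s..t}"
      then have "u = l \<or> l < u" using that by auto
      then show "?j u = \<delta> (u - l)" using join by auto
    qed
    also have "\<dots> = curve_length \<delta> (s - l) (t - l)"
      using curve_length_shift[of \<delta> l "s - l" "t - l"] by simp
    finally show ?thesis using 2 that by (auto simp: unit_speed_curves_def)
  qed
  have lip: "dist (?j s) (?j t) \<le> t - s" if "0 \<le> s" "s \<le> t" "t \<le> l + k" for s t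
  proof -
    consider "t \<le> l" | "l < s" | "s \<le> l" "l < t" using that by linarith
    then show ?thesis
    proof cases
      case 1
      then show ?thesis using that unit_speed_dist_le[OF assms(1)] by auto
    next
      case 2
      then show ?thesis using that unit_speed_dist_le[OF assms(2), of "s - l" "t - l"] by auto
    next
      case 3
      have "dist (\<gamma> s) (\<delta> (t - l)) \<le> dist (\<gamma> s) (\<gamma> l) + dist (\<delta> 0) (\<delta> (t - l))"
        using dist_triangle join by metis
      then show ?thesis
        using 3 that unit_speed_dist_le[OF assms(2), of 0 "t - l"] unit_speed_dist_le[OF assms(1), of s l]
        by auto
    qed
  qed
  have "curve_length ?j s t = ennreal (t - s)" if st: "0 \<le> s" "s \<le> t" "t \<le> l + k" for s t
  proof -
    consider "t \<le> l" | "l \<le> s" | "s \<le> l" "l \<le> t" by linarith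
    then show ?thesis
    proof cases
      case 3
      have "curve_length ?j s t \<le> ennreal (t - s)"
        by (rule curve_length_le) (use st in \<open>auto intro!: lip simp del: if_split split del: if_split\<close>)
      moreover have "ennreal (t - s) = ennreal (l - s) + ennreal (t - l)"
        using 3 by (subst ennreal_plus[symmetric]) auto
      then have "ennreal (t - s) \<le> curve_length ?j s t"
        using curve_length_superadditive[OF 3, of ?j] len1[of s l] len2[of l t] 3 st by simp
      ultimately show ?thesis by (rule antisym)
    qed (use st in \<open>simp_all add: len1 len2\<close>)
  qed
  then show ?thesis
    using cont l k 1 2 join unfolding unit_speed_curves_def by auto
qed

lemma segment_unit_speed:
  fixes x y :: "real^'d"
  obtains \<gamma> where "(dist x y, \<gamma>) \<in> unit_speed_curves x y"
    and "\<And>t. t \<in> {0..dist x y} \<Longrightarrow> \<gamma> t \<in> closed_segment x y"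
proof
  define l where "l = dist x y"
  define \<gamma> where "\<gamma> = (\<lambda>t. x + (t / l) *\<^sub>R (y - x))"
  have l: "0 \<le> l" by (simp add: l_def)
  have end1: "\<gamma> 0 = x" by (simp add: \<gamma>_def)
  have end2: "\<gamma> l = y" by (cases "x = y") (auto simp: \<gamma>_def l_def)
  have iso: "dist (\<gamma> s) (\<gamma> t) = t - s" if "0 \<le> s" "s \<le> t" "t \<le> l" for s t
  proof (cases "x = y")
    case True
    then show ?thesis using that by (simp add: \<gamma>_def l_def)
  next
    case False
    then have "l > 0" by (simp add: l_def)
    have "\<gamma> s - \<gamma> t = ((s - t) / l) *\<^sub>R (y - x)"
      by (simp add: \<gamma>_def scaleR_left_diff_distrib[symmetric] diff_divide_distrib)
    then have "dist (\<gamma> s) (\<gamma> t) = \<bar>(s - t) / l\<bar> * norm (y - x)"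
      by (simp add: dist_norm)
    also have "\<dots> = t - s" using that \<open>l > 0\<close> by (simp add: l_def dist_norm norm_minus_commute)
    finally show ?thesis .
  qed
  have "curve_length \<gamma> s t = ennreal (t - s)" if st: "0 \<le> s" "s \<le> t" "t \<le> l" for s t
  proof (rule antisym)
    show "curve_length \<gamma> s t \<le> ennreal (t - s)"
      by (rule curve_length_le) (use st iso in auto)
    have "ennreal (t - s) = ennreal (dist (\<gamma> s) (\<gamma> t))" using iso[OF st] by simp
    also have "\<dots> \<le> curve_length \<gamma> s t"
      unfolding curve_length_def by (rule SUP_upper2[where i = "[s, t]"]) (use st in auto)
    finally show "ennreal (t - s) \<le> curve_length \<gamma> s t" .
  qed
  moreover have "continuous_on {0..l} \<gamma>"
    unfolding \<gamma>_def by (cases "l = 0") (auto intro!: continuous_intros)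
  ultimately show "(dist x y, \<gamma>) \<in> unit_speed_curves x y"
    using l end1 end2 by (auto simp: unit_speed_curves_def l_def[symmetric])
  show "\<gamma> t \<in> closed_segment x y" if "t \<in> {0..dist x y}" for t
    unfolding in_segment
  proof (intro exI[of _ "t / l"] conjI)
    show "t / l \<le> 1" "0 \<le> t / l" using that l by (auto simp: l_def divide_le_eq_1)
    show "\<gamma> t = (1 - t / l) *\<^sub>R x + (t / l) *\<^sub>R y"
      by (simp add: \<gamma>_def algebra_simps)
  qed
qed

text \<open>The density-sensitive metric for a general weight on the space; only measurability and values
  in the unit interval matter for its geometry.\<close>

definition weighted_dist :: "(real^'d \<Rightarrow> real) \<Rightarrow> real^'d \<Rightarrow> real^'d \<Rightarrow> real" where
  "weighted_dist W x y = (INF (l, \<gamma>) \<in> unit_speed_curves x y. LINT t:{0..l}|lborel. W (\<gamma> t))"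

locale path_weight =
  fixes W :: "real^'d \<Rightarrow> real"
  assumes W_measurable: "W \<in> borel_measurable borel" and W_nonneg: "\<And>x. 0 \<le> W x"
    and W_le_1: "\<And>x. W x \<le> 1"
begin

text \<open>Without integrability the Bochner integral along a curve would be zero by default. The curve is
  clamped to its parameter interval so that continuity on that interval gives measurability.\<close>

lemma set_integrable_along:
  fixes a b :: real
  assumes "continuous_on {a..b} \<gamma>"
  shows "set_integrable lborel {a..b} (\<lambda>t. W (\<gamma> t))"
proof (cases "a \<le> b")
  case True
  have "continuous_on UNIV (\<lambda>t. \<gamma> (max a (min b t)))"
    by (rule continuous_on_compose2[OF assms])
      (use True in \<open>auto intro!: continuous_on_max continuous_on_min continuous_on_const continuous_on_id\<close>)
  then have m: "(\<lambda>t. \<gamma> (max a (min b t))) \<in> borel_measurable borel"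
    by (rule borel_measurable_continuous_onI)
  have "set_integrable lborel {a..b} (\<lambda>t. W (\<gamma> (max a (min b t))))"
    unfolding set_integrable_def
  proof (rule Bochner_Integration.integrable_bound)
    show "integrable lborel (indicat_real {a..b})" using True by simp
    show "(\<lambda>t. indicat_real {a..b} t *\<^sub>R W (\<gamma> (max a (min b t)))) \<in> borel_measurable lborel"
      using measurable_compose[OF m W_measurable] by simp
  qed (auto simp: indicator_def W_nonneg W_le_1)
  then show ?thesis
    unfolding set_integrable_def
    by (rule back_subst[of "integrable lborel"]) (auto simp: indicator_def fun_eq_iff max_def min_def)
next
  case False
  then show ?thesis by (simp add: set_integrable_def)
qed

lemma along_mono_set:
  assumes "set_integrable lborel B (\<lambda>t. W (\<gamma> t))" "A \<subseteq> B" "A \<in> sets borel"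
  shows "(LINT t:A|lborel. W (\<gamma> t)) \<le> (LINT t:B|lborel. W (\<gamma> t))"
proof -
  have "set_integrable lborel A (\<lambda>t. W (\<gamma> t))"
    by (rule set_integrable_subset[OF assms(1)]) (use assms in auto)
  then show ?thesis
    using assms unfolding set_lebesgue_integral_def set_integrable_def
    by (intro integral_mono) (auto simp: indicator_def W_nonneg)
qed

lemma curve_continuous:
  "(l, \<gamma>) \<in> unit_speed_curves x y \<Longrightarrow> continuous_on {0..l} \<gamma>"
  by (simp add: unit_speed_curves_def)

lemma along_nonneg: "0 \<le> (LINT t:{a..b}|lborel. W (\<gamma> t))"
  unfolding set_lebesgue_integral_def by (rule integral_nonneg_AE) (simp add: W_nonneg)

lemma weighted_dist_le:
  assumes "(l, \<gamma>) \<in> unit_speed_curves x y"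
  shows "weighted_dist W x y \<le> (LINT t:{0..l}|lborel. W (\<gamma> t))"
proof -
  have "bdd_below ((\<lambda>(l, \<gamma>). LINT t:{0..l}|lborel. W (\<gamma> t)) ` unit_speed_curves x y)"
    by (rule bdd_belowI[of _ 0]) (auto intro: along_nonneg)
  from cINF_lower[OF this assms] show ?thesis by (simp add: weighted_dist_def)
qed

lemma weighted_dist_greatest:
  assumes "\<And>l \<gamma>. (l, \<gamma>) \<in> unit_speed_curves x y \<Longrightarrow> c \<le> (LINT t:{0..l}|lborel. W (\<gamma> t))"
  shows "c \<le> weighted_dist W x y"
  unfolding weighted_dist_def
  by (rule cINF_greatest) (use segment_unit_speed[of x y] assms in auto)

lemma weighted_dist_segment:
  assumes "\<And>z. z \<in> closed_segment x y \<Longrightarrow> W z \<le> w" "0 \<le> w"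
  shows "weighted_dist W x y \<le> w * dist x y"
proof -
  obtain \<gamma> where g: "(dist x y, \<gamma>) \<in> unit_speed_curves x y"
    "\<And>t. t \<in> {0..dist x y} \<Longrightarrow> \<gamma> t \<in> closed_segment x y"
    using segment_unit_speed by blast
  have "weighted_dist W x y \<le> (LINT t:{0..dist x y}|lborel. W (\<gamma> t))"
    by (rule weighted_dist_le[OF g(1)])
  also have "\<dots> \<le> (LINT t:{0..dist x y}|lborel. w)"
  proof (rule set_integral_mono)
    show "set_integrable lborel {0..dist x y} (\<lambda>t. W (\<gamma> t))"
      by (intro set_integrable_along curve_continuous[OF g(1)])
    show "set_integrable lborel {0..dist x y} (\<lambda>t. w)"
      by (simp add: set_integrable_def)
  qed (use assms g(2) in auto)
  also have "\<dots> = w * dist x y"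
    by (simp add: set_lebesgue_integral_def)
  finally show ?thesis .
qed

lemma weighted_dist_refl: "weighted_dist W x x \<le> 0"
  using weighted_dist_segment[of x x 1] W_le_1 by auto

lemma weighted_dist_le_dist: "weighted_dist W x y \<le> dist x y"
  using weighted_dist_segment[of x y 1] W_le_1 by auto

lemma weighted_dist_triangle:
  "weighted_dist W x z \<le> weighted_dist W x y + weighted_dist W y z"
proof -
  have join: "weighted_dist W x z \<le> (LINT t:{0..l}|lborel. W (\<gamma> t)) + (LINT t:{0..k}|lborel. W (\<delta> t))"
    if 1: "(l, \<gamma>) \<in> unit_speed_curves x y" and 2: "(k, \<delta>) \<in> unit_speed_curves y z" for l \<gamma> k \<delta>
  proof -
    let ?j = "\<lambda>t. if t \<le> l then \<gamma> t else \<delta> (t - l)"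
    have l: "0 \<le> l" "0 \<le> k" using 1 2 by (auto simp: unit_speed_curves_def)
    note J = unit_speed_curves_join[OF 1 2]
    have int: "set_integrable lborel {0..l + k} (\<lambda>t. W (?j t))"
      by (intro set_integrable_along curve_continuous[OF J])
    have sub: "{0..l} \<union> {l<..l + k} = {0..l + k}" using l by auto
    have "(LINT t:{0..l} \<union> {l<..l + k}|lborel. W (?j t))
       = (LINT t:{0..l}|lborel. W (?j t)) + (LINT t:{l<..l + k}|lborel. W (?j t))"
      by (rule set_integral_Un)
        (use l in \<open>auto intro: set_integrable_subset[OF int]\<close>)
    then have "(LINT t:{0..l + k}|lborel. W (?j t))
       = (LINT t:{0..l}|lborel. W (?j t)) + (LINT t:{l<..l + k}|lborel. W (?j t))"
      unfolding sub .
    also have "(LINT t:{0..l}|lborel. W (?j t)) = (LINT t:{0..l}|lborel. W (\<gamma> t))"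
      by (rule set_lebesgue_integral_cong) auto
    also have "(LINT t:{l<..l + k}|lborel. W (?j t)) = (LINT t:{0<..k}|lborel. W (\<delta> t))"
    proof -
      have "(LINT t:{0<..k}|lborel. W (\<delta> t)) = (LINT t|lborel. indicator {0<..k} (- l + 1 * t) *\<^sub>R W (\<delta> (- l + 1 * t)))"
        unfolding set_lebesgue_integral_def
        by (subst lborel_integral_real_affine[where c = 1 and t = "- l"]) auto
      also have "\<dots> = (LINT t:{l<..l + k}|lborel. W (?j t))"
        unfolding set_lebesgue_integral_def
        by (rule Bochner_Integration.integral_cong) (auto simp: indicator_def)
      finally show ?thesis ..
    qed
    also have "(LINT t:{0<..k}|lborel. W (\<delta> t)) \<le> (LINT t:{0..k}|lborel. W (\<delta> t))"
    proof (rule along_mono_set)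
      show "set_integrable lborel {0..k} (\<lambda>t. W (\<delta> t))"
        by (intro set_integrable_along curve_continuous[OF 2])
      show "{0<..k} \<subseteq> {0..k}" by auto
    qed auto
    finally show ?thesis using weighted_dist_le[OF J] by linarith
  qed
  have "weighted_dist W x z - weighted_dist W y z \<le> weighted_dist W x y"
  proof (rule weighted_dist_greatest)
    fix l \<gamma> assume 1: "(l, \<gamma>) \<in> unit_speed_curves x y"
    have "weighted_dist W x z - (LINT t:{0..l}|lborel. W (\<gamma> t)) \<le> weighted_dist W y z"
      by (rule weighted_dist_greatest) (use join[OF 1] in force)
    then show "weighted_dist W x z - weighted_dist W y z \<le> (LINT t:{0..l}|lborel. W (\<gamma> t))" by simp
  qed
  then show ?thesis by simp
qed

lemma along_ge_of_weight_1:
  assumes "continuous_on {0..l} \<gamma>" "0 \<le> s" "s \<le> t" "t \<le> l"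
    and "\<And>u. s < u \<Longrightarrow> u < t \<Longrightarrow> W (\<gamma> u) = 1"
  shows "t - s \<le> (LINT t:{0..l}|lborel. W (\<gamma> t))"
proof -
  have "t - s = (LINT u:{s<..<t}|lborel. 1)" using assms by (simp add: set_lebesgue_integral_def)
  also have "\<dots> = (LINT u:{s<..<t}|lborel. W (\<gamma> u))"
    by (rule set_lebesgue_integral_cong) (use assms in auto)
  also have "\<dots> \<le> (LINT t:{0..l}|lborel. W (\<gamma> t))"
  proof (rule along_mono_set)
    show "set_integrable lborel {0..l} (\<lambda>t. W (\<gamma> t))"
      by (rule set_integrable_along[OF assms(1)])
    show "{s<..<t} \<subseteq> {0..l}" using assms by auto
  qed auto
  finally show ?thesis .
qed

text \<open>Suppose \<open>f\<close> increases from the start to the end of the curve. Between the last time at which it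
  equals \<open>- h\<close> and the first later time at which it equals \<open>h\<close>, the curve runs through the region
  of weight one, so this stretch contributes its full Euclidean length to the integral. The
  increase over the stretch is at least the total increase. A decrease is an increase of \<open>- f\<close>.\<close>

lemma increment_le_along:
  assumes c: "(l, \<gamma>) \<in> unit_speed_curves x y"
    and lip: "\<And>u v. \<bar>f u - f v\<bar> \<le> L * dist u v" and L: "L > 0"
    and bd: "\<And>u. \<bar>f u\<bar> \<le> h" and flat: "\<And>u. W u \<noteq> 1 \<Longrightarrow> f u = h \<or> f u = - h"
  shows "\<bar>f y - f x\<bar> \<le> L * (LINT t:{0..l}|lborel. W (\<gamma> t))"
proof -
  let ?I = "LINT t:{0..l}|lborel. W (\<gamma> t)"
  have l: "0 \<le> l" and cont: "continuous_on {0..l} \<gamma>" and ends: "\<gamma> 0 = x" "\<gamma> l = y"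
    using c by (auto simp: unit_speed_curves_def)
  have contf: "continuous_on UNIV f"
    unfolding continuous_on_iff
  proof (intro ballI allI impI)
    fix u e assume "e > (0::real)"
    then show "\<exists>d>0. \<forall>v\<in>UNIV. dist v u < d \<longrightarrow> dist (f v) (f u) < e"
    proof (intro exI[of _ "e / L"] conjI ballI impI)
      fix v assume "dist v u < e / L"
      then have "L * dist v u < e" using L by (simp add: field_simps)
      then show "dist (f v) (f u) < e" using lip[of v u] by (simp add: dist_real_def)
    qed (use L in auto)
  qed
  have main: "g y - g x \<le> L * ?I"
    if g: "\<And>u. g u = f u \<or> g u = - f u" "continuous_on UNIV g" "\<And>u v. \<bar>g u - g v\<bar> \<le> L * dist u v" for g
  proof -
    have bdg: "- h \<le> g u" "g u \<le> h" for u using bd[of u] g(1)[of u] by (auto simp: abs_le_iff)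
    have flatg: "g u = h \<or> g u = - h" if "W u \<noteq> 1" for u
      using flat[OF that] g(1)[of u] by auto
    have contg: "continuous_on {0..l} (\<lambda>t. g (\<gamma> t))"
      by (rule continuous_on_compose2[OF g(2) cont]) auto
    define A where "A = {t \<in> {0..l}. g (\<gamma> t) = - h}"
    define s where "s = (if A = {} then 0 else Sup A)"
    have "closed A" "bounded A"
    proof -
      show "closed A" unfolding A_def
        using continuous_closed_preimage_constant[OF contg, of "- h"] by (simp add: closed_atLeastAtMost)
      show "bounded A" unfolding A_def by (rule bounded_subset[of "{0..l}"]) auto
    qed
    then have SupA: "Sup A \<in> A" if "A \<noteq> {}" using that
      by (intro closed_contains_Sup) (auto intro: bounded_imp_bdd_above)
    have s: "0 \<le> s" "s \<le> l" using l SupA by (auto simp: s_def A_def)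
    have gs: "g (\<gamma> s) \<le> g x" using SupA ends bdg by (auto simp: s_def A_def)
    have after: "g (\<gamma> u) \<noteq> - h" if "s < u" "u \<le> l" for u
    proof
      assume "g (\<gamma> u) = - h"
      then have "u \<in> A" using that s by (auto simp: A_def)
      then have "u \<le> s" using \<open>bounded A\<close>
        by (auto simp: s_def intro!: cSup_upper bounded_imp_bdd_above)
      then show False using that by simp
    qed
    define B where "B = {t \<in> {s..l}. g (\<gamma> t) = h}"
    define t where "t = (if B = {} then l else Inf B)"
    have "closed B" "bounded B"
    proof -
      have "continuous_on {s..l} (\<lambda>t. g (\<gamma> t))"
        by (rule continuous_on_subset[OF contg]) (use s in auto)
      then show "closed B" unfolding B_def
        using continuous_closed_preimage_constant[of "{s..l}" _ h] by (simp add: closed_atLeastAtMost)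
      show "bounded B" unfolding B_def by (rule bounded_subset[of "{s..l}"]) auto
    qed
    then have InfB: "Inf B \<in> B" if "B \<noteq> {}" using that
      by (intro closed_contains_Inf) (auto intro: bounded_imp_bdd_below)
    have t: "s \<le> t" "t \<le> l" using s InfB by (auto simp: t_def B_def)
    have gt: "g y \<le> g (\<gamma> t)" using InfB ends bdg by (auto simp: t_def B_def)
    have before: "g (\<gamma> u) \<noteq> h" if "s \<le> u" "u < t" for u
    proof
      assume "g (\<gamma> u) = h"
      then have "u \<in> B" using that t by (auto simp: B_def)
      then have "t \<le> u" using \<open>bounded B\<close>
        by (auto simp: t_def intro!: cInf_lower bounded_imp_bdd_below)
      then show False using that by simp
    qed
    have "W (\<gamma> u) = 1" if "s < u" "u < t" for u
      using flatg[of "\<gamma> u"] after[of u] before[of u] that t by auto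
    then have "t - s \<le> ?I"
      using cont s t by (intro along_ge_of_weight_1) auto
    moreover have "g (\<gamma> t) - g (\<gamma> s) \<le> L * dist (\<gamma> s) (\<gamma> t)"
      using g(3)[of "\<gamma> t" "\<gamma> s"] by (simp add: dist_commute)
    moreover have "dist (\<gamma> s) (\<gamma> t) \<le> t - s"
      using unit_speed_dist_le[OF c] s t by simp
    ultimately have "g (\<gamma> t) - g (\<gamma> s) \<le> L * ?I"
      by (smt (verit) L mult_left_mono)
    then show ?thesis using gs gt by linarith
  qed
  have "f y - f x \<le> L * ?I" by (rule main) (use contf lip in auto)
  moreover have "- f y - - f x \<le> L * ?I"
    by (rule main) (use contf lip in \<open>auto intro: continuous_on_minus simp: abs_minus_commute\<close>)
  ultimately show ?thesis by (simp add: abs_le_iff)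
qed

text \<open>A Euclidean Lipschitz function stays Lipschitz with the same constant after the distances are
  shrunk, provided that it takes one of its two extreme values wherever they are shrunk.\<close>

lemma lipschitz_weighted_dist:
  assumes "\<And>u v. \<bar>f u - f v\<bar> \<le> L * dist u v" and L: "L > 0"
    and "\<And>u. \<bar>f u\<bar> \<le> h" and "\<And>u. W u \<noteq> 1 \<Longrightarrow> f u = h \<or> f u = - h"
  shows "\<bar>f x - f y\<bar> \<le> L * weighted_dist W x y"
proof -
  have "\<bar>f y - f x\<bar> / L \<le> weighted_dist W x y"
  proof (rule weighted_dist_greatest)
    fix l \<gamma> assume "(l, \<gamma>) \<in> unit_speed_curves x y"
    from increment_le_along[OF this assms]
    show "\<bar>f y - f x\<bar> / L \<le> (LINT t:{0..l}|lborel. W (\<gamma> t))"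
      using L by (simp add: pos_divide_le_eq mult.commute)
  qed
  then show ?thesis using L by (simp add: pos_divide_le_eq mult.commute abs_minus_commute)
qed

end

section \<open>Kernel mass along a line\<close>

lemma kernel_nonneg:
  assumes "is_kernel (radial K :: real^'d \<Rightarrow> real)" "0 \<le> r"
  shows "0 \<le> K r"
proof -
  have "norm (r *\<^sub>R axis undefined 1 :: real^'d) = r" using assms(2) by (simp add: norm_axis_1)
  then show ?thesis using assms(1) unfolding is_kernel_def radial_def by metis
qed

text \<open>The profile is constrained by the kernel only at nonnegative arguments, hence the absolute
  value.\<close>

lemma kernel_profile_measurable:
  assumes "is_kernel (radial K :: real^'d \<Rightarrow> real)"
  shows "(\<lambda>r. K \<bar>r\<bar>) \<in> borel_measurable borel"
proof -
  have "(radial K :: real^'d \<Rightarrow> real) \<in> borel_measurable borel"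
    using assms by (simp add: is_kernel_def)
  moreover have "(\<lambda>r. r *\<^sub>R axis undefined 1 :: real^'d) \<in> borel_measurable borel"
    by (intro borel_measurable_continuous_onI continuous_intros)
  ultimately have "(\<lambda>r. radial K (r *\<^sub>R axis undefined 1 :: real^'d)) \<in> borel_measurable borel"
    by (rule measurable_compose[rotated])
  then show ?thesis by (simp add: radial_def norm_axis_1)
qed

text \<open>The support of a radial function contains with each point its antipode, so its diameter is at
  least twice the norm of any of its points.\<close>

lemma kernel_radius:
  assumes "is_kernel (radial K :: real^'d \<Rightarrow> real)" "0 \<le> r" "K r \<noteq> 0"
  shows "2 * r \<le> diameter (kernel_support (radial K :: real^'d \<Rightarrow> real))"
proof -
  let ?x = "r *\<^sub>R axis undefined 1 :: real^'d"
  have n: "norm ?x = r" using assms(2) by (simp add: norm_axis_1)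
  have "?x \<in> kernel_support (radial K :: real^'d \<Rightarrow> real)" "- ?x \<in> kernel_support (radial K :: real^'d \<Rightarrow> real)"
    unfolding kernel_support_def using assms n
    by (auto intro!: subsetD[OF closure_subset] simp: radial_def simp del: norm_scaleR)
  moreover have "bounded (kernel_support (radial K :: real^'d \<Rightarrow> real))"
    using assms(1) by (simp add: is_kernel_def compact_imp_bounded)
  ultimately have "dist ?x (- ?x) \<le> diameter (kernel_support (radial K :: real^'d \<Rightarrow> real))"
    by (intro diameter_bounded_bound) auto
  moreover have "?x - - ?x = 2 *\<^sub>R ?x" by (simp only: diff_minus_eq_add scaleR_2)
  then have "dist ?x (- ?x) = 2 * r" using n by (simp only: dist_norm norm_scaleR)
  ultimately show ?thesis by simp
qed

definition half_line_mass :: "(real \<Rightarrow> real) \<Rightarrow> ennreal" where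
  "half_line_mass K = (\<integral>\<^sup>+r. ennreal (K \<bar>r\<bar>) * indicator {0..} r \<partial>lborel)"

text \<open>If the profile vanished almost everywhere on the half line, then so would its dilations along
  every ray. Integrating the dilated kernel over space and over dilation factors in \<open>{1..2}\<close> in both
  orders gives zero in one order (first the dilations, along each ray) and a positive number in
  the other (each dilated kernel has positive integral). This replaces polar coordinates.\<close>

lemma half_line_mass_pos:
  assumes "is_kernel (radial K :: real^'d \<Rightarrow> real)"
  shows "half_line_mass K > 0"
proof (rule ccontr)
  note [measurable] = kernel_profile_measurable[OF assms]
  have [measurable]: "(\<lambda>x::real^'d. K (norm x)) \<in> borel_measurable borel"
    using assms by (simp add: is_kernel_def radial_def[abs_def])
  let ?k = "\<lambda>r. ennreal (K \<bar>r\<bar>)"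
  assume "\<not> half_line_mass K > 0"
  then have I: "(\<integral>\<^sup>+r. ?k r * indicator {0..} r \<partial>lborel) = 0"
    by (simp add: half_line_mass_def)
  let ?F = "\<lambda>(s::real) (x::real^'d). ?k (s * norm x) * indicator {1..2} s"
  have inner0: "(\<integral>\<^sup>+s. ?F s x \<partial>lborel) = 0" if "x \<noteq> 0" for x
  proof -
    let ?c = "norm x"
    have c: "?c > 0" using that by simp
    have "0 = ennreal \<bar>?c\<bar> * (\<integral>\<^sup>+s. ?k (0 + ?c * s) * indicator {0..} (0 + ?c * s) \<partial>lborel)"
      using c by (subst nn_integral_real_affine[symmetric, of "\<lambda>r. ?k r * indicator {0..} r"]) (auto simp: I)
    then have "(\<integral>\<^sup>+s. ?k (?c * s) * indicator {0..} (?c * s) \<partial>lborel) = 0"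
      using c by simp
    moreover have "(\<integral>\<^sup>+s. ?F s x \<partial>lborel) \<le> (\<integral>\<^sup>+s. ?k (?c * s) * indicator {0..} (?c * s) \<partial>lborel)"
      by (rule nn_integral_mono) (use c in \<open>auto simp: indicator_def mult.commute\<close>)
    ultimately show ?thesis by simp
  qed
  have "0 = (\<integral>\<^sup>+x. (\<integral>\<^sup>+s. ?F s x \<partial>lborel) \<partial>(lborel :: (real^'d) measure))"
  proof -
    have "AE x in (lborel :: (real^'d) measure). x \<noteq> 0" by (rule AE_lborel_singleton)
    then have "AE x in (lborel :: (real^'d) measure). (\<integral>\<^sup>+s. ?F s x \<partial>lborel) = 0"
      by eventually_elim (rule inner0)
    then have "(\<integral>\<^sup>+x. (\<integral>\<^sup>+s. ?F s x \<partial>lborel) \<partial>(lborel :: (real^'d) measure)) = (\<integral>\<^sup>+x. 0 \<partial>(lborel :: (real^'d) measure))"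
      by (rule nn_integral_cong_AE)
    then show ?thesis by simp
  qed
  also have "\<dots> = (\<integral>\<^sup>+s. (\<integral>\<^sup>+x. ?F s x \<partial>(lborel :: (real^'d) measure)) \<partial>lborel)"
    by (rule lborel_pair.Fubini') measurable
  finally have "(\<integral>\<^sup>+s. (\<integral>\<^sup>+x. ?F s x \<partial>(lborel :: (real^'d) measure)) \<partial>lborel) = 0" ..
  then have ae: "AE s in lborel. (\<integral>\<^sup>+x. ?F s x \<partial>(lborel :: (real^'d) measure)) = 0"
    by (subst (asm) nn_integral_0_iff_AE) measurable
  have pos: "(\<integral>\<^sup>+x. ?F s x \<partial>(lborel :: (real^'d) measure)) \<noteq> 0" if "s \<in> {1..2}" for s
  proof
    assume *: "(\<integral>\<^sup>+x. ?F s x \<partial>(lborel :: (real^'d) measure)) = 0"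
    have s: "s > 0" using that by auto
    have "(\<lambda>x::real^'d. K (norm (s *\<^sub>R x))) \<in> borel_measurable borel" by measurable
    then have [measurable]: "(\<lambda>x::real^'d. K (s * norm x)) \<in> borel_measurable borel"
      using s by simp
    have "1 = (\<integral>\<^sup>+x. ?k (norm x) \<partial>(lborel :: (real^'d) measure))"
      using assms by (simp add: is_kernel_def radial_def)
    also have "(lborel :: (real^'d) measure) = density (distr lborel borel (\<lambda>x. 0 + s *\<^sub>R x)) (\<lambda>_. ennreal (\<bar>s\<bar> ^ DIM(real^'d)))"
      by (rule lborel_affine) (use s in auto)
    also have "(\<integral>\<^sup>+x. ?k (norm x) \<partial>\<dots>) = (\<integral>\<^sup>+x. ennreal (\<bar>s\<bar> ^ DIM(real^'d)) * ?k (norm (s *\<^sub>R x)) \<partial>(lborel :: (real^'d) measure))"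
      by (subst nn_integral_density, simp, simp, subst nn_integral_distr) (auto simp del: norm_scaleR)
    also have "\<dots> = ennreal (\<bar>s\<bar> ^ DIM(real^'d)) * (\<integral>\<^sup>+x. ?F s x \<partial>(lborel :: (real^'d) measure))"
      using that s by (simp add: nn_integral_cmult)
    finally show False using * by simp
  qed
  have "AE s in lborel. s \<notin> {1..2::real}" using ae by eventually_elim (use pos in blast)
  then have "emeasure lborel {1..2::real} = 0"
    by (subst (asm) AE_iff_measurable[of "{1..2}"]) auto
  then show False by simp
qed

lemma kernel_diameter_pos:
  assumes "is_kernel (radial K :: real^'d \<Rightarrow> real)"
  shows "diameter (kernel_support (radial K :: real^'d \<Rightarrow> real)) > 0"
proof (rule ccontr)
  note [measurable] = kernel_profile_measurable[OF assms]
  assume "\<not> ?thesis"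
  then have K0: "K r = 0" if "r > 0" for r using kernel_radius[OF assms, of r] that by force
  have "AE r in lborel. ennreal (K \<bar>r\<bar>) * indicator {0..} r = 0"
    using AE_lborel_singleton[of "0::real"] by eventually_elim (auto simp: indicator_def K0)
  then have "half_line_mass K = 0"
    unfolding half_line_mass_def by (subst nn_integral_0_iff_AE) measurable
  then show False using half_line_mass_pos[OF assms] by simp
qed

text \<open>From any point of a segment whose length is at least the kernel diameter, the longer half of
  the segment covers the kernel radius \<open>\<sigma> * C0 / 2\<close>; this half already carries the full half-line
  mass.\<close>

lemma smoothed_segment_ge:
  assumes kernel: "is_kernel (radial K :: real^'d \<Rightarrow> real)" and "\<sigma> > 0" "0 < v" "v \<le> 1"
    and \<sigma>: "\<sigma> * diameter (kernel_support (radial K :: real^'d \<Rightarrow> real)) \<le> v" and t0: "t0 \<in> {0..1}"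
  shows "ennreal \<sigma> * half_line_mass K
    \<le> (\<integral>\<^sup>+t. ennreal (K (\<bar>t - t0\<bar> * v / \<sigma>)) * indicator {0..1} t \<partial>lborel)"
proof -
  note [measurable] = kernel_profile_measurable[OF kernel]
  let ?k = "\<lambda>r. ennreal (K \<bar>r\<bar>)"
  define C where "C = diameter (kernel_support (radial K :: real^'d \<Rightarrow> real))"
  \<comment> \<open>the direction of the longer half\<close>
  define e :: real where "e = (if t0 \<le> 1/2 then 1 else -1)"
  have e: "e * e = 1" "\<bar>e\<bar> = 1" by (auto simp: e_def)
  define c where "c = e * v / \<sigma>"
  have c0: "c \<noteq> 0" and c: "\<bar>c\<bar> = v / \<sigma>" using assms e by (auto simp: c_def abs_mult e_def)
  let ?J = "\<integral>\<^sup>+t. ennreal (K (\<bar>t - t0\<bar> * v / \<sigma>)) * indicator {0..1} t \<partial>lborel"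
  have "half_line_mass K = ennreal \<bar>c\<bar> *
      (\<integral>\<^sup>+t. ?k (- t0 * c + c * t) * indicator {0..} (- t0 * c + c * t) \<partial>lborel)"
    unfolding half_line_mass_def by (rule nn_integral_real_affine[OF _ c0]) measurable
  also have "\<dots> \<le> ennreal \<bar>c\<bar> * ?J"
  proof (intro mult_left_mono nn_integral_mono)
    fix t
    define w where "w = - t0 * c + c * t"
    have eq: "w = e * (t - t0) * v / \<sigma>" by (simp add: w_def c_def algebra_simps diff_divide_distrib)
    have ab: "\<bar>w\<bar> = \<bar>t - t0\<bar> * v / \<sigma>"
      unfolding eq using assms(2,3) e by (simp add: abs_mult)
    have "?k w * indicator {0..} w \<le> ennreal (K (\<bar>t - t0\<bar> * v / \<sigma>)) * indicator {0..1} t"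
    proof (cases "K (\<bar>t - t0\<bar> * v / \<sigma>) = 0 \<or> w < 0")
      case True
      then show ?thesis by (auto simp: ab)
    next
      case False
      then have "2 * (\<bar>t - t0\<bar> * v / \<sigma>) \<le> C"
        unfolding C_def by (intro kernel_radius[OF kernel]) (use assms in auto)
      then have "2 * \<bar>t - t0\<bar> * v \<le> \<sigma> * C" using assms(2) by (simp add: field_simps)
      also have "\<dots> \<le> v" using \<sigma> by (simp add: C_def)
      finally have "\<bar>t - t0\<bar> \<le> 1/2" using assms(3) by simp
      moreover have "0 \<le> e * (t - t0)"
        using False assms(2,3) by (auto simp: eq not_less zero_le_divide_iff zero_le_mult_iff)
      ultimately have "t \<in> {0..1}" using t0 by (auto simp: e_def split: if_splits)
      then show ?thesis using False by (simp add: ab)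
    qed
    then show "?k (- t0 * c + c * t) * indicator {0..} (- t0 * c + c * t)
      \<le> ennreal (K (\<bar>t - t0\<bar> * v / \<sigma>)) * indicator {0..1} t"
      unfolding w_def .
  qed auto
  finally have I: "half_line_mass K \<le> ennreal (v / \<sigma>) * ?J" by (simp add: c)
  have "ennreal \<sigma> * half_line_mass K \<le> ennreal \<sigma> * (ennreal (v / \<sigma>) * ?J)"
    by (intro mult_left_mono I) auto
  also have "\<dots> = ennreal v * ?J"
    using assms(2,3) by (simp add: mult.assoc[symmetric] ennreal_mult[symmetric])
  also have "\<dots> \<le> 1 * ?J"
    using assms(4) by (intro mult_right_mono) (auto simp: ennreal_le_1)
  finally show ?thesis by simp
qed

section \<open>Regression functions and the hypercube bound\<close>

text \<open>A label that is a function of the point agrees almost surely with a function measurable for the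
  conditioning sigma-algebra, which is its own conditional expectation.\<close>

lemma noise_free_is_regression:
  assumes "prob_space P" and sets: "sets P = sets borel" and f: "f \<in> borel_measurable borel"
    and ae: "AE z in P. snd z = f (fst z)" and bd: "AE z in P. \<bar>snd z\<bar> \<le> M"
  shows "is_regression P f"
proof -
  interpret prob_space P by fact
  have sp: "space P = UNIV" using sets_eq_imp_space_eq[OF sets] by simp
  let ?F = "vimage_algebra UNIV fst borel :: ((real^'a) \<times> real) measure"
  have fstP: "fst \<in> P \<rightarrow>\<^sub>M borel" and sndP: "snd \<in> borel_measurable P"
    using sets by (simp_all add: measurable_cong_sets[OF sets refl] borel_measurable_continuous_onI
        continuous_on_fst continuous_on_snd)
  have "subalgebra P ?F"
    unfolding subalgebra_def using sets_vimage_algebra_space[of UNIV fst borel]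
    by (auto simp: sp sets_vimage_algebra2 intro!: measurable_sets[OF fstP, unfolded sp, simplified])
  then interpret S: finite_measure_subalgebra P ?F
    by unfold_locales
  have fF: "(\<lambda>z. f (fst z)) \<in> borel_measurable ?F"
    by (rule measurable_compose[OF measurable_vimage_algebra1 f]) auto
  have fP: "(\<lambda>z. f (fst z)) \<in> borel_measurable P"
    by (rule measurable_compose[OF fstP f])
  have "integrable P snd"
    by (rule integrable_const_bound[of _ M]) (use bd sndP in auto)
  then have "integrable P (\<lambda>z. f (fst z))"
    by (rule Bochner_Integration.integrable_cong_AE_imp) (use ae fP in auto)
  then have "AE z in P. real_cond_exp P ?F (\<lambda>z. f (fst z)) z = f (fst z)"
    using fF by (rule S.real_cond_exp_F_meas)
  moreover have "AE z in P. real_cond_exp P ?F snd z = real_cond_exp P ?F (\<lambda>z. f (fst z)) z"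
    by (rule S.real_cond_exp_cong[OF ae sndP fP])
  ultimately have "AE z in P. real_cond_exp P ?F snd z = f (fst z)"
    by eventually_elim simp
  then show ?thesis using f by (simp add: is_regression_def)
qed

lemma regression_AE_eq:
  assumes sets: "sets P = sets borel" and f: "is_regression P f"
  shows "regression P \<in> borel_measurable borel" "AE x in marginal_X P. regression P x = f x"
proof -
  have r: "is_regression P (regression P)"
    unfolding regression_def by (rule someI[of _ f]) (rule f)
  then show m: "regression P \<in> borel_measurable borel" by (simp add: is_regression_def)
  have fstP: "fst \<in> P \<rightarrow>\<^sub>M borel"
    by (simp add: measurable_cong_sets[OF sets refl] borel_measurable_continuous_onI continuous_on_fst)
  have [measurable]: "f \<in> borel_measurable borel" using f by (simp add: is_regression_def)
  note m[measurable]
  have "AE z in P. real_cond_exp P (vimage_algebra UNIV fst borel) snd z = regression P (fst z)"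
    "AE z in P. real_cond_exp P (vimage_algebra UNIV fst borel) snd z = f (fst z)"
    using r f by (simp_all add: is_regression_def)
  then have "AE z in P. regression P (fst z) = f (fst z)"
    by eventually_elim simp
  then show "AE x in marginal_X P. regression P x = f x"
    unfolding marginal_X_def by (subst AE_distr_iff[OF fstP]) measurable
qed

lemma prob_space_marginal_X:
  assumes "prob_space P" "sets P = sets borel"
  shows "prob_space (marginal_X P)"
  unfolding marginal_X_def
  by (rule prob_space.prob_space_distr[OF assms(1)])
    (simp add: measurable_cong_sets[OF assms(2) refl] borel_measurable_continuous_onI continuous_on_fst)

lemma sets_marginal_X [simp, measurable_cong]: "sets (marginal_X P) = sets borel"
  by (simp add: marginal_X_def)

text \<open>A supervised estimator ignores the unlabeled points, which therefore integrate out.\<close>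

lemma supervised_risk:
  fixes P :: "((real^'d) \<times> real) measure" and e :: "(nat \<Rightarrow> (real^'d) \<times> real) \<Rightarrow> real^'d \<Rightarrow> real"
  assumes P: "prob_space P" and sets: "sets P = sets borel" and f: "is_regression P f"
    and e: "(\<lambda>(z, x). e z x) \<in> borel_measurable ((\<Pi>\<^sub>M i\<in>{..<n}. borel) \<Otimes>\<^sub>M borel)"
  shows "risk n m P (\<lambda>(z, u). e z)
    = (\<integral>\<^sup>+z. (\<integral>\<^sup>+x. ennreal ((e z x - f x)\<^sup>2) \<partial>marginal_X P) \<partial>(\<Pi>\<^sub>M i\<in>{..<n}. P))"
proof -
  interpret X: prob_space "marginal_X P" by (rule prob_space_marginal_X[OF P sets])
  interpret U: prob_space "\<Pi>\<^sub>M i\<in>{..<m}. marginal_X P"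
    by (rule prob_space_PiM) (rule X.prob_space_axioms)
  have "sets ((\<Pi>\<^sub>M i\<in>{..<n}. P) \<Otimes>\<^sub>M marginal_X P) = sets ((\<Pi>\<^sub>M i\<in>{..<n}. borel) \<Otimes>\<^sub>M borel)"
    by (intro sets_pair_measure_cong sets_PiM_cong) (auto simp: sets)
  then have [measurable]: "(\<lambda>(z, x). e z x) \<in> borel_measurable ((\<Pi>\<^sub>M i\<in>{..<n}. P) \<Otimes>\<^sub>M marginal_X P)"
    using e by (simp cong: measurable_cong_sets)
  note regression_AE_eq(1)[OF sets f, measurable]
  let ?H = "\<lambda>z. \<integral>\<^sup>+x. ennreal ((e z x - regression P x)\<^sup>2) \<partial>marginal_X P"
  have [measurable]: "?H \<in> borel_measurable (\<Pi>\<^sub>M i\<in>{..<n}. P)"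
    by (rule X.borel_measurable_nn_integral) measurable
  have "risk n m P (\<lambda>(z, u). e z) = (\<integral>\<^sup>+\<omega>. ?H (fst \<omega>) \<partial>sample_law n m P)"
    by (simp add: risk_def split_beta)
  also have "\<dots> = (\<integral>\<^sup>+z. \<integral>\<^sup>+u. ?H z \<partial>(\<Pi>\<^sub>M i\<in>{..<m}. marginal_X P) \<partial>(\<Pi>\<^sub>M i\<in>{..<n}. P))"
    unfolding sample_law_def by (subst U.nn_integral_fst[symmetric]) (simp_all add: split_beta)
  also have "\<dots> = (\<integral>\<^sup>+z. ?H z \<partial>(\<Pi>\<^sub>M i\<in>{..<n}. P))"
    by (simp add: U.emeasure_space_1)
  also have "\<dots> = (\<integral>\<^sup>+z. (\<integral>\<^sup>+x. ennreal ((e z x - f x)\<^sup>2) \<partial>marginal_X P) \<partial>(\<Pi>\<^sub>M i\<in>{..<n}. P))"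
  proof (rule nn_integral_cong, rule nn_integral_cong_AE)
    fix z
    show "AE x in marginal_X P. ennreal ((e z x - regression P x)\<^sup>2) = ennreal ((e z x - f x)\<^sup>2)"
      using regression_AE_eq(2)[OF sets f] by eventually_elim simp
  qed
  finally show ?thesis .
qed

text \<open>Replacing the factors of a product measure by smaller ones decreases all integrals. Applied to
  a common part of two distributions, this bounds both sample laws from below by one measure.\<close>

lemma nn_integral_PiM_mono:
  assumes R: "sigma_finite_measure R" and P: "sigma_finite_measure P" and sets: "sets R = sets P"
    and le: "R \<le> P" and I: "finite I" and \<phi>: "\<phi> \<in> borel_measurable (\<Pi>\<^sub>M i\<in>I. P)"
  shows "(\<integral>\<^sup>+z. \<phi> z \<partial>(\<Pi>\<^sub>M i\<in>I. R)) \<le> (\<integral>\<^sup>+z. \<phi> z \<partial>(\<Pi>\<^sub>M i\<in>I. P))"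
  using I \<phi>
proof (induction I arbitrary: \<phi>)
  case empty
  then show ?case by (simp add: PiM_empty)
next
  case (insert i I)
  interpret R: product_sigma_finite "\<lambda>_. R" by (rule product_sigma_finite.intro) (rule R)
  interpret P: product_sigma_finite "\<lambda>_. P" by (rule product_sigma_finite.intro) (rule P)
  note insert.prems[measurable]
  have "sets (\<Pi>\<^sub>M i\<in>insert i I. R) = sets (\<Pi>\<^sub>M i\<in>insert i I. P)"
    by (rule sets_PiM_cong) (auto simp: sets)
  then have m: "\<phi> \<in> borel_measurable (\<Pi>\<^sub>M i\<in>insert i I. R)"
    using insert.prems by (simp cong: measurable_cong_sets)
  have m2: "(\<lambda>z. \<integral>\<^sup>+y. \<phi> (z(i := y)) \<partial>P) \<in> borel_measurable (\<Pi>\<^sub>M i\<in>I. P)"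
    by (rule sigma_finite_measure.borel_measurable_nn_integral[OF P]) (use insert.hyps in measurable)
  have "(\<integral>\<^sup>+z. \<phi> z \<partial>(\<Pi>\<^sub>M i\<in>insert i I. R)) = (\<integral>\<^sup>+z. (\<integral>\<^sup>+y. \<phi> (z(i := y)) \<partial>R) \<partial>(\<Pi>\<^sub>M i\<in>I. R))"
    by (rule R.product_nn_integral_insert[OF insert.hyps m])
  also have "\<dots> \<le> (\<integral>\<^sup>+z. (\<integral>\<^sup>+y. \<phi> (z(i := y)) \<partial>P) \<partial>(\<Pi>\<^sub>M i\<in>I. R))"
    by (intro nn_integral_mono nn_integral_mono_measure sets le)
  also have "\<dots> \<le> (\<integral>\<^sup>+z. (\<integral>\<^sup>+y. \<phi> (z(i := y)) \<partial>P) \<partial>(\<Pi>\<^sub>M i\<in>I. P))"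
    by (rule insert.IH[OF m2])
  also have "\<dots> = (\<integral>\<^sup>+z. \<phi> z \<partial>(\<Pi>\<^sub>M i\<in>insert i I. P))"
    by (rule P.product_nn_integral_insert[OF insert.hyps insert.prems, symmetric])
  finally show ?case .
qed

lemma emeasure_PiM_space_const:
  assumes "sigma_finite_measure R" "finite I"
  shows "emeasure (\<Pi>\<^sub>M i\<in>I. R) (space (\<Pi>\<^sub>M i\<in>I. R)) = emeasure R (space R) ^ card I"
proof -
  interpret R: product_sigma_finite "\<lambda>_. R" by (rule product_sigma_finite.intro) (rule assms)
  have "(\<integral>\<^sup>+x. (\<Prod>i\<in>I. 1) \<partial>Pi\<^sub>M I (\<lambda>_. R)) = (\<Prod>i\<in>I. (\<integral>\<^sup>+x. 1 \<partial>R))"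
    by (rule R.product_nn_integral_prod[OF assms(2), of "\<lambda>_ _. 1"]) auto
  then show ?thesis by simp
qed

lemma measure_le_prob_finite:
  assumes "prob_space P" "sets R = sets P" "R \<le> P"
  shows "sigma_finite_measure R"
proof -
  interpret prob_space P by fact
  have "emeasure R (space R) \<le> emeasure P (space R)"
    using assms le_measureD3 by auto
  also have "\<dots> \<le> 1" by (rule emeasure_le_1)
  finally have "finite_measure R" by (intro finite_measureI) (auto simp: top_unique)
  then show ?thesis by (rule finite_measure.axioms)
qed

text \<open>Under the product of the common part \<open>R\<close> both hypotheses see the same estimate, and no number is
  close to both \<open>h\<close> and \<open>- h\<close>: the two squared errors add up to at least \<open>2 * h\<^sup>2\<close>.\<close>

lemma two_point_bound:
  fixes P Q R :: "((real^'d) \<times> real) measure" and e :: "(nat \<Rightarrow> (real^'d) \<times> real) \<Rightarrow> real^'d \<Rightarrow> real"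
  assumes P: "prob_space P" "sets P = sets borel" and Q: "prob_space Q" "sets Q = sets borel"
    and R: "sets R = sets borel" "R \<le> P" "R \<le> Q" "r \<le> emeasure R UNIV"
    and \<kappa>: "finite_measure \<kappa>" "sets \<kappa> = sets borel" "v \<le> emeasure \<kappa> UNIV"
    and e: "(\<lambda>(z, x). e z x) \<in> borel_measurable ((\<Pi>\<^sub>M i\<in>{..<n}. borel) \<Otimes>\<^sub>M borel)"
  shows "2 * (ennreal (h\<^sup>2) * v * r ^ n)
    \<le> (\<integral>\<^sup>+z. (\<integral>\<^sup>+x. ennreal ((e z x - - h)\<^sup>2) \<partial>\<kappa>) \<partial>(\<Pi>\<^sub>M i\<in>{..<n}. P))
      + (\<integral>\<^sup>+z. (\<integral>\<^sup>+x. ennreal ((e z x - h)\<^sup>2) \<partial>\<kappa>) \<partial>(\<Pi>\<^sub>M i\<in>{..<n}. Q))"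
proof -
  interpret \<kappa>: finite_measure \<kappa> by fact
  have sf: "sigma_finite_measure R" "sigma_finite_measure P" "sigma_finite_measure Q"
    using measure_le_prob_finite[OF P(1), of R] measure_le_prob_finite[OF P(1), of P]
      measure_le_prob_finite[OF Q(1), of Q] P Q R by auto
  let ?L = "\<lambda>h z. \<integral>\<^sup>+x. ennreal ((e z x - h)\<^sup>2) \<partial>\<kappa>"
  have L: "?L h \<in> borel_measurable (\<Pi>\<^sub>M i\<in>{..<n}. N)" if "sets N = sets borel" for h and N :: "((real^'d) \<times> real) measure"
  proof -
    have "sets ((\<Pi>\<^sub>M i\<in>{..<n}. N) \<Otimes>\<^sub>M \<kappa>) = sets ((\<Pi>\<^sub>M i\<in>{..<n}. borel) \<Otimes>\<^sub>M borel)"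
      by (intro sets_pair_measure_cong sets_PiM_cong) (auto simp: that \<kappa>)
    then have [measurable]: "(\<lambda>(z, x). e z x) \<in> borel_measurable ((\<Pi>\<^sub>M i\<in>{..<n}. N) \<Otimes>\<^sub>M \<kappa>)"
      using e by (simp cong: measurable_cong_sets)
    show ?thesis by (rule \<kappa>.borel_measurable_nn_integral) measurable
  qed
  have pt: "2 * (ennreal (h\<^sup>2) * v) \<le> ?L (- h) z + ?L h z" if z: "z \<in> space (\<Pi>\<^sub>M i\<in>{..<n}. R)" for z
  proof -
    have "z \<in> space (\<Pi>\<^sub>M i\<in>{..<n}. borel)"
      using z R(1) by (simp add: space_PiM sets_eq_imp_space_eq[OF R(1)])
    then have "(\<lambda>x. e z x) \<in> borel_measurable borel"
      using measurable_compose[OF measurable_Pair1' e] by (simp add: split_beta)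
    then have [measurable]: "(\<lambda>x. e z x) \<in> borel_measurable \<kappa>"
      using \<kappa>(2) by (simp cong: measurable_cong_sets)
    have "2 * (ennreal (h\<^sup>2) * v) \<le> 2 * (ennreal (h\<^sup>2) * emeasure \<kappa> UNIV)"
      using \<kappa>(3) by (intro mult_left_mono) auto
    also have "\<dots> = (\<integral>\<^sup>+x. ennreal (2 * h\<^sup>2) \<partial>\<kappa>)"
      using sets_eq_imp_space_eq[OF \<kappa>(2)] by (simp add: ennreal_mult' mult.assoc)
    also have "\<dots> \<le> (\<integral>\<^sup>+x. ennreal ((e z x - - h)\<^sup>2) + ennreal ((e z x - h)\<^sup>2) \<partial>\<kappa>)"
    proof (rule nn_integral_mono)
      fix x
      have "(e z x - - h)\<^sup>2 + (e z x - h)\<^sup>2 = 2 * h\<^sup>2 + 2 * (e z x)\<^sup>2"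
        by (simp add: power2_eq_square algebra_simps)
      then have "2 * h\<^sup>2 \<le> (e z x - - h)\<^sup>2 + (e z x - h)\<^sup>2" by simp
      then show "ennreal (2 * h\<^sup>2) \<le> ennreal ((e z x - - h)\<^sup>2) + ennreal ((e z x - h)\<^sup>2)"
        by (metis ennreal_leI ennreal_plus zero_le_power2)
    qed
    also have "\<dots> = ?L (- h) z + ?L h z" by (rule nn_integral_add) measurable
    finally show ?thesis .
  qed
  have spR: "space R = UNIV" using sets_eq_imp_space_eq[OF R(1)] by simp
  have "2 * (ennreal (h\<^sup>2) * v * r ^ n) = 2 * (ennreal (h\<^sup>2) * v) * r ^ n"
    by (simp add: mult.assoc)
  also have "\<dots> \<le> 2 * (ennreal (h\<^sup>2) * v) * emeasure R UNIV ^ n"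
    using R(4) by (intro mult_left_mono power_mono) auto
  also have "\<dots> = (\<integral>\<^sup>+z. 2 * (ennreal (h\<^sup>2) * v) \<partial>(\<Pi>\<^sub>M i\<in>{..<n}. R))"
    using emeasure_PiM_space_const[OF sf(1), of "{..<n}"] spR by simp
  also have "\<dots> \<le> (\<integral>\<^sup>+z. ?L (- h) z + ?L h z \<partial>(\<Pi>\<^sub>M i\<in>{..<n}. R))"
    by (rule nn_integral_mono) (rule pt)
  also have "\<dots> = (\<integral>\<^sup>+z. ?L (- h) z \<partial>(\<Pi>\<^sub>M i\<in>{..<n}. R)) + (\<integral>\<^sup>+z. ?L h z \<partial>(\<Pi>\<^sub>M i\<in>{..<n}. R))"
    by (rule nn_integral_add) (rule L[OF R(1)])+
  also have "\<dots> \<le> (\<integral>\<^sup>+z. ?L (- h) z \<partial>(\<Pi>\<^sub>M i\<in>{..<n}. P)) + (\<integral>\<^sup>+z. ?L h z \<partial>(\<Pi>\<^sub>M i\<in>{..<n}. Q))"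
    by (intro add_mono nn_integral_PiM_mono sf L) (use P Q R in auto)
  finally show ?thesis .
qed

text \<open>Pairs the vertices of the hypercube along direction \<open>g\<close>.\<close>

lemma sum_Pow_split:
  assumes "finite G" "g \<in> G"
  shows "(\<Sum>T\<in>Pow G. F T) = (\<Sum>T\<in>Pow (G - {g}). F T + F (insert g T))"
proof -
  have "Pow G = Pow (insert g (G - {g}))" using assms by (simp add: insert_absorb)
  also have "\<dots> = Pow (G - {g}) \<union> insert g ` Pow (G - {g})" by (rule Pow_insert)
  finally have "(\<Sum>T\<in>Pow G. F T) = (\<Sum>T\<in>Pow (G - {g}). F T) + (\<Sum>T\<in>insert g ` Pow (G - {g}). F T)"
    using assms by (simp only:) (subst sum.union_disjoint, auto)
  also have "(\<Sum>T\<in>insert g ` Pow (G - {g}). F T) = (\<Sum>T\<in>Pow (G - {g}). F (insert g T))"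
    by (subst sum.reindex) (auto simp: inj_on_def)
  finally show ?thesis by (simp add: sum.distrib)
qed

text \<open>Assouad's method. The supremum of the risk is at least the average over all \<open>T \<subseteq> G\<close>. The risk
  dominates the sum of the errors under the pieces \<open>\<kappa> g\<close>, whose sum lies below every marginal; for
  each \<open>g\<close> the average is taken over pairs \<open>T\<close>, \<open>insert g T\<close>, which
  disagree on \<open>\<kappa> g\<close> and share a common part of mass \<open>r\<close>.\<close>

lemma assouad_bound:
  fixes P :: "'g set \<Rightarrow> ((real^'d) \<times> real) measure" and v r :: ennreal
  assumes G: "finite G" "G \<noteq> {}"
    and P: "\<And>T. T \<subseteq> G \<Longrightarrow> P T \<in> \<P>" "\<And>T. T \<subseteq> G \<Longrightarrow> prob_space (P T)"
      "\<And>T. T \<subseteq> G \<Longrightarrow> sets (P T) = sets borel"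
    and f: "\<And>T. T \<subseteq> G \<Longrightarrow> is_regression (P T) (f T)"
    and \<kappa>: "\<And>g. g \<in> G \<Longrightarrow> finite_measure (\<kappa> g)" "\<And>g. g \<in> G \<Longrightarrow> sets (\<kappa> g) = sets borel"
      "\<And>g. g \<in> G \<Longrightarrow> v \<le> emeasure (\<kappa> g) UNIV"
    and \<kappa>_le: "\<And>T \<phi>. T \<subseteq> G \<Longrightarrow> \<phi> \<in> borel_measurable borel \<Longrightarrow>
        (\<Sum>g\<in>G. \<integral>\<^sup>+x. \<phi> x \<partial>\<kappa> g) \<le> (\<integral>\<^sup>+x. \<phi> x \<partial>marginal_X (P T))"
    and sign: "\<And>T g. T \<subseteq> G \<Longrightarrow> g \<in> G \<Longrightarrow> AE x in \<kappa> g. f T x = (if g \<in> T then h else - h)"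
    and R: "\<And>T g. g \<in> G \<Longrightarrow> T \<subseteq> G - {g} \<Longrightarrow>
        \<exists>R. sets R = sets borel \<and> R \<le> P T \<and> R \<le> P (insert g T) \<and> r \<le> emeasure R UNIV"
  shows "of_nat (card G) * (ennreal (h\<^sup>2) * v * r ^ n) \<le> supervised_minimax_risk n m \<P>"
  unfolding supervised_minimax_risk_def
proof (rule INF_greatest)
  fix F :: "'d sample \<Rightarrow> real^'d \<Rightarrow> real" assume "F \<in> supervised_estimators n"
  then obtain e where F: "F = (\<lambda>(z, u). e z)"
    and e: "(\<lambda>(z, x). e z x) \<in> borel_measurable ((\<Pi>\<^sub>M i\<in>{..<n}. borel) \<Otimes>\<^sub>M borel)"
    unfolding supervised_estimators_def by blast
  let ?B = "ennreal (h\<^sup>2) * v * r ^ n"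
  let ?S = "SUP P\<in>\<P>. risk n m P F"
  define A where "A T g = (\<integral>\<^sup>+z. (\<integral>\<^sup>+x. ennreal ((e z x - (if g \<in> T then h else - h))\<^sup>2) \<partial>\<kappa> g) \<partial>(\<Pi>\<^sub>M i\<in>{..<n}. P T))" for T g
  have risk_ge: "(\<Sum>g\<in>G. A T g) \<le> risk n m (P T) F" if T: "T \<subseteq> G" for T
  proof -
    have fm: "f T \<in> borel_measurable borel" using f[OF T] by (simp add: is_regression_def)
    have "(\<Sum>g\<in>G. A T g) = (\<integral>\<^sup>+z. (\<Sum>g\<in>G. \<integral>\<^sup>+x. ennreal ((e z x - (if g \<in> T then h else - h))\<^sup>2) \<partial>\<kappa> g) \<partial>(\<Pi>\<^sub>M i\<in>{..<n}. P T))"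
      unfolding A_def
    proof (rule nn_integral_sum[symmetric])
      fix g assume g: "g \<in> G"
      interpret \<kappa>: finite_measure "\<kappa> g" by (rule \<kappa>(1)[OF g])
      have "sets ((\<Pi>\<^sub>M i\<in>{..<n}. P T) \<Otimes>\<^sub>M \<kappa> g) = sets ((\<Pi>\<^sub>M i\<in>{..<n}. borel) \<Otimes>\<^sub>M borel)"
        by (intro sets_pair_measure_cong sets_PiM_cong) (auto simp: P(3)[OF T] \<kappa>(2)[OF g])
      then have [measurable]: "(\<lambda>(z, x). e z x) \<in> borel_measurable ((\<Pi>\<^sub>M i\<in>{..<n}. P T) \<Otimes>\<^sub>M \<kappa> g)"
        using e by (simp cong: measurable_cong_sets)
      show "(\<lambda>z. \<integral>\<^sup>+x. ennreal ((e z x - (if g \<in> T then h else - h))\<^sup>2) \<partial>\<kappa> g) \<in> borel_measurable (\<Pi>\<^sub>M i\<in>{..<n}. P T)"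
        by (rule \<kappa>.borel_measurable_nn_integral) measurable
    qed
    also have "\<dots> \<le> (\<integral>\<^sup>+z. (\<integral>\<^sup>+x. ennreal ((e z x - f T x)\<^sup>2) \<partial>marginal_X (P T)) \<partial>(\<Pi>\<^sub>M i\<in>{..<n}. P T))"
    proof (rule nn_integral_mono)
      fix z assume z: "z \<in> space (\<Pi>\<^sub>M i\<in>{..<n}. P T)"
      have "z \<in> space (\<Pi>\<^sub>M i\<in>{..<n}. borel)"
        using z by (simp add: space_PiM sets_eq_imp_space_eq[OF P(3)[OF T]])
      then have [measurable]: "(\<lambda>x. e z x) \<in> borel_measurable borel"
        using measurable_compose[OF measurable_Pair1' e] by (simp add: split_beta)
      have "(\<Sum>g\<in>G. \<integral>\<^sup>+x. ennreal ((e z x - (if g \<in> T then h else - h))\<^sup>2) \<partial>\<kappa> g)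
         = (\<Sum>g\<in>G. \<integral>\<^sup>+x. ennreal ((e z x - f T x)\<^sup>2) \<partial>\<kappa> g)"
      proof (intro sum.cong refl nn_integral_cong_AE)
        fix g assume "g \<in> G"
        from sign[OF T this]
        show "AE x in \<kappa> g. ennreal ((e z x - (if g \<in> T then h else - h))\<^sup>2) = ennreal ((e z x - f T x)\<^sup>2)"
          by eventually_elim simp
      qed
      also have "\<dots> \<le> (\<integral>\<^sup>+x. ennreal ((e z x - f T x)\<^sup>2) \<partial>marginal_X (P T))"
        by (rule \<kappa>_le[OF T]) (use fm in measurable)
      finally show "(\<Sum>g\<in>G. \<integral>\<^sup>+x. ennreal ((e z x - (if g \<in> T then h else - h))\<^sup>2) \<partial>\<kappa> g)
         \<le> (\<integral>\<^sup>+x. ennreal ((e z x - f T x)\<^sup>2) \<partial>marginal_X (P T))" .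
    qed
    also have "\<dots> = risk n m (P T) F"
      unfolding F by (rule supervised_risk[OF P(2)[OF T] P(3)[OF T] f[OF T] e, symmetric])
    finally show ?thesis .
  qed
  have pair: "2 * ?B \<le> A T g + A (insert g T) g" if g: "g \<in> G" and T: "T \<in> Pow (G - {g})" for T g
  proof -
    have sub: "T \<subseteq> G" "insert g T \<subseteq> G" and gT: "g \<notin> T" using g T by auto
    obtain R where "sets R = sets borel" "R \<le> P T" "R \<le> P (insert g T)" "r \<le> emeasure R UNIV"
      using R[OF g, of T] T by auto
    from two_point_bound[OF P(2,3)[OF sub(1)] P(2,3)[OF sub(2)] this \<kappa>[OF g] e, of h]
    show ?thesis using gT by (simp add: A_def)
  qed
  have card: "2 * 2 ^ card (G - {g}) = (2::ennreal) ^ card G" if "g \<in> G" for g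
    using G that by (metis card_Suc_Diff1 power_Suc)
  have "2 ^ card G * (of_nat (card G) * ?B) = (\<Sum>g\<in>G. 2 ^ card G * ?B)"
    by (simp add: mult_ac)
  also have "\<dots> = (\<Sum>g\<in>G. \<Sum>T\<in>Pow (G - {g}). 2 * ?B)"
    by (rule sum.cong[OF refl]) (use G card in \<open>simp add: card_Pow mult_ac flip: card\<close>)
  also have "\<dots> \<le> (\<Sum>g\<in>G. \<Sum>T\<in>Pow (G - {g}). A T g + A (insert g T) g)"
    by (intro sum_mono pair)
  also have "\<dots> = (\<Sum>g\<in>G. \<Sum>T\<in>Pow G. A T g)"
    by (rule sum.cong[OF refl]) (use G in \<open>simp add: sum_Pow_split\<close>)
  also have "\<dots> = (\<Sum>T\<in>Pow G. \<Sum>g\<in>G. A T g)" by (rule sum.swap)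
  also have "\<dots> \<le> (\<Sum>T\<in>Pow G. ?S)"
  proof (rule sum_mono)
    fix T assume "T \<in> Pow G"
    then have "(\<Sum>g\<in>G. A T g) \<le> risk n m (P T) F" "P T \<in> \<P>" using risk_ge P(1) by auto
    then show "(\<Sum>g\<in>G. A T g) \<le> ?S" by (meson SUP_upper2)
  qed
  also have "\<dots> = 2 ^ card G * ?S" using G by (simp add: card_Pow)
  finally have "2 ^ card G * (of_nat (card G) * ?B) \<le> 2 ^ card G * ?S" .
  then show "of_nat (card G) * ?B \<le> ?S"
    by (subst (asm) ennreal_mult_le_mult_iff) (auto simp: power_eq_top_ennreal)
qed

section \<open>Mixtures of curves\<close>

text \<open>Choose an index \<open>j\<close> with weight \<open>w\<close> and a uniform parameter \<open>t\<close>; the point is \<open>c j t\<close> and its label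
  \<open>y j\<close>. The total mass is \<open>card J * w\<close>, so that submixtures with the same \<open>w\<close> are submeasures.\<close>

definition curve_mixture ::
    "real \<Rightarrow> 'j set \<Rightarrow> ('j \<Rightarrow> real \<Rightarrow> real^'d) \<Rightarrow> ('j \<Rightarrow> real) \<Rightarrow> ((real^'d) \<times> real) measure" where
  "curve_mixture w J c y =
     distr (density (count_space J \<Otimes>\<^sub>M lborel) (\<lambda>(j, t). ennreal w * indicator {0..1} t)) borel
       (\<lambda>(j, t). (c j t, y j))"

lemma sets_curve_mixture [simp, measurable_cong]: "sets (curve_mixture w J c y) = sets borel"
  by (simp add: curve_mixture_def)

lemma space_curve_mixture [simp]: "space (curve_mixture w J c y) = UNIV"
  by (simp add: curve_mixture_def)

lemma nn_integral_curve_mixture: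
  assumes J: "finite J" and c: "\<And>j. j \<in> J \<Longrightarrow> c j \<in> borel_measurable borel"
    and \<phi>[measurable]: "\<phi> \<in> borel_measurable borel"
  shows "(\<integral>\<^sup>+z. \<phi> z \<partial>curve_mixture w J c y)
    = (\<Sum>j\<in>J. ennreal w * (\<integral>\<^sup>+t. \<phi> (c j t, y j) * indicator {0..1} t \<partial>lborel))"
proof -
  have cm: "(\<lambda>(j, t). (c j t, y j)) \<in> count_space J \<Otimes>\<^sub>M lborel \<rightarrow>\<^sub>M borel"
  proof (rule measurable_pair_measure_countable1)
    show "countable J" using J by (rule countable_finite)
    fix j assume "j \<in> J"
    from c[OF this] have [measurable]: "c j \<in> borel_measurable borel" .
    show "(\<lambda>t. case (j, t) of (j, t) \<Rightarrow> (c j t, y j)) \<in> lborel \<rightarrow>\<^sub>M borel"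
      by simp
  qed
  have wm: "(\<lambda>(j, t). ennreal w * indicator {0..1} t) \<in> borel_measurable (count_space J \<Otimes>\<^sub>M (lborel :: real measure))"
    by measurable
  have prod: "(\<lambda>x. (case x of (j, t) \<Rightarrow> ennreal w * indicator {0..1} t) * \<phi> (case x of (j, t) \<Rightarrow> (c j t, y j)))
      \<in> borel_measurable (count_space J \<Otimes>\<^sub>M lborel)"
    by (rule borel_measurable_times_ennreal[OF wm measurable_compose[OF cm \<phi>]])
  have "(\<integral>\<^sup>+z. \<phi> z \<partial>curve_mixture w J c y)
      = (\<integral>\<^sup>+x. (case x of (j, t) \<Rightarrow> ennreal w * indicator {0..1} t) * \<phi> (case x of (j, t) \<Rightarrow> (c j t, y j))
          \<partial>(count_space J \<Otimes>\<^sub>M lborel))"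
    unfolding curve_mixture_def
    by (subst nn_integral_distr) (use cm in \<open>auto intro!: nn_integral_density wm measurable_compose[OF cm \<phi>]\<close>)
  also have "\<dots> = (\<integral>\<^sup>+j. \<integral>\<^sup>+t. (ennreal w * indicator {0..1} t) * \<phi> (c j t, y j) \<partial>lborel \<partial>count_space J)"
    by (subst lborel.nn_integral_fst[OF prod, symmetric]) simp
  also have "\<dots> = (\<Sum>j\<in>J. \<integral>\<^sup>+t. (ennreal w * indicator {0..1} t) * \<phi> (c j t, y j) \<partial>lborel)"
    by (rule nn_integral_count_space_finite[OF J])
  also have "\<dots> = (\<Sum>j\<in>J. ennreal w * (\<integral>\<^sup>+t. \<phi> (c j t, y j) * indicator {0..1} t \<partial>lborel))"
  proof (rule sum.cong[OF refl])
    fix j assume "j \<in> J"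
    from c[OF this] have [measurable]: "c j \<in> borel_measurable borel" .
    show "(\<integral>\<^sup>+t. (ennreal w * indicator {0..1} t) * \<phi> (c j t, y j) \<partial>lborel)
       = ennreal w * (\<integral>\<^sup>+t. \<phi> (c j t, y j) * indicator {0..1} t \<partial>lborel)"
      by (subst nn_integral_cmult[symmetric]) (auto simp: mult_ac)
  qed
  finally show ?thesis .
qed

lemma nn_integral_marginal_mixture:
  fixes c :: "'j \<Rightarrow> real \<Rightarrow> real^'d"
  assumes J: "finite J" and c: "\<And>j. j \<in> J \<Longrightarrow> c j \<in> borel_measurable borel"
    and \<phi>[measurable]: "\<phi> \<in> borel_measurable borel"
  shows "(\<integral>\<^sup>+x. \<phi> x \<partial>marginal_X (curve_mixture w J c y))
    = (\<Sum>j\<in>J. ennreal w * (\<integral>\<^sup>+t. \<phi> (c j t) * indicator {0..1} t \<partial>lborel))"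
proof -
  have [measurable]: "fst \<in> borel_measurable (borel :: ((real^'d) \<times> real) measure)"
    by (intro borel_measurable_continuous_onI continuous_on_fst continuous_on_id)
  have "(\<integral>\<^sup>+x. \<phi> x \<partial>marginal_X (curve_mixture w J c y)) = (\<integral>\<^sup>+z. \<phi> (fst z) \<partial>curve_mixture w J c y)"
    unfolding marginal_X_def by (rule nn_integral_distr) measurable
  also have "\<dots> = (\<Sum>j\<in>J. ennreal w * (\<integral>\<^sup>+t. \<phi> (c j t) * indicator {0..1} t \<partial>lborel))"
    by (subst nn_integral_curve_mixture[OF J c]) auto
  finally show ?thesis .
qed

lemma emeasure_curve_mixture_UNIV:
  assumes "finite J" "\<And>j. j \<in> J \<Longrightarrow> c j \<in> borel_measurable borel"
  shows "emeasure (curve_mixture w J c y) UNIV = of_nat (card J) * ennreal w"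
  using nn_integral_curve_mixture[OF assms, where \<phi> = "\<lambda>_. 1" and w = w and y = y] by simp

lemma prob_space_curve_mixture:
  assumes "finite J" "J \<noteq> {}" "\<And>j. j \<in> J \<Longrightarrow> c j \<in> borel_measurable borel"
  shows "prob_space (curve_mixture (1 / card J) J c y)"
proof (rule prob_spaceI)
  have "card J > 0" using assms by (simp add: card_gt_0_iff)
  then show "emeasure (curve_mixture (1 / card J) J c y) (space (curve_mixture (1 / card J) J c y)) = 1"
    using emeasure_curve_mixture_UNIV[OF assms(1,3)]
    by (simp add: ennreal_of_nat_eq_real_of_nat ennreal_mult[symmetric])
qed

lemma AE_curve_mixture:
  assumes J: "finite J" and c: "\<And>j. j \<in> J \<Longrightarrow> c j \<in> borel_measurable borel"
    and m: "{z. Q z} \<in> sets borel" and Q: "\<And>j t. j \<in> J \<Longrightarrow> t \<in> {0..1} \<Longrightarrow> Q (c j t, y j)"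
  shows "AE z in curve_mixture w J c y. Q z"
proof -
  have m': "- {z. Q z} \<in> sets borel" using m by auto
  have "emeasure (curve_mixture w J c y) (- {z. Q z}) = (\<integral>\<^sup>+z. indicator (- {z. Q z}) z \<partial>curve_mixture w J c y)"
    using m' by (simp add: nn_integral_indicator)
  also have "\<dots> = (\<Sum>j\<in>J. ennreal w * (\<integral>\<^sup>+t. indicator (- {z. Q z}) (c j t, y j) * indicator {0..1} t \<partial>lborel))"
    by (rule nn_integral_curve_mixture[OF J c]) (use m' in \<open>auto\<close>)
  also have "\<dots> = (\<Sum>j\<in>J. ennreal w * (\<integral>\<^sup>+t. 0 \<partial>(lborel :: real measure)))"
  proof (intro sum.cong refl arg_cong2[where f = "(*)"] nn_integral_cong)
    fix j t assume "j \<in> J"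
    then show "indicator (- {z. Q z}) (c j t, y j) * indicator {0..1} t = (0::ennreal)"
      using Q[of j t] by (auto simp: indicator_def)
  qed
  finally have "emeasure (curve_mixture w J c y) (- {z. Q z}) = 0" by simp
  then show ?thesis using m' by (intro AE_I[of _ _ "- {z. Q z}"]) auto
qed

lemma curve_mixture_mono:
  fixes c :: "'j \<Rightarrow> real \<Rightarrow> real^'d"
  assumes J: "finite J" and c: "\<And>j. j \<in> J \<Longrightarrow> c j \<in> borel_measurable borel"
    and J': "J' \<subseteq> J" and eq: "\<And>j. j \<in> J' \<Longrightarrow> c' j = c j \<and> y' j = y j"
  shows "curve_mixture w J' c' y' \<le> curve_mixture w J c y"
proof -
  have fin: "finite J'" using J J' by (rule rev_finite_subset)
  have "emeasure (curve_mixture w J' c' y') A \<le> emeasure (curve_mixture w J c y) A" if A: "A \<in> sets borel" for A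
  proof -
    have [measurable]: "indicator A \<in> borel_measurable (borel :: ((real^'d) \<times> real) measure)"
      using A by simp
    let ?I = "\<lambda>j. ennreal w * (\<integral>\<^sup>+t. indicator A (c j t, y j) * indicator {0..1} t \<partial>lborel)"
    have "emeasure (curve_mixture w J' c' y') A = (\<integral>\<^sup>+z. indicator A z \<partial>curve_mixture w J' c' y')"
      using A by (simp add: nn_integral_indicator)
    also have "\<dots> = (\<Sum>j\<in>J'. ?I j)"
      by (subst nn_integral_curve_mixture[OF fin]) (use c J' eq in auto)
    also have "\<dots> \<le> (\<Sum>j\<in>J. ?I j)" by (rule sum_mono2) (use J J' in auto)
    also have "\<dots> = (\<integral>\<^sup>+z. indicator A z \<partial>curve_mixture w J c y)"
      by (rule nn_integral_curve_mixture[OF J c, symmetric]) auto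
    also have "\<dots> = emeasure (curve_mixture w J c y) A"
      using A by (simp add: nn_integral_indicator)
    finally show ?thesis .
  qed
  then show ?thesis by (subst le_measure) auto
qed

lemma measure_support_curve_mixture:
  assumes J: "finite J" and c: "\<And>j. j \<in> J \<Longrightarrow> continuous_on UNIV (c j)"
  shows "measure_support (marginal_X (curve_mixture w J c y)) \<subseteq> (\<Union>j\<in>J. c j ` {0..1})"
proof
  fix x assume x: "x \<in> measure_support (marginal_X (curve_mixture w J c y))"
  let ?S = "\<Union>j\<in>J. c j ` {0..1}"
  have "compact ?S"
    by (intro compact_UN J compact_continuous_image) (auto intro: continuous_on_subset[OF c])
  then have op: "open (- ?S)" by (intro open_Compl compact_imp_closed)
  have cm: "c j \<in> borel_measurable borel" if "j \<in> J" for j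
    by (rule borel_measurable_continuous_onI[OF c[OF that]])
  show "x \<in> ?S"
  proof (rule ccontr)
    assume "x \<notin> ?S"
    then have "emeasure (marginal_X (curve_mixture w J c y)) (- ?S) > 0"
      using x op unfolding measure_support_def by blast
    moreover have "emeasure (marginal_X (curve_mixture w J c y)) (- ?S) = (\<integral>\<^sup>+x. indicator (- ?S) x \<partial>marginal_X (curve_mixture w J c y))"
      using op by (simp add: nn_integral_indicator borel_open)
    moreover have "\<dots> = (\<Sum>j\<in>J. ennreal w * (\<integral>\<^sup>+t. indicator (- ?S) (c j t) * indicator {0..1} t \<partial>lborel))"
      by (rule nn_integral_marginal_mixture[OF J cm borel_measurable_indicator[OF borel_open[OF op]]])
    moreover have "\<dots> = (\<Sum>j\<in>J. ennreal w * (\<integral>\<^sup>+t. 0 \<partial>(lborel :: real measure)))"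
      by (intro sum.cong refl arg_cong2[where f = "(*)"] nn_integral_cong) (force simp: indicator_def)
    ultimately show False by simp
  qed
qed

lemma shifted_kernel_measurable:
  assumes "is_kernel (radial K :: real^'d \<Rightarrow> real)" "\<sigma> > 0"
  shows "(\<lambda>(x :: real^'d, u). ennreal (K (norm (x - u) / \<sigma>) / \<sigma> ^ CARD('d))) \<in> borel_measurable (borel \<Otimes>\<^sub>M borel)"
proof -
  note [measurable] = kernel_profile_measurable[OF assms(1)]
  have "(\<lambda>(x :: real^'d, u). ennreal (K \<bar>norm (x - u) / \<sigma>\<bar> / \<sigma> ^ CARD('d))) \<in> borel_measurable (borel \<Otimes>\<^sub>M borel)"
    by measurable
  then show ?thesis using assms(2) by (simp add: abs_of_nonneg)
qed

lemma smoothed_density_mixture: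
  assumes "is_kernel (radial K :: real^'d \<Rightarrow> real)" "\<sigma> > 0"
    and J: "finite J" and c: "\<And>j. j \<in> J \<Longrightarrow> (c j :: real \<Rightarrow> real^'d) \<in> borel_measurable borel"
  shows "smoothed_density K (curve_mixture w J c y) \<sigma> x = (\<Sum>j\<in>J. ennreal w *
     (\<integral>\<^sup>+t. ennreal (K (norm (x - c j t) / \<sigma>) / \<sigma> ^ CARD('d)) * indicator {0..1} t \<partial>lborel))"
  unfolding smoothed_density_def
proof (rule nn_integral_marginal_mixture[OF J c])
  show "(\<lambda>u. ennreal (K (norm (x - u) / \<sigma>) / \<sigma> ^ CARD('d))) \<in> borel_measurable borel"
    using measurable_compose[OF measurable_Pair1' shifted_kernel_measurable[OF assms(1,2)], of x] by simp
qed

lemma smoothed_density_mixture_eq_0: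
  assumes K: "is_kernel (radial K :: real^'d \<Rightarrow> real)" and \<sigma>: "\<sigma> > 0"
    and J: "finite J" and c: "\<And>j. j \<in> J \<Longrightarrow> (c j :: real \<Rightarrow> real^'d) \<in> borel_measurable borel"
    and far: "\<And>j t. j \<in> J \<Longrightarrow> t \<in> {0..1} \<Longrightarrow>
      \<sigma> * diameter (kernel_support (radial K :: real^'d \<Rightarrow> real)) < 2 * dist x (c j t)"
  shows "smoothed_density K (curve_mixture w J c y) \<sigma> x = 0"
proof -
  have "K (norm (x - c j t) / \<sigma>) = 0" if "j \<in> J" "t \<in> {0..1}" for j t
  proof (rule ccontr)
    assume "K (norm (x - c j t) / \<sigma>) \<noteq> 0"
    then have "2 * (norm (x - c j t) / \<sigma>) \<le> diameter (kernel_support (radial K :: real^'d \<Rightarrow> real))"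
      using \<sigma> by (intro kernel_radius[OF K]) auto
    then show False using far[OF that] \<sigma> by (simp add: field_simps dist_norm)
  qed
  then have "(\<integral>\<^sup>+t. ennreal (K (norm (x - c j t) / \<sigma>) / \<sigma> ^ CARD('d)) * indicator {0..1} t \<partial>lborel)
      = (\<integral>\<^sup>+t. 0 \<partial>(lborel :: real measure))" if "j \<in> J" for j
    using that by (intro nn_integral_cong) (auto simp: indicator_def)
  then show ?thesis
    by (simp add: smoothed_density_mixture[OF K \<sigma> J c])
qed

text \<open>Although the mixture lives on segments, smoothing at scale \<open>\<sigma>\<close> gives density of order
  \<open>w / \<sigma> ^ (d - 1)\<close> at each point of a segment of weight \<open>w\<close>, the end points included: a
  neighbourhood of size \<open>\<sigma>\<close> contains a piece of length of order \<open>\<sigma>\<close> and mass of order \<open>w * \<sigma>\<close>.\<close>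

lemma smoothed_density_segment_ge:
  assumes K: "is_kernel (radial K :: real^'d \<Rightarrow> real)" and \<sigma>: "\<sigma> > 0"
    and J: "finite J" and c: "\<And>j. j \<in> J \<Longrightarrow> (c j :: real \<Rightarrow> real^'d) \<in> borel_measurable borel"
    and j: "j \<in> J" and seg: "\<And>t. c j t = a + t *\<^sub>R b" and b: "0 < norm b" "norm b \<le> 1"
    and \<sigma>b: "\<sigma> * diameter (kernel_support (radial K :: real^'d \<Rightarrow> real)) \<le> norm b" and t0: "t0 \<in> {0..1}"
  shows "ennreal w * (ennreal (\<sigma> / \<sigma> ^ CARD('d)) * half_line_mass K)
    \<le> smoothed_density K (curve_mixture w J c y) \<sigma> (c j t0)"
proof -
  note [measurable] = kernel_profile_measurable[OF K]
  let ?N = "ennreal (1 / \<sigma> ^ CARD('d))"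
  have "ennreal (\<sigma> / \<sigma> ^ CARD('d)) * half_line_mass K = ?N * (ennreal \<sigma> * half_line_mass K)"
    using \<sigma> by (simp add: mult.assoc[symmetric] ennreal_mult[symmetric])
  also have "\<dots> \<le> ?N * (\<integral>\<^sup>+t. ennreal (K (\<bar>t - t0\<bar> * norm b / \<sigma>)) * indicator {0..1} t \<partial>lborel)"
    by (intro mult_left_mono smoothed_segment_ge[OF K \<sigma> b \<sigma>b t0]) auto
  also have "\<dots> = (\<integral>\<^sup>+t. ennreal (K (norm (c j t0 - c j t) / \<sigma>) / \<sigma> ^ CARD('d)) * indicator {0..1} t \<partial>lborel)"
  proof -
    have n: "norm (c j t0 - c j t) = \<bar>t - t0\<bar> * norm b" for t
    proof -
      have "c j t0 - c j t = (t0 - t) *\<^sub>R b" by (simp add: seg scaleR_left_diff_distrib)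
      then show ?thesis by (simp add: abs_minus_commute)
    qed
    have "(\<lambda>t. K \<bar>\<bar>t - t0\<bar> * norm b / \<sigma>\<bar>) \<in> borel_measurable borel" by measurable
    then have [measurable]: "(\<lambda>t. K (\<bar>t - t0\<bar> * norm b / \<sigma>)) \<in> borel_measurable borel"
      using \<sigma> by (simp add: abs_mult)
    have "ennreal (K (\<bar>t - t0\<bar> * norm b / \<sigma>) / \<sigma> ^ CARD('d)) = ?N * ennreal (K (\<bar>t - t0\<bar> * norm b / \<sigma>))" for t
      using \<sigma> kernel_nonneg[OF K, of "\<bar>t - t0\<bar> * norm b / \<sigma>"] by (subst ennreal_mult[symmetric]) auto
    then show ?thesis
      unfolding n by (subst nn_integral_cmult[symmetric]) (auto simp: mult.assoc)
  qed
  finally have "ennreal w * (ennreal (\<sigma> / \<sigma> ^ CARD('d)) * half_line_mass K) \<le> ennreal w *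
      (\<integral>\<^sup>+t. ennreal (K (norm (c j t0 - c j t) / \<sigma>) / \<sigma> ^ CARD('d)) * indicator {0..1} t \<partial>lborel)"
    by (intro mult_left_mono) auto
  also have "\<dots> \<le> (\<Sum>i\<in>J. ennreal w *
      (\<integral>\<^sup>+t. ennreal (K (norm (c j t0 - c i t) / \<sigma>) / \<sigma> ^ CARD('d)) * indicator {0..1} t \<partial>lborel))"
    by (rule member_le_sum[OF j _ J]) auto
  also have "\<dots> = smoothed_density K (curve_mixture w J c y) \<sigma> (c j t0)"
    by (rule smoothed_density_mixture[OF K \<sigma> J c, symmetric])
  finally show ?thesis .
qed

lemma exp_weight_nonneg: "0 \<le> exp_weight \<alpha> p"
  by (simp add: exp_weight_def)

lemma exp_weight_le_1: "0 \<le> \<alpha> \<Longrightarrow> exp_weight \<alpha> p \<le> 1"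
  by (simp add: exp_weight_def)

lemma exp_weight_zero [simp]: "exp_weight \<alpha> 0 = 1" "exp_weight 0 p = 1"
  by (auto simp: exp_weight_def)

text \<open>An infinite density is harmless, since the weight is then zero or \<open>\<alpha>\<close> is zero.\<close>

lemma exp_weight_le:
  assumes "0 \<le> \<alpha>" "0 \<le> \<rho>" "ennreal \<rho> \<le> p"
  shows "exp_weight \<alpha> p \<le> exp (- \<alpha> * \<rho>)"
proof (cases "p = \<infinity>")
  case False
  then have "\<rho> \<le> enn2real p" using assms(2,3) enn2real_mono[OF assms(3)] by (simp add: less_top)
  then show ?thesis using False assms(1) by (simp add: exp_weight_def mult_left_mono)
qed (use assms in \<open>auto simp: exp_weight_def\<close>)

definition density_weight ::
    "(real \<Rightarrow> real) \<Rightarrow> ((real^'d) \<times> real) measure \<Rightarrow> real \<Rightarrow> real \<Rightarrow> real^'d \<Rightarrow> real" where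
  "density_weight K P \<alpha> \<sigma> x = exp_weight \<alpha> (smoothed_density K P \<sigma> x)"

lemma density_dist_eq_weighted:
  "density_dist K P \<alpha> \<sigma> x y = weighted_dist (density_weight K P \<alpha> \<sigma>) x y"
  by (simp add: density_dist_def weighted_dist_def density_weight_def)

lemma path_weight_density_weight:
  fixes P :: "((real^'d) \<times> real) measure"
  assumes K: "is_kernel (radial K :: real^'d \<Rightarrow> real)" and \<sigma>: "\<sigma> > 0" and \<alpha>: "\<alpha> \<ge> 0"
    and P: "prob_space P" "sets P = sets borel"
  shows "path_weight (density_weight K P \<alpha> \<sigma>)"
proof
  interpret X: prob_space "marginal_X P" by (rule prob_space_marginal_X[OF P])
  note [measurable] = shifted_kernel_measurable[OF K \<sigma>]
  have [measurable]: "smoothed_density K P \<sigma> \<in> borel_measurable borel"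
    unfolding smoothed_density_def[abs_def]
    by (rule X.borel_measurable_nn_integral) measurable
  have [measurable]: "exp_weight \<alpha> \<in> borel_measurable borel"
    unfolding exp_weight_def[abs_def] by measurable
  show "density_weight K P \<alpha> \<sigma> \<in> borel_measurable borel"
    unfolding density_weight_def[abs_def] by measurable
qed (simp_all add: density_weight_def exp_weight_nonneg exp_weight_le_1 \<alpha>)

lemma covering_number_le:
  assumes "finite A" "A \<subseteq> cube"
    and "\<And>z. z \<in> measure_support (marginal_X P) \<Longrightarrow> \<exists>x\<in>A. density_dist K P \<alpha> \<sigma> x z \<le> \<epsilon>"
  shows "covering_number K P \<alpha> \<sigma> \<epsilon> \<le> card A"
  unfolding covering_number_def
  by (rule cInf_lower) (use assms in \<open>auto intro!: exI[of _ A]\<close>)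

lemma cube_closed: "closed (cube :: (real^'d) set)"
proof -
  have "cube = (\<Inter>i. {x :: real^'d. 0 \<le> x $ i} \<inter> {x. x $ i \<le> 1})" by (auto simp: cube_def)
  moreover have "closed \<dots>"
    by (intro closed_INT ballI closed_Int closed_Collect_le continuous_intros)
  ultimately show ?thesis by simp
qed

lemma mixture_regression_class:
  fixes c :: "'j \<Rightarrow> real \<Rightarrow> real^'d"
  assumes J: "finite J" "J \<noteq> {}" and c: "\<And>j. j \<in> J \<Longrightarrow> continuous_on UNIV (c j)"
    and cube: "\<And>j t. j \<in> J \<Longrightarrow> t \<in> {0..1} \<Longrightarrow> c j t \<in> cube"
    and y: "\<And>j. j \<in> J \<Longrightarrow> \<bar>y j\<bar> \<le> M"
    and f: "f \<in> borel_measurable borel" "\<And>j t. j \<in> J \<Longrightarrow> t \<in> {0..1} \<Longrightarrow> f (c j t) = y j"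
    and lip: "\<And>u v. \<bar>f u - f v\<bar> \<le> L * density_dist K (curve_mixture (1 / card J) J c y) \<alpha> \<sigma> u v"
  shows "is_regression (curve_mixture (1 / card J) J c y) f"
    and "curve_mixture (1 / card J) J c y \<in> lipschitz_class K M \<alpha> \<sigma> L"
proof -
  let ?P = "curve_mixture (1 / card J) J c y"
  note f(1)[measurable]
  have [measurable]: "fst \<in> borel_measurable (borel :: ((real^'d) \<times> real) measure)"
    "snd \<in> borel_measurable (borel :: ((real^'d) \<times> real) measure)"
    by (auto intro!: borel_measurable_continuous_onI continuous_on_fst continuous_on_snd)
  have cm: "c j \<in> borel_measurable borel" if "j \<in> J" for j
    by (rule borel_measurable_continuous_onI[OF c[OF that]])
  have P: "prob_space ?P" by (rule prob_space_curve_mixture[OF J cm])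
  have bd: "AE z in ?P. \<bar>snd z\<bar> \<le> M"
    by (rule AE_curve_mixture[OF J(1) cm]) (auto simp: y)
  have "AE z in ?P. snd z = f (fst z)"
    by (rule AE_curve_mixture[OF J(1) cm]) (auto simp: f)
  then show reg: "is_regression ?P f"
    by (intro noise_free_is_regression[OF P _ f(1) _ bd]) auto
  have "AE z in ?P. fst z \<in> cube"
  proof (rule AE_curve_mixture[OF J(1) cm])
    have "closed (fst -` cube :: ((real^'d) \<times> real) set)"
      by (rule closed_vimage[OF cube_closed]) (intro continuous_on_fst continuous_on_id)
    then show "{z :: (real^'d) \<times> real. fst z \<in> cube} \<in> sets borel"
      by (simp add: vimage_def borel_closed)
  qed (auto simp: cube)
  then show "?P \<in> lipschitz_class K M \<alpha> \<sigma> L"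
    unfolding lipschitz_class_def using P bd reg lip by auto
qed

section \<open>The spiked cube\<close>

text \<open>Grid points of the bottom face, \<open>v\<close> being the vertical direction.\<close>

definition base_grid :: "'d \<Rightarrow> nat \<Rightarrow> (real^'d) set" where
  "base_grid v q = (\<lambda>u. \<chi> k. if k = v then 0 else real (u k) / real q) ` (UNIV - {v} \<rightarrow>\<^sub>E {..<q})"

lemma finite_base_grid: "finite (base_grid v q)"
  unfolding base_grid_def by (intro finite_imageI finite_PiE) auto

lemma card_base_grid:
  assumes "q > 0"
  shows "card (base_grid (v :: 'd) q :: (real^'d) set) = q ^ (CARD('d) - 1)"
proof -
  have "inj_on (\<lambda>u. \<chi> k. if k = v then 0 else real (u k) / real q) (UNIV - {v :: 'd} \<rightarrow>\<^sub>E {..<q})"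
  proof (rule inj_onI)
    fix u u' :: "'d \<Rightarrow> nat"
    assume u: "u \<in> UNIV - {v} \<rightarrow>\<^sub>E {..<q}" "u' \<in> UNIV - {v} \<rightarrow>\<^sub>E {..<q}"
      and eq: "(\<chi> k. if k = v then 0 else real (u k) / real q) = (\<chi> k. if k = v then 0 else real (u' k) / real q)"
    show "u = u'"
    proof (rule PiE_ext[OF u])
      fix k assume "k \<in> UNIV - {v}"
      moreover have "(\<chi> k. if k = v then 0 else real (u k) / real q) $ k = (\<chi> k. if k = v then 0 else real (u' k) / real q) $ k"
        by (simp only: eq)
      ultimately show "u k = u' k" using assms by simp
    qed
  qed
  then have "card (base_grid v q) = card (UNIV - {v} \<rightarrow>\<^sub>E {..<q})"
    unfolding base_grid_def by (rule card_image)
  also have "\<dots> = q ^ (CARD('d) - 1)" by (simp add: card_PiE)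
  finally show ?thesis .
qed

lemma base_grid_coords:
  assumes "g \<in> base_grid v q" "q > 0"
  shows "g $ v = 0" "0 \<le> g $ k" "g $ k < 1"
proof -
  obtain u where u: "u \<in> UNIV - {v} \<rightarrow>\<^sub>E {..<q}" and g: "g = (\<chi> k. if k = v then 0 else real (u k) / real q)"
    using assms(1) by (auto simp: base_grid_def)
  show "g $ v = 0" "0 \<le> g $ k" by (auto simp: g)
  show "g $ k < 1"
  proof (cases "k = v")
    case False
    then have "u k < q" using u by (auto dest: PiE_mem)
    then show ?thesis using False assms(2) by (simp add: g)
  qed (simp add: g)
qed

lemma base_grid_separated:
  assumes "g \<in> base_grid v q" "g' \<in> base_grid v q" "g \<noteq> g'" "q > 0"
  obtains k where "k \<noteq> v" "1 / real q \<le> \<bar>g $ k - g' $ k\<bar>"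
proof -
  obtain u where g: "g = (\<chi> k. if k = v then 0 else real (u k) / real q)"
    using assms(1) by (auto simp: base_grid_def)
  obtain u' where g': "g' = (\<chi> k. if k = v then 0 else real (u' k) / real q)"
    using assms(2) by (auto simp: base_grid_def)
  obtain k where k: "g $ k \<noteq> g' $ k" using assms(3) by (auto simp: vec_eq_iff)
  then have kv: "k \<noteq> v" by (auto simp: g g')
  then have "u k \<noteq> u' k" using k by (auto simp: g g')
  then have "1 \<le> \<bar>real (u k) - real (u' k)\<bar>" by linarith
  then have "1 / real q \<le> \<bar>real (u k) - real (u' k)\<bar> / real q"
    using assms(4) by (intro divide_right_mono) auto
  also have "\<dots> = \<bar>g $ k - g' $ k\<bar>"
    using kv assms(4) by (simp add: g g' diff_divide_distrib[symmetric] abs_divide)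
  finally show thesis using that kv by blast
qed

text \<open>Closure under zeroing coordinates keeps the paths that change one coordinate at a time inside
  the grid lines.\<close>

lemma base_grid_restrict:
  assumes "g \<in> base_grid v q" "q > 0"
  shows "(\<chi> k. if k \<in> A then g $ k else 0) \<in> base_grid v q"
proof -
  obtain u where u: "u \<in> UNIV - {v} \<rightarrow>\<^sub>E {..<q}" and g: "g = (\<chi> k. if k = v then 0 else real (u k) / real q)"
    using assms(1) by (auto simp: base_grid_def)
  define u' where "u' = (\<lambda>k. if k = v then undefined else if k \<in> A then u k else 0)"
  show ?thesis
    unfolding base_grid_def
  proof (rule image_eqI[of _ _ u'])
    show "u' \<in> UNIV - {v} \<rightarrow>\<^sub>E {..<q}"
      using u assms(2) by (auto simp: PiE_iff extensional_def u'_def)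
    show "(\<chi> k. if k \<in> A then g $ k else 0) = (\<chi> k. if k = v then 0 else real (u' k) / real q)"
      by (auto simp: vec_eq_iff g u'_def)
  qed
qed

lemma zero_in_base_grid:
  assumes "q > 0"
  shows "0 \<in> base_grid v q"
proof -
  have "base_grid v q \<noteq> {}" unfolding base_grid_def using assms by (auto simp: PiE_eq_empty_iff)
  then obtain g where "g \<in> base_grid v q" by blast
  from base_grid_restrict[OF this assms, of "{}"] show ?thesis by (simp add: zero_vec_def)
qed

text \<open>An edge \<open>(g, b, i)\<close> runs in direction \<open>i\<close> through the grid point \<open>g\<close>. For \<open>i \<noteq> v\<close> it is a grid line of
  the top face (\<open>b\<close> true) or of the bottom face, counted once for each grid point on it. For
  \<open>i = v\<close> it is the spine over \<open>g\<close>, counted once for each \<open>b\<close>. The repetitions make the index set a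
  product and cost only constant factors.\<close>

type_synonym 'd edge = "(real^'d) \<times> bool \<times> 'd"

definition edges :: "'d::finite \<Rightarrow> nat \<Rightarrow> 'd edge set" where
  "edges v q = base_grid v q \<times> UNIV \<times> UNIV"

text \<open>Whether the edge belongs to the upper of the two pieces.\<close>

fun raised :: "'d::finite \<Rightarrow> (real^'d) set \<Rightarrow> 'd edge \<Rightarrow> bool" where
  "raised v T (g, b, i) = (if i = v then g \<in> T else b)"

text \<open>The two positions of a spine differ by a vertical shift of \<open>1 / q\<close> only: they share the heights from
  \<open>1 / q\<close> to \<open>1 - 1 / q\<close>, and either way the spine stays \<open>1 / q\<close> away from one face.\<close>

fun edge_point :: "'d::finite \<Rightarrow> nat \<Rightarrow> (real^'d) set \<Rightarrow> 'd edge \<Rightarrow> real \<Rightarrow> real^'d" where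
  "edge_point v q T (g, b, i) t =
     (if i = v then \<chi> k. if k = v then (if g \<in> T then 1 / real q else 0) + t * (1 - 1 / real q) else g $ k
      else \<chi> k. if k = i then t else if k = v then of_bool b else g $ k)"

definition edge_length :: "'d::finite \<Rightarrow> nat \<Rightarrow> 'd edge \<Rightarrow> real" where
  "edge_length v q = (\<lambda>(g, b, i). if i = v then 1 - 1 / real q else 1)"

definition edge_vector :: "'d::finite \<Rightarrow> nat \<Rightarrow> 'd edge \<Rightarrow> real^'d" where
  "edge_vector v q = (\<lambda>(g, b, i). edge_length v q (g, b, i) *\<^sub>R axis i 1)"

lemma finite_edges: "finite (edges v q)"
  by (simp add: edges_def finite_base_grid)

lemma card_edges:
  assumes "q > 0"
  shows "card (edges (v :: 'd::finite) q) = 2 * CARD('d) * q ^ (CARD('d) - 1)"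
  by (simp add: edges_def card_cartesian_product card_base_grid[OF assms] card_UNIV_bool)

lemma edge_point_affine: "edge_point v q T j t = edge_point v q T j 0 + t *\<^sub>R edge_vector v q j"
  by (cases j) (auto simp: vec_eq_iff edge_vector_def edge_length_def axis_def)

lemma norm_edge_vector: "q \<ge> 1 \<Longrightarrow> norm (edge_vector v q j) = edge_length v q j"
  by (cases j) (auto simp: edge_vector_def norm_axis_1 edge_length_def)

lemma edge_length_bounds: "q \<ge> 2 \<Longrightarrow> 1/2 \<le> edge_length v q j" "q \<ge> 2 \<Longrightarrow> edge_length v q j \<le> 1"
  by (cases j; simp add: edge_length_def field_simps)+

lemma continuous_edge_point: "continuous_on UNIV (edge_point v q T j)"
proof -
  have "continuous_on UNIV (\<lambda>t. edge_point v q T j 0 + t *\<^sub>R edge_vector v q j)"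
    by (intro continuous_intros)
  then show ?thesis by (rule continuous_on_cong[THEN iffD1, rotated -1]) (simp_all add: edge_point_affine[symmetric])
qed

lemma edge_point_in_cube:
  assumes "j \<in> edges v q" "t \<in> {0..1}" "q \<ge> 1"
  shows "edge_point v q T j t \<in> cube"
proof -
  obtain g b i where j: "j = (g, b, i)" by (cases j)
  then have g: "g \<in> base_grid v q" using assms(1) by (simp add: edges_def)
  have co: "0 \<le> g $ k" "g $ k \<le> 1" for k
    using base_grid_coords(2,3)[OF g, of k] assms(3) by auto
  have q: "0 \<le> 1 - 1 / real q" "0 \<le> 1 / real q" using assms(3) by auto
  define s where "s = t * (1 - 1 / real q)"
  have "0 \<le> s" "s \<le> 1 - 1 / real q"
    using assms(2) q mult_right_mono[of t 1 "1 - 1 / real q"] by (auto simp: s_def)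
  then have "0 \<le> s" "s \<le> 1" "0 \<le> 1 / real q + s" "1 / real q + s \<le> 1"
    using q by linarith+
  then show ?thesis using co assms(2) by (auto simp: j cube_def s_def)
qed

text \<open>The two pieces differ by at least \<open>1 / q\<close> in some coordinate: in the vertical one if a face is involved,
  because every spine ends \<open>1 / q\<close> short of the opposite face, and in a horizontal one for two
  different spines.\<close>

lemma edges_separated:
  assumes j: "j \<in> edges v q" "raised v T j" and j': "j' \<in> edges v q" "\<not> raised v T j'"
    and t: "t \<in> {0..1}" "t' \<in> {0..1}" and q: "q \<ge> 1"
  shows "1 / real q \<le> dist (edge_point v q T j t) (edge_point v q T j' t')"
proof -
  obtain g b i where J: "j = (g, b, i)" by (cases j)
  obtain g' b' i' where J': "j' = (g', b', i')" by (cases j')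
  have g: "g \<in> base_grid v q" "g' \<in> base_grid v q" using j j' by (auto simp: J J' edges_def)
  have by_coord: ?thesis if "1 / real q \<le> \<bar>edge_point v q T j t $ k - edge_point v q T j' t' $ k\<bar>" for k
    using that component_le_norm_cart[of "edge_point v q T j t - edge_point v q T j' t'" k]
    by (simp add: dist_norm)
  have q': "0 \<le> 1 - 1 / real q" "1 / real q \<le> 1" using q by auto
  have tq: "0 \<le> s * (1 - 1 / real q)" "s * (1 - 1 / real q) \<le> 1 - 1 / real q" if "s \<in> {0..1}" for s
    using that q' mult_right_mono[of s 1 "1 - 1 / real q"] by auto
  show ?thesis
  proof (cases "i = v \<and> i' = v")
    case True
    then have "g \<noteq> g'" using j j' by (auto simp: J J')
    then obtain k where "k \<noteq> v" "1 / real q \<le> \<bar>g $ k - g' $ k\<bar>"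
      using base_grid_separated[OF g] q by auto
    then show ?thesis using True by (intro by_coord[of k]) (simp add: J J')
  next
    case False
    show ?thesis
      by (rule by_coord[of v]) (use False j j' tq[OF t(1)] tq[OF t(2)] q' in \<open>auto simp: J J' split: if_splits\<close>)
  qed
qed

definition corner :: "'d \<Rightarrow> bool \<Rightarrow> real^'d" where
  "corner v b = (\<chi> k. if k = v then of_bool b else 0)"

context path_weight
begin

context
  fixes v :: 'd and q :: nat and T :: "(real^'d) set" and w :: real
  assumes q: "q \<ge> 2" and w: "0 \<le> w"
    and small: "\<And>j t. j \<in> edges v q \<Longrightarrow> t \<in> {0..1} \<Longrightarrow> W (edge_point v q T j t) \<le> w"
begin

lemma weighted_dist_edge:
  assumes j: "j \<in> edges v q" and st: "s \<in> {0..1}" "t \<in> {0..1}"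
  shows "weighted_dist W (edge_point v q T j s) (edge_point v q T j t) \<le> w"
proof -
  have "weighted_dist W (edge_point v q T j s) (edge_point v q T j t)
      \<le> w * dist (edge_point v q T j s) (edge_point v q T j t)"
  proof (rule weighted_dist_segment[OF _ w])
    fix z assume "z \<in> closed_segment (edge_point v q T j s) (edge_point v q T j t)"
    then obtain u where u: "0 \<le> u" "u \<le> 1"
      and z: "z = (1 - u) *\<^sub>R edge_point v q T j s + u *\<^sub>R edge_point v q T j t"
      by (auto simp: in_segment)
    have "z = edge_point v q T j 0 + ((1 - u) * s + u * t) *\<^sub>R edge_vector v q j"
      unfolding z by (subst (1 2) edge_point_affine) (simp add: algebra_simps)
    also have "\<dots> = edge_point v q T j ((1 - u) * s + u * t)"
      by (rule edge_point_affine[symmetric])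
    finally have "z = edge_point v q T j ((1 - u) * s + u * t)" .
    moreover have "(1 - u) * s + u * t \<in> {0..1}"
      using u st convex_bound_le[of s 1 t "1 - u" u] by auto
    ultimately show "W z \<le> w" using small[OF j] by simp
  qed
  also have "dist (edge_point v q T j s) (edge_point v q T j t) \<le> 1"
  proof -
    have "edge_point v q T j s - edge_point v q T j t = (s - t) *\<^sub>R edge_vector v q j"
      by (subst (1 2) edge_point_affine) (simp add: algebra_simps)
    then have "dist (edge_point v q T j s) (edge_point v q T j t) = \<bar>s - t\<bar> * edge_length v q j"
      using norm_edge_vector[of q v j] q by (simp add: dist_norm)
    also have "\<dots> \<le> 1 * 1"
      using st edge_length_bounds[OF q, of v j] by (intro mult_mono) auto
    finally show ?thesis by simp
  qed
  then have "w * dist (edge_point v q T j s) (edge_point v q T j t) \<le> w * 1"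
    using w by (rule mult_left_mono)
  finally show ?thesis by simp
qed

text \<open>Walk from the corner to the grid point by changing one coordinate at a time; each change is a
  move along one grid line.\<close>

lemma weighted_dist_face_grid:
  assumes g: "g \<in> base_grid v q" and A: "finite A" "v \<notin> A"
  shows "weighted_dist W (corner v b) (\<chi> k. if k = v then of_bool b else if k \<in> A then g $ k else 0) \<le> real (card A) * w"
  using A
proof (induction A)
  case empty
  have "(\<chi> k. if k = v then of_bool b else if k \<in> {} then g $ k else 0) = corner v b"
    by (simp add: corner_def vec_eq_iff)
  then show ?case using weighted_dist_refl[of "corner v b"] by simp
next
  case (insert i A)
  let ?p = "\<lambda>A. \<chi> k. if k = v then of_bool b else if k \<in> A then g $ k else 0"
  let ?j = "(\<chi> k. if k \<in> A then g $ k else 0, b, i)"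
  have iv: "i \<noteq> v" using insert.prems by auto
  have j: "?j \<in> edges v q"
    using base_grid_restrict[OF g] q by (simp add: edges_def)
  have gi: "g $ i \<in> {0..1}" using base_grid_coords(2,3)[OF g, of i] q by auto
  have p: "?p A = edge_point v q T ?j 0" "?p (insert i A) = edge_point v q T ?j (g $ i)"
    using insert.hyps iv by (auto simp: vec_eq_iff)
  have "weighted_dist W (corner v b) (?p (insert i A))
     \<le> weighted_dist W (corner v b) (?p A) + weighted_dist W (?p A) (?p (insert i A))"
    by (rule weighted_dist_triangle)
  also have "\<dots> \<le> real (card A) * w + w"
    unfolding p using insert weighted_dist_edge[OF j, of 0 "g $ i"] gi p(1) by (intro add_mono) auto
  also have "\<dots> = real (card (insert i A)) * w"
    using insert.hyps by (simp add: algebra_simps)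
  finally show ?case .
qed

text \<open>At most \<open>d - 1\<close> grid lines of a face lead from the corner to a grid point on the edge, and one
  more move follows the edge itself.\<close>

lemma weighted_dist_from_corner:
  assumes j: "j \<in> edges v q" and t: "t \<in> {0..1}"
  shows "weighted_dist W (corner v (raised v T j)) (edge_point v q T j t) \<le> real CARD('d) * w"
proof -
  obtain g b i where J: "j = (g, b, i)" by (cases j)
  have g: "g \<in> base_grid v q" using j by (simp add: J edges_def)
  define B where "B = raised v T j"
  let ?p = "\<chi> k. if k = v then of_bool B else if k \<in> UNIV - {v} then g $ k else 0"
  have "\<exists>s\<in>{0..1}. ?p = edge_point v q T j s"
  proof (cases "i = v")
    case True
    \<comment> \<open>an upper spine meets its face at parameter 1, a lower one at parameter 0\<close>
    then show ?thesis
      by (intro bexI[of _ "of_bool B"]) (auto simp: J vec_eq_iff B_def)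
  next
    case False
    then show ?thesis using base_grid_coords[OF g] q
      by (intro bexI[of _ "g $ i"]) (auto simp: J vec_eq_iff B_def less_imp_le)
  qed
  then obtain s where s: "s \<in> {0..1}" "?p = edge_point v q T j s" by blast
  have "weighted_dist W (corner v B) (edge_point v q T j t)
     \<le> weighted_dist W (corner v B) ?p + weighted_dist W ?p (edge_point v q T j t)"
    by (rule weighted_dist_triangle)
  also have "\<dots> \<le> real (card (UNIV - {v})) * w + w"
    using weighted_dist_face_grid[OF g, of "UNIV - {v}" B] weighted_dist_edge[OF j s(1) t]
    unfolding s(2) by (intro add_mono) auto
  also have "\<dots> = real CARD('d) * w"
    by (simp add: card_Diff_singleton of_nat_diff Suc_leI algebra_simps)
  finally show ?thesis by (simp add: B_def)
qed

text \<open>The spine over the origin starts at one of the two corners and ends \<open>1 / q\<close> away from the other.\<close>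

lemma weighted_dist_corners: "weighted_dist W (corner v True) (corner v False) \<le> 1 / real q + w"
proof -
  let ?j = "(0 :: real^'d, True, v)"
  have j: "?j \<in> edges v q" using zero_in_base_grid[of q v] q by (simp add: edges_def)
  have axis: "dist x y \<le> 1 / real q" if "x - y = (1 / real q) *\<^sub>R axis v 1" for x y :: "real^'d"
    using that by (simp add: dist_norm norm_axis_1)
  show ?thesis
  proof (cases "0 \<in> T")
    case True
    have "edge_point v q T ?j 1 = corner v True"
      using True by (simp add: corner_def vec_eq_iff)
    moreover have "weighted_dist W (edge_point v q T ?j 0) (corner v False) \<le> 1 / real q"
      by (rule order_trans[OF weighted_dist_le_dist axis])
        (use True in \<open>simp add: corner_def vec_eq_iff axis_def\<close>)
    ultimately show ?thesis
      using weighted_dist_triangle[of "corner v True" "corner v False" "edge_point v q T ?j 0"]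
        weighted_dist_edge[OF j, of 1 0] by auto
  next
    case False
    have "edge_point v q T ?j 0 = corner v False"
      using False by (simp add: corner_def vec_eq_iff)
    moreover have "weighted_dist W (corner v True) (edge_point v q T ?j 1) \<le> 1 / real q"
      by (rule order_trans[OF weighted_dist_le_dist axis])
        (use False in \<open>simp add: corner_def vec_eq_iff axis_def\<close>)
    ultimately show ?thesis
      using weighted_dist_triangle[of "corner v True" "corner v False" "edge_point v q T ?j 1"]
        weighted_dist_edge[OF j, of 1 0] by auto
  qed
qed

end

end

lemma corner_in_cube: "corner v b \<in> cube"
  by (auto simp: corner_def cube_def)

text \<open>Value \<open>- h\<close> within distance \<open>r\<close> of \<open>A\<close>, then growth at slope \<open>L\<close> until the value \<open>h\<close> is reached.\<close>

definition separating_fun :: "real \<Rightarrow> real \<Rightarrow> real \<Rightarrow> (real^'d) set \<Rightarrow> real^'d \<Rightarrow> real" where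
  "separating_fun L h r A x = - h + min (2 * h) (L * max 0 (infdist x A - r))"

lemma separating_fun_lipschitz:
  assumes "L > 0"
  shows "\<bar>separating_fun L h r A x - separating_fun L h r A y\<bar> \<le> L * dist x y"
proof -
  have "\<bar>infdist x A - infdist y A\<bar> \<le> dist x y" by (rule infdist_triangle_abs)
  then have "\<bar>max 0 (infdist x A - r) - max 0 (infdist y A - r)\<bar> \<le> dist x y" by linarith
  then have "L * \<bar>max 0 (infdist x A - r) - max 0 (infdist y A - r)\<bar> \<le> L * dist x y"
    using assms by (intro mult_left_mono) auto
  then have "\<bar>L * max 0 (infdist x A - r) - L * max 0 (infdist y A - r)\<bar> \<le> L * dist x y"
    using assms by (simp add: abs_mult right_diff_distrib[symmetric])
  then show ?thesis unfolding separating_fun_def by linarith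
qed

lemma separating_fun_bounded:
  assumes "L > 0" "h \<ge> 0"
  shows "\<bar>separating_fun L h r A x\<bar> \<le> h"
proof -
  have "0 \<le> L * max 0 (infdist x A - r)" using assms by simp
  then show ?thesis unfolding separating_fun_def using assms by linarith
qed

lemma separating_fun_near:
  assumes "infdist x A \<le> r" "h \<ge> 0"
  shows "separating_fun L h r A x = - h"
  using assms by (simp add: separating_fun_def max_def)

lemma separating_fun_far:
  assumes "r + 2 * h / L \<le> infdist x A" "L > 0" "h \<ge> 0"
  shows "separating_fun L h r A x = h"
proof -
  have "2 * h / L \<le> max 0 (infdist x A - r)" using assms(1) by linarith
  then have "2 * h \<le> L * max 0 (infdist x A - r)"
    using assms(2) by (simp add: pos_divide_le_eq mult.commute)
  then show ?thesis by (simp add: separating_fun_def)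
qed

lemma separating_fun_measurable: "separating_fun L h r A \<in> borel_measurable borel"
  unfolding separating_fun_def[abs_def]
  by (intro borel_measurable_continuous_onI continuous_intros)

section \<open>The spiked distributions: membership and risk\<close>

abbreviation edge_label :: "'d::finite \<Rightarrow> (real^'d) set \<Rightarrow> real \<Rightarrow> 'd edge \<Rightarrow> real" where
  "edge_label v T h j \<equiv> if raised v T j then h else - h"

definition spiked :: "'d::finite \<Rightarrow> nat \<Rightarrow> real \<Rightarrow> (real^'d) set \<Rightarrow> ((real^'d) \<times> real) measure" where
  "spiked v q h T = curve_mixture (1 / card (edges v q)) (edges v q) (edge_point v q T) (edge_label v T h)"

definition lower_part :: "'d::finite \<Rightarrow> nat \<Rightarrow> (real^'d) set \<Rightarrow> (real^'d) set" where
  "lower_part v q T = (\<Union>j\<in>{j \<in> edges v q. \<not> raised v T j}. edge_point v q T j ` {0..1})"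

definition spiked_regression :: "'d::finite \<Rightarrow> nat \<Rightarrow> real \<Rightarrow> real \<Rightarrow> (real^'d) set \<Rightarrow> real^'d \<Rightarrow> real" where
  "spiked_regression v q L h T = separating_fun L h (1 / (4 * real q)) (lower_part v q T)"

lemma edges_nonempty: "q \<ge> 1 \<Longrightarrow> edges v q \<noteq> {}"
  using zero_in_base_grid[of q v] by (auto simp: edges_def)

lemma edge_point_measurable: "edge_point v q T j \<in> borel_measurable borel"
  by (intro borel_measurable_continuous_onI continuous_edge_point)

lemma spiked_prob_space: "q \<ge> 1 \<Longrightarrow> prob_space (spiked v q h T)"
  unfolding spiked_def by (intro prob_space_curve_mixture finite_edges edges_nonempty edge_point_measurable)

lemma sets_spiked [simp, measurable_cong]: "sets (spiked v q h T) = sets borel"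
  by (simp add: spiked_def)

text \<open>The value \<open>h\<close> is reached at distance \<open>1 / (4 * q) + 2 * h / L \<le> 3 / (4 * q)\<close> from the lower piece,
  and the points within \<open>1 / (4 * q)\<close> of the upper piece are at least that far away.\<close>

lemma spiked_regression_near_edge:
  assumes two: "\<exists>i. i \<noteq> v" and q: "q \<ge> 1" and L: "L > 0" and h: "0 \<le> h" "4 * real q * h \<le> L"
    and j: "j \<in> edges v q" and t: "t \<in> {0..1}" and near: "dist x (edge_point v q T j t) \<le> 1 / (4 * real q)"
  shows "spiked_regression v q L h T x = edge_label v T h j"
proof (cases "raised v T j")
  case False
  then have "edge_point v q T j t \<in> lower_part v q T" using j t unfolding lower_part_def by blast
  then have "infdist x (lower_part v q T) \<le> 1 / (4 * real q)"
    using near infdist_le order_trans by blast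
  then show ?thesis using False h by (simp add: spiked_regression_def separating_fun_near)
next
  case True
  obtain i where "i \<noteq> v" using two by blast
  then have "edge_point v q T (0, False, i) 0 \<in> lower_part v q T"
    unfolding lower_part_def using zero_in_base_grid[of q v] q
    by (intro UN_I[of "(0, False, i)"] imageI) (auto simp: edges_def)
  then have ne: "lower_part v q T \<noteq> {}" by blast
  have "3 / (4 * real q) \<le> infdist x (lower_part v q T)"
    unfolding infdist_notempty[OF ne]
  proof (rule cINF_greatest[OF ne])
    fix a assume "a \<in> lower_part v q T"
    then obtain j' t' where "j' \<in> edges v q" "\<not> raised v T j'" "t' \<in> {0..1}" "a = edge_point v q T j' t'"
      unfolding lower_part_def by blast
    then have "1 / real q \<le> dist (edge_point v q T j t) a"
      using edges_separated[OF j True] t q by auto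
    also have "\<dots> \<le> dist x (edge_point v q T j t) + dist x a"
      by (metis dist_commute dist_triangle)
    finally have "1 / real q - 1 / (4 * real q) \<le> dist x a" using near by simp
    moreover have "1 / real q - 1 / (4 * real q) = 3 / (4 * real q)" using q by (simp add: field_simps)
    ultimately show "3 / (4 * real q) \<le> dist x a" by simp
  qed
  moreover have "1 / (4 * real q) + 2 * h / L \<le> 3 / (4 * real q)"
    using h(2) L q by (simp add: field_simps)
  ultimately show ?thesis
    using True L h by (simp add: spiked_regression_def separating_fun_far)
qed

text \<open>Where the smoothed density is positive there is a support point within \<open>\<sigma> * C0 / 2 \<le> 1 / (4 * q)\<close>, so
  the regression function is \<open>h\<close> or \<open>- h\<close> there.\<close>

lemma spiked_class:
  assumes K: "is_kernel (radial K :: real^'d \<Rightarrow> real)" and \<sigma>: "\<sigma> > 0" and \<alpha>: "\<alpha> \<ge> 0"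
    and two: "\<exists>i. i \<noteq> (v :: 'd)" and q: "q \<ge> 1" and L: "L > 0" and h: "0 \<le> h" "4 * real q * h \<le> L" "h \<le> M"
    and \<sigma>q: "\<sigma> * diameter (kernel_support (radial K :: real^'d \<Rightarrow> real)) \<le> 1 / (2 * real q)"
  shows "is_regression (spiked v q h T) (spiked_regression v q L h T)"
    and "spiked v q h T \<in> lipschitz_class K M \<alpha> \<sigma> L"
proof -
  let ?P = "spiked v q h T" and ?f = "spiked_regression v q L h T"
  interpret path_weight "density_weight K ?P \<alpha> \<sigma>"
    by (rule path_weight_density_weight[OF K \<sigma> \<alpha> spiked_prob_space]) (use q in auto)
  note near = spiked_regression_near_edge[OF two q L h(1,2)]
  have flat: "?f x = h \<or> ?f x = - h" if "density_weight K ?P \<alpha> \<sigma> x \<noteq> 1" for x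
  proof -
    have "smoothed_density K ?P \<sigma> x \<noteq> 0" using that by (auto simp: density_weight_def)
    then obtain j t where j: "j \<in> edges v q" "t \<in> {0..1}"
      and "\<not> \<sigma> * diameter (kernel_support (radial K :: real^'d \<Rightarrow> real)) < 2 * dist x (edge_point v q T j t)"
      using smoothed_density_mixture_eq_0[where c = "edge_point v q T" and x = x and J = "edges v q",
          OF K \<sigma> finite_edges edge_point_measurable]
      unfolding spiked_def by blast
    then have "dist x (edge_point v q T j t) \<le> 1 / (4 * real q)" using \<sigma>q by simp
    from near[OF j this] show ?thesis by simp
  qed
  have lip: "\<bar>?f x - ?f y\<bar> \<le> L * density_dist K ?P \<alpha> \<sigma> x y" for x y
    unfolding density_dist_eq_weighted
    by (rule lipschitz_weighted_dist[OF _ L _ flat])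
      (use L h in \<open>auto simp: spiked_regression_def intro: separating_fun_lipschitz separating_fun_bounded\<close>)
  have label: "\<bar>edge_label v T h j\<bar> \<le> M" for j using h by simp
  have fm: "?f \<in> borel_measurable borel"
    by (simp add: spiked_regression_def separating_fun_measurable)
  have fy: "?f (edge_point v q T j t) = edge_label v T h j" if "j \<in> edges v q" "t \<in> {0..1}" for j t
    by (rule near[OF that]) simp
  note membership = mixture_regression_class[where c = "edge_point v q T" and y = "edge_label v T h" and f = ?f,
      OF finite_edges edges_nonempty[OF q] continuous_edge_point edge_point_in_cube[OF _ _ q] label fm fy
        lip[unfolded spiked_def]]
  show "is_regression ?P ?f" "?P \<in> lipschitz_class K M \<alpha> \<sigma> L"
    unfolding spiked_def using membership by auto
qed

text \<open>Two balls around the corners \<open>corner v True\<close> and \<open>corner v False\<close> cover the support at all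
  scales from \<open>n powr (- 1 / (2 + \<xi>))\<close> on. The bound \<open>(C1 / \<epsilon>) powr \<xi>\<close> may drop below two, but only for
  \<open>\<epsilon>\<close> above a constant; by the hypothesis \<open>coarse\<close> one ball then covers both pieces.\<close>

lemma spiked_covering_class:
  assumes K: "is_kernel (radial K :: real^'d \<Rightarrow> real)" and \<sigma>: "\<sigma> > 0" and \<alpha>: "\<alpha> \<ge> 0"
    and two: "\<exists>i. i \<noteq> (v :: 'd)" and q: "q \<ge> 2" and L: "L > 0" and h: "0 \<le> h" "4 * real q * h \<le> L" "h \<le> M"
    and \<sigma>q: "\<sigma> * diameter (kernel_support (radial K :: real^'d \<Rightarrow> real)) \<le> 1 / (2 * real q)"
    and \<rho>: "0 \<le> \<rho>" "ennreal \<rho> \<le> ennreal (1 / card (edges v q)) * (ennreal (\<sigma> / \<sigma> ^ CARD('d)) * half_line_mass K)"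
    and n: "n \<ge> 1" and \<xi>: "\<xi> > 0" and C1: "C1 > 0"
    and fine: "real CARD('d) * exp (- \<alpha> * \<rho>) \<le> real n powr (- 1 / (2 + \<xi>))"
    and coarse: "1 / real q + (real CARD('d) + 1) * exp (- \<alpha> * \<rho>) \<le> C1 * 2 powr (- 1 / \<xi>)"
  shows "spiked v q h T \<in> covering_class K M C1 \<xi> n \<alpha> \<sigma> L"
proof -
  let ?P = "spiked v q h T"
  let ?D = "density_dist K ?P \<alpha> \<sigma>"
  define w where "w = exp (- \<alpha> * \<rho>)"
  have w: "0 \<le> w" by (simp add: w_def)
  interpret path_weight "density_weight K ?P \<alpha> \<sigma>"
    by (rule path_weight_density_weight[OF K \<sigma> \<alpha> spiked_prob_space]) (use q in auto)
  have small: "density_weight K ?P \<alpha> \<sigma> (edge_point v q T j t) \<le> w" if j: "j \<in> edges v q" "t \<in> {0..1}" for j t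
    unfolding w_def density_weight_def
  proof (rule exp_weight_le[OF \<alpha> \<rho>(1)])
    have n: "norm (edge_vector v q j) = edge_length v q j" using norm_edge_vector[of q v j] q by simp
    have "1 / (2 * real q) \<le> 1 / 2" using q by (simp add: field_simps)
    then have "ennreal (1 / card (edges v q)) * (ennreal (\<sigma> / \<sigma> ^ CARD('d)) * half_line_mass K)
       \<le> smoothed_density K ?P \<sigma> (edge_point v q T j t)"
      unfolding spiked_def
      using edge_length_bounds[OF q, of v j] \<sigma>q j
      by (intro smoothed_density_segment_ge[where c = "edge_point v q T", OF K \<sigma> finite_edges edge_point_measurable _ edge_point_affine])
        (auto simp: n)
    then show "ennreal \<rho> \<le> smoothed_density K ?P \<sigma> (edge_point v q T j t)"
      using \<rho>(2) by (rule order_trans[rotated])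
  qed
  note from_corner = weighted_dist_from_corner[OF q w small, folded density_dist_eq_weighted]
  note corners = weighted_dist_corners[OF q w small, folded density_dist_eq_weighted]
  have supp: "\<exists>j\<in>edges v q. \<exists>t\<in>{0..1}. z = edge_point v q T j t"
    if "z \<in> measure_support (marginal_X ?P)" for z
    using that measure_support_curve_mixture[where c = "edge_point v q T", OF finite_edges continuous_edge_point]
    unfolding spiked_def by blast
  have "real (covering_number K ?P \<alpha> \<sigma> \<epsilon>) \<le> max 1 ((C1 / \<epsilon>) powr \<xi>)"
    if \<epsilon>: "real n powr (- 1 / (2 + \<xi>)) \<le> \<epsilon>" for \<epsilon>
  proof (cases "1 / real q + (real CARD('d) + 1) * w \<le> \<epsilon>")
    case True
    have "covering_number K ?P \<alpha> \<sigma> \<epsilon> \<le> card {corner v True}"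
    proof (rule covering_number_le)
      fix z assume "z \<in> measure_support (marginal_X ?P)"
      from supp[OF this] obtain j t where z: "j \<in> edges v q" "t \<in> {0..1}" "z = edge_point v q T j t" by blast
      have "?D (corner v True) (corner v (raised v T j)) \<le> 1 / real q + w"
        using corners weighted_dist_refl[of "corner v True"] w
        by (cases "raised v T j") (auto simp: density_dist_eq_weighted add_nonneg_nonneg intro: order_trans)
      moreover have "?D (corner v (raised v T j)) z \<le> real CARD('d) * w"
        using from_corner z by blast
      moreover have "?D (corner v True) z
          \<le> ?D (corner v True) (corner v (raised v T j)) + ?D (corner v (raised v T j)) z"
        unfolding density_dist_eq_weighted by (rule weighted_dist_triangle)
      ultimately have "?D (corner v True) z \<le> \<epsilon>" using True by (simp add: algebra_simps)
      then show "\<exists>x\<in>{corner v True}. ?D x z \<le> \<epsilon>" by simp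
    qed (auto simp: corner_in_cube)
    then show ?thesis by simp
  next
    case False
    have pos: "0 < \<epsilon>" using \<epsilon> n by (intro less_le_trans[OF _ \<epsilon>]) simp
    have "\<epsilon> \<le> C1 * 2 powr (- 1 / \<xi>)" using False coarse by (simp add: w_def)
    then have "\<epsilon> * 2 powr (1 / \<xi>) \<le> C1 * 2 powr (- 1 / \<xi>) * 2 powr (1 / \<xi>)"
      by (rule mult_right_mono) simp
    also have "\<dots> = C1" by (simp add: mult.assoc powr_add[symmetric])
    finally have "2 powr (1 / \<xi>) \<le> C1 / \<epsilon>" using pos by (simp add: field_simps)
    then have "(2 powr (1 / \<xi>)) powr \<xi> \<le> (C1 / \<epsilon>) powr \<xi>" using \<xi> by (intro powr_mono2) auto
    then have two: "2 \<le> (C1 / \<epsilon>) powr \<xi>" using \<xi> by (simp add: powr_powr)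
    have "covering_number K ?P \<alpha> \<sigma> \<epsilon> \<le> card (range (corner v))"
    proof (rule covering_number_le)
      fix z assume "z \<in> measure_support (marginal_X ?P)"
      from supp[OF this] obtain j t where z: "j \<in> edges v q" "t \<in> {0..1}" "z = edge_point v q T j t" by blast
      then have "?D (corner v (raised v T j)) z \<le> \<epsilon>"
        using from_corner[of j t] fine \<epsilon> by (simp add: w_def)
      then show "\<exists>x\<in>range (corner v). ?D x z \<le> \<epsilon>" by blast
    qed (auto simp: corner_in_cube)
    also have "\<dots> \<le> card (UNIV :: bool set)" by (rule card_image_le) simp
    finally show ?thesis using two by simp
  qed
  then show ?thesis
    unfolding covering_class_def using spiked_class(2)[OF K \<sigma> \<alpha> two _ L h \<sigma>q] q by auto
qed

definition spine :: "'d::finite \<Rightarrow> real^'d \<Rightarrow> real \<Rightarrow> real^'d" where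
  "spine v g s = (\<chi> k. if k = v then s else g $ k)"

text \<open>The middle part of the spine over \<open>g\<close>, which the spine occupies both when \<open>g\<close> is in \<open>T\<close> and when it
  is not.\<close>

definition spine_measure :: "'d::finite \<Rightarrow> nat \<Rightarrow> real^'d \<Rightarrow> (real^'d) measure" where
  "spine_measure v q g = distr (density lborel
     (\<lambda>s. ennreal (2 / card (edges v q)) * indicator {1 / real q..1 - 1 / real q} s)) borel (spine v g)"

lemma spine_measurable [measurable]: "spine v g \<in> borel_measurable borel"
proof -
  have "spine v g = (\<lambda>s. spine v g 0 + s *\<^sub>R axis v 1)"
    by (auto simp: spine_def fun_eq_iff vec_eq_iff axis_def)
  moreover have "(\<lambda>s. spine v g 0 + s *\<^sub>R axis v 1) \<in> borel_measurable borel"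
    by (intro borel_measurable_continuous_onI continuous_intros)
  ultimately show ?thesis by simp
qed

lemma sets_spine_measure [simp, measurable_cong]: "sets (spine_measure v q g) = sets borel"
  by (simp add: spine_measure_def)

lemma nn_integral_spine_measure:
  assumes [measurable]: "\<phi> \<in> borel_measurable borel"
  shows "(\<integral>\<^sup>+x. \<phi> x \<partial>spine_measure v q g)
    = ennreal (2 / card (edges v q)) * (\<integral>\<^sup>+s. \<phi> (spine v g s) * indicator {1 / real q..1 - 1 / real q} s \<partial>lborel)"
  unfolding spine_measure_def
  by (subst nn_integral_distr, simp, simp, subst nn_integral_density, simp, simp,
      subst nn_integral_cmult[symmetric]) (auto simp: mult_ac)

lemma emeasure_spine_measure:
  assumes "q \<ge> 2"
  shows "emeasure (spine_measure v q g) UNIV = ennreal (2 / card (edges v q) * (1 - 2 / real q))"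
proof -
  have "2 / real q \<le> 1" using assms by simp
  then have le: "1 / real q \<le> 1 - 1 / real q" by (simp add: field_simps)
  have sp: "space (spine_measure v q g) = UNIV" by (simp add: spine_measure_def)
  have "emeasure (spine_measure v q g) UNIV = ennreal (2 / card (edges v q)) * ennreal (1 - 1 / real q - 1 / real q)"
    using nn_integral_spine_measure[of "\<lambda>_. 1" v q g] le sp by simp
  also have "\<dots> = ennreal (2 / card (edges v q) * (1 - 1 / real q - 1 / real q))"
    using le by (subst ennreal_mult) auto
  finally show ?thesis by (simp add: diff_diff_eq)
qed

lemma edge_point_spine:
  "edge_point v q T (g, b, v) t = spine v g ((if g \<in> T then 1 / real q else 0) + (1 - 1 / real q) * t)"
  by (simp add: spine_def mult.commute)

text \<open>The edge is parametrised at speed \<open>1 - 1 / q \<le> 1\<close>, so the uniform law of the parameter gives every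
  piece of it at least its length.\<close>

lemma nn_integral_spine_le_edge:
  assumes [measurable]: "\<phi> \<in> borel_measurable borel" and q: "q \<ge> 2"
  shows "(\<integral>\<^sup>+s. \<phi> (spine v g s) * indicator {1 / real q..1 - 1 / real q} s \<partial>lborel)
    \<le> (\<integral>\<^sup>+t. \<phi> (edge_point v q T (g, b, v) t) * indicator {0..1} t \<partial>lborel)"
proof -
  define a l where "a = (if g \<in> T then 1 / real q else 0)" and "l = 1 - 1 / real q"
  have l: "0 < l" "l \<le> 1" using q by (auto simp: l_def)
  have a: "0 \<le> a" "a \<le> 1 / real q" by (auto simp: a_def)
  let ?F = "\<lambda>s. \<phi> (spine v g s) * indicator {1 / real q..1 - 1 / real q} s"
  have "(\<integral>\<^sup>+s. ?F s \<partial>lborel) = ennreal \<bar>l\<bar> * (\<integral>\<^sup>+t. ?F (a + l * t) \<partial>lborel)"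
    by (rule nn_integral_real_affine) (use l in auto)
  also have "\<dots> \<le> 1 * (\<integral>\<^sup>+t. ?F (a + l * t) \<partial>lborel)"
    using l by (intro mult_right_mono) (auto simp: ennreal_le_1)
  also have "\<dots> \<le> 1 * (\<integral>\<^sup>+t. \<phi> (edge_point v q T (g, b, v) t) * indicator {0..1} t \<partial>lborel)"
  proof (intro mult_left_mono nn_integral_mono)
    fix t
    have "t \<in> {0..1}" if "a + l * t \<in> {1 / real q..1 - 1 / real q}"
    proof -
      have "0 \<le> l * t" "l * t \<le> l * 1" using that a unfolding atLeastAtMost_iff l_def[symmetric] by linarith+
      then have "0 \<le> t" "t \<le> 1"
        using mult_le_cancel_left_pos[OF l(1), of 0 t] mult_le_cancel_left_pos[OF l(1), of t 1] by simp_all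
      then show ?thesis by simp
    qed
    then show "?F (a + l * t) \<le> \<phi> (edge_point v q T (g, b, v) t) * indicator {0..1} t"
      unfolding edge_point_spine a_def[symmetric] l_def[symmetric] by (auto simp: indicator_def)
  qed auto
  finally show ?thesis by simp
qed

lemma spine_measures_le_spiked:
  assumes [measurable]: "\<phi> \<in> borel_measurable borel" and q: "q \<ge> 2"
  shows "(\<Sum>g\<in>base_grid v q. \<integral>\<^sup>+x. \<phi> x \<partial>spine_measure v q g) \<le> (\<integral>\<^sup>+x. \<phi> x \<partial>marginal_X (spiked v q h T))"
proof -
  let ?N = "card (edges v q)"
  let ?I = "\<lambda>j. ennreal (1 / ?N) * (\<integral>\<^sup>+t. \<phi> (edge_point v q T j t) * indicator {0..1} t \<partial>lborel)"
  have "(\<Sum>g\<in>base_grid v q. \<integral>\<^sup>+x. \<phi> x \<partial>spine_measure v q g)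
      \<le> (\<Sum>g\<in>base_grid v q. \<Sum>p\<in>UNIV \<times> {v}. ?I (g, p))"
  proof (rule sum_mono)
    fix g
    let ?S = "\<integral>\<^sup>+s. \<phi> (spine v g s) * indicator {1 / real q..1 - 1 / real q} s \<partial>lborel"
    have "(\<integral>\<^sup>+x. \<phi> x \<partial>spine_measure v q g) = (\<Sum>p\<in>(UNIV :: bool set) \<times> {v}. ennreal (1 / ?N) * ?S)"
    proof -
      have "ennreal (2 / ?N) = 2 * ennreal (1 / ?N)"
        using ennreal_mult[of 2 "1 / ?N"] by simp
      then show ?thesis
        by (simp add: nn_integral_spine_measure card_cartesian_product card_UNIV_bool mult.assoc)
    qed
    also have "\<dots> \<le> (\<Sum>p\<in>UNIV \<times> {v}. ?I (g, p))"
      by (rule sum_mono) (use nn_integral_spine_le_edge[OF assms] in \<open>auto intro!: mult_left_mono\<close>)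
    finally show "(\<integral>\<^sup>+x. \<phi> x \<partial>spine_measure v q g) \<le> (\<Sum>p\<in>UNIV \<times> {v}. ?I (g, p))" .
  qed
  also have "\<dots> = (\<Sum>j\<in>base_grid v q \<times> UNIV \<times> {v}. ?I j)"
    by (simp add: sum.cartesian_product split_beta)
  also have "\<dots> \<le> (\<Sum>j\<in>edges v q. ?I j)"
    by (rule sum_mono2) (auto simp: finite_edges, auto simp: edges_def)
  also have "\<dots> = (\<integral>\<^sup>+x. \<phi> x \<partial>marginal_X (spiked v q h T))"
    unfolding spiked_def
    by (rule nn_integral_marginal_mixture[where c = "edge_point v q T", OF finite_edges edge_point_measurable, symmetric]) simp
  finally show ?thesis .
qed

lemma same_edge:
  assumes "j \<notin> {g} \<times> UNIV \<times> {v}"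
  shows "edge_point v q (insert g T) j = edge_point v q T j" "raised v (insert g T) j = raised v T j"
proof -
  obtain g' b i where j: "j = (g', b, i)" by (cases j)
  then have "i \<noteq> v \<or> g' \<noteq> g" using assms by auto
  then show "edge_point v q (insert g T) j = edge_point v q T j" "raised v (insert g T) j = raised v T j"
    unfolding j fun_eq_iff edge_point.simps raised.simps by (cases "i = v"; simp)+
qed

text \<open>Remove from the mixture the two edges \<open>(g, b, v)\<close> that form the spine over \<open>g\<close>.\<close>

lemma spiked_common_part:
  assumes g: "g \<in> base_grid v q" and T: "g \<notin> T" and q: "q \<ge> 1"
  obtains R where "sets R = sets borel" "R \<le> spiked v q h T" "R \<le> spiked v q h (insert g T)"
    "ennreal (1 - 2 / card (edges v q)) \<le> emeasure R UNIV"
proof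
  let ?J = "edges v q - {g} \<times> UNIV \<times> {v}" and ?N = "card (edges v q)"
  let ?R = "curve_mixture (1 / ?N) ?J (edge_point v q T) (edge_label v T h)"
  show "sets ?R = sets borel" by simp
  show "?R \<le> spiked v q h T"
    unfolding spiked_def
    by (rule curve_mixture_mono[where c = "edge_point v q T", OF finite_edges edge_point_measurable Diff_subset]) blast
  have "edge_point v q T j = edge_point v q (insert g T) j \<and> edge_label v T h j = edge_label v (insert g T) h j"
    if "j \<in> ?J" for j
  proof -
    have "j \<notin> {g} \<times> UNIV \<times> {v}" using that by blast
    from same_edge[OF this] show ?thesis by (simp only:)
  qed
  then show "?R \<le> spiked v q h (insert g T)"
    unfolding spiked_def
    by (rule curve_mixture_mono[where c = "edge_point v q (insert g T)",
          OF finite_edges edge_point_measurable Diff_subset])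
  have "card ?J = ?N - card ({g} \<times> (UNIV :: bool set) \<times> {v})"
    by (rule card_Diff_subset) (use g in \<open>auto simp: edges_def\<close>)
  then have "card ?J = ?N - 2" by (simp add: card_cartesian_product card_UNIV_bool)
  then have c: "real ?N - 2 \<le> real (card ?J)" by simp
  have N: "?N > 0" using edges_nonempty[OF q, of v] finite_edges[of v q] by (simp add: card_gt_0_iff)
  have "1 - 2 / ?N = (real ?N - 2) * (1 / ?N)" using N by (simp add: field_simps)
  also have "\<dots> \<le> real (card ?J) * (1 / ?N)" by (rule mult_right_mono[OF c]) simp
  finally have "ennreal (1 - 2 / ?N) \<le> ennreal (real (card ?J) * (1 / ?N))" by (rule ennreal_leI)
  also have "\<dots> = emeasure ?R UNIV"
  proof -
    have "finite ?J" using finite_edges by (rule finite_Diff)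
    from emeasure_curve_mixture_UNIV[where c = "edge_point v q T", OF this edge_point_measurable, of "1 / ?N"]
    show ?thesis by (simp only: ennreal_of_nat_eq_real_of_nat ennreal_mult' of_nat_0_le_iff)
  qed
  finally show "ennreal (1 - 2 / ?N) \<le> emeasure ?R UNIV" .
qed

text \<open>The middle parts of the spines have total mass \<open>(1 - 2 / q) / d \<ge> 1 / (3 * d)\<close>. A single spine has
  mass \<open>1 / (d * q ^ (d - 1)) \<le> 1 / (d * n)\<close>, so by Bernoulli's inequality all \<open>n\<close> labeled
  points miss it with probability at least \<open>1 - 1 / d \<ge> 1 / 2\<close>.\<close>

lemma spiked_minimax_bound:
  fixes v :: "'d::finite"
  assumes two: "CARD('d) \<ge> 2" and q: "q \<ge> 3" and L: "L > 0" and h: "0 \<le> h" "4 * real q * h \<le> L"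
    and nq: "real n \<le> real q ^ (CARD('d) - 1)"
    and P: "\<And>T. T \<subseteq> base_grid v q \<Longrightarrow> spiked v q h T \<in> \<P>"
    and f: "\<And>T. T \<subseteq> base_grid v q \<Longrightarrow> is_regression (spiked v q h T) (spiked_regression v q L h T)"
  shows "ennreal (h\<^sup>2 / (6 * real CARD('d))) \<le> supervised_minimax_risk n m \<P>"
proof -
  let ?N = "card (edges v q)" and ?d = "real CARD('d)" and ?Q = "real q ^ (CARD('d) - 1)"
  have ex: "\<exists>i. i \<noteq> v"
  proof (rule ccontr)
    assume "\<nexists>i. i \<noteq> v"
    then have "UNIV = {v}" by blast
    then have "CARD('d) = card {v}" by simp
    then show False using two by simp
  qed
  have Q: "?Q > 0" using q by simp
  have N: "real ?N = 2 * ?d * ?Q" using q by (simp add: card_edges)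
  have d: "?d \<ge> 2" using two by simp
  have r0: "0 \<le> 1 - 2 / real ?N"
  proof -
    have "1 \<le> ?Q" using q by simp
    then have "2 * 1 * 1 \<le> 2 * ?d * ?Q" using d by (intro mult_mono) auto
    then show ?thesis using N Q d by (simp add: field_simps)
  qed
  have q2: "2 / real q \<le> 2 / 3" using q by (intro divide_left_mono) auto
  have "of_nat (card (base_grid v q)) * (ennreal (h\<^sup>2) * ennreal (2 / ?N * (1 - 2 / real q)) * ennreal (1 - 2 / ?N) ^ n)
     \<le> supervised_minimax_risk n m \<P>"
  proof (rule assouad_bound[where P = "spiked v q h" and f = "spiked_regression v q L h" and \<kappa> = "spine_measure v q"])
    show "finite (base_grid v q)" by (rule finite_base_grid)
    show "base_grid v q \<noteq> {}" using zero_in_base_grid[of q v] q by auto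
    show "finite_measure (spine_measure v q g)" for g
      using emeasure_spine_measure[of q v g] q by (intro finite_measureI) (simp add: spine_measure_def)
    show "(\<Sum>g\<in>base_grid v q. \<integral>\<^sup>+x. \<phi> x \<partial>spine_measure v q g) \<le> (\<integral>\<^sup>+x. \<phi> x \<partial>marginal_X (spiked v q h T))"
      if "\<phi> \<in> borel_measurable borel" for \<phi> T
      by (rule spine_measures_le_spiked[OF that]) (use q in simp)
    show "AE x in spine_measure v q g. spiked_regression v q L h T x = (if g \<in> T then h else - h)"
      if T: "T \<subseteq> base_grid v q" and g: "g \<in> base_grid v q" for T g
    proof -
      have [measurable]: "spiked_regression v q L h T \<in> borel_measurable borel"
        using f[OF T] by (simp add: is_regression_def)
      have "spiked_regression v q L h T (spine v g s) = (if g \<in> T then h else - h)"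
        if s: "s \<in> {1 / real q..1 - 1 / real q}" for s
      proof -
        define a l where "a = (if g \<in> T then 1 / real q else 0)" and "l = 1 - 1 / real q"
        have l: "0 < l" using q by (simp add: l_def)
        let ?t = "(s - a) / l"
        have "0 \<le> a" "a \<le> 1 / real q" by (auto simp: a_def)
        then have "0 \<le> s - a" "s - a \<le> l" using s unfolding l_def atLeastAtMost_iff by linarith+
        then have t: "?t \<in> {0..1}" using l by (auto simp: divide_le_eq)
        have e: "(g, True, v) \<in> edges v q" using g by (simp add: edges_def)
        have "spine v g s = edge_point v q T (g, True, v) ?t"
          using l unfolding edge_point_spine a_def[symmetric] l_def[symmetric] by simp
        then have "spiked_regression v q L h T (spine v g s) = edge_label v T h (g, True, v)"
          by (intro spiked_regression_near_edge[OF ex _ L h e t]) (use q in auto)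
        then show ?thesis by simp
      qed
      then show ?thesis
        unfolding spine_measure_def
        by (subst AE_distr_iff, simp, measurable, subst AE_density) (auto simp: indicator_def)
    qed
    show "\<exists>R. sets R = sets borel \<and> R \<le> spiked v q h T \<and> R \<le> spiked v q h (insert g T)
        \<and> ennreal (1 - 2 / ?N) \<le> emeasure R UNIV"
      if "g \<in> base_grid v q" "T \<subseteq> base_grid v q - {g}" for T g
    proof -
      have "g \<notin> T" "q \<ge> 1" using that q by auto
      from spiked_common_part[OF that(1) this, of h] obtain R where
        "sets R = sets borel" "R \<le> spiked v q h T" "R \<le> spiked v q h (insert g T)"
        "ennreal (1 - 2 / ?N) \<le> emeasure R UNIV" .
      then show ?thesis by (intro exI conjI)
    qed
  qed (use q P f in \<open>auto simp: emeasure_spine_measure spiked_prob_space\<close>)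
  also have "of_nat (card (base_grid v q)) * (ennreal (h\<^sup>2) * ennreal (2 / ?N * (1 - 2 / real q)) * ennreal (1 - 2 / ?N) ^ n)
     = ennreal (?Q * (h\<^sup>2 * (2 / ?N * (1 - 2 / real q)) * (1 - 2 / ?N) ^ n))"
  proof -
    have "ennreal (a * (b * c * e ^ n)) = ennreal a * (ennreal b * ennreal c * ennreal e ^ n)"
      if "0 \<le> a" "0 \<le> b" "0 \<le> c" "0 \<le> e" for a b c e :: real
      using that by (simp add: ennreal_mult ennreal_power)
    moreover have "of_nat (card (base_grid v q)) = ennreal ?Q"
      using q by (simp add: card_base_grid ennreal_of_nat_eq_real_of_nat)
    moreover have "0 \<le> 2 / ?N * (1 - 2 / real q)" using q2 by (intro mult_nonneg_nonneg) auto
    ultimately show ?thesis using r0 Q by (simp only: zero_le_power2 less_imp_le)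
  qed
  finally have *: "ennreal (?Q * (h\<^sup>2 * (2 / ?N * (1 - 2 / real q)) * (1 - 2 / ?N) ^ n)) \<le> supervised_minimax_risk n m \<P>" .
  have QN: "?Q * (2 / ?N) = 1 / ?d" using N Q d by (simp add: field_simps)
  have eq: "?Q * (h\<^sup>2 * (2 / ?N * (1 - 2 / real q)) * (1 - 2 / ?N) ^ n)
      = h\<^sup>2 * (1 / ?d) * ((1 - 2 / real q) * (1 - 2 / ?N) ^ n)"
  proof -
    have "a * (b * (c * e) * k) = b * (a * c) * (e * k)" for a b c e k :: real by (simp add: mult_ac)
    then show ?thesis unfolding QN[symmetric] .
  qed
  have "1 / 2 \<le> 1 + real n * (- (2 / ?N))"
  proof -
    have "real n * (2 / ?N) = real n / ?Q * (1 / ?d)" using N Q d by (simp add: field_simps)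
    also have "\<dots> \<le> 1 * (1 / 2)" using nq Q d by (intro mult_mono) (auto simp: divide_le_eq)
    finally show ?thesis by simp
  qed
  also have "\<dots> \<le> (1 + - (2 / ?N)) ^ n"
    by (rule Bernoulli_inequality) (use r0 in simp)
  finally have "1 / 2 \<le> (1 - 2 / ?N) ^ n" by simp
  then have "1 / 3 * (1 / 2) \<le> (1 - 2 / real q) * (1 - 2 / ?N) ^ n"
    using q2 by (intro mult_mono) auto
  then have "h\<^sup>2 * (1 / ?d) * (1 / 3 * (1 / 2)) \<le> h\<^sup>2 * (1 / ?d) * ((1 - 2 / real q) * (1 - 2 / ?N) ^ n)"
    by (intro mult_left_mono) auto
  then have "h\<^sup>2 / (6 * ?d) \<le> ?Q * (h\<^sup>2 * (2 / ?N * (1 - 2 / real q)) * (1 - 2 / ?N) ^ n)"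
    unfolding eq by (simp add: field_simps)
  then show ?thesis by (rule order_trans[OF ennreal_leI *])
qed

section \<open>A two-atom family for small samples\<close>

lemma nn_integral_atom:
  fixes p :: "'a::topological_space"
  assumes "\<phi> \<in> borel_measurable borel"
  shows "(\<integral>\<^sup>+x. \<phi> x \<partial>scale_measure r (return borel p)) = r * \<phi> p"
  using assms by (simp add: nn_integral_scale_measure nn_integral_return)

text \<open>With \<open>\<alpha> = 0\<close> the metric is Euclidean, and two atoms at distance \<open>b\<close> are covered by a single ball at
  all admissible scales. The label of one atom is zero, that of the other is \<open>L * b\<close> or
  \<open>- L * b\<close>; the sample misses the second atom with probability \<open>(1 / 2) ^ n\<close>.\<close>

lemma two_atom_minimax_bound:
  fixes K :: "real \<Rightarrow> real" and \<P> :: "((real^'d) \<times> real) measure set"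
  assumes K: "is_kernel (radial K :: real^'d \<Rightarrow> real)" and \<sigma>: "\<sigma> > 0" and L: "L > 0"
    and b: "0 < b" "b \<le> 1" "L * b \<le> M" "b \<le> real n powr (- 1 / (2 + \<xi>))"
    and \<P>: "covering_class K M C1 \<xi> n 0 \<sigma> L \<subseteq> \<P>"
  shows "ennreal ((L * b)\<^sup>2 / 2 * (1 / 2) ^ n) \<le> supervised_minimax_risk n m \<P>"
proof -
  define p :: "real^'d" where "p = b *\<^sub>R axis undefined 1"
  define c :: "bool \<Rightarrow> real \<Rightarrow> real^'d" where "c = (\<lambda>j t. if j then p else 0)"
  define s :: "unit set \<Rightarrow> real" where "s T = (if () \<in> T then 1 else - 1)" for T
  define y where "y = (\<lambda>T j. if j then s T * (L * b) else 0)"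
  define P where "P = (\<lambda>T. curve_mixture (1 / card (UNIV :: bool set)) UNIV c (y T))"
  define f :: "unit set \<Rightarrow> real^'d \<Rightarrow> real" where "f = (\<lambda>T x. s T * min (L * b) (L * norm x))"
  have np: "norm p = b" using b by (simp add: p_def norm_axis_1)
  have cc: "continuous_on UNIV (c j)" for j by (simp add: c_def)
  have cm: "c j \<in> borel_measurable borel" for j by (simp add: c_def)
  have fin: "finite (UNIV :: bool set)" "(UNIV :: bool set) \<noteq> {}" by auto
  have prob: "prob_space (P T)" for T unfolding P_def by (rule prob_space_curve_mixture[OF fin cm])
  have sets[simp]: "sets (P T) = sets borel" for T by (simp add: P_def)
  have p_cube: "p \<in> cube" "0 \<in> (cube :: (real^'d) set)"
    using b by (auto simp: cube_def p_def axis_def)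
  have scaled_min: "min (L * b) (L * t) = L * min b t" for t using L by (auto simp: min_def)
  have abs_s: "\<bar>s T * x\<bar> = \<bar>x\<bar>" for T x by (simp add: s_def)
  have fm: "f T \<in> borel_measurable borel" for T
    unfolding f_def by (intro borel_measurable_continuous_onI continuous_intros)
  have lip: "\<bar>f T u - f T v\<bar> \<le> L * density_dist K (P T) 0 \<sigma> u v" for T u v
  proof -
    interpret path_weight "density_weight K (P T) 0 \<sigma>"
      by (rule path_weight_density_weight[OF K \<sigma> _ prob]) auto
    show ?thesis
      unfolding density_dist_eq_weighted
    proof (rule lipschitz_weighted_dist[where h = "L * b"])
      fix u v :: "real^'d"
      have "\<bar>min b (norm u) - min b (norm v)\<bar> \<le> \<bar>norm u - norm v\<bar>" by linarith
      also have "\<dots> \<le> dist u v" by (simp add: dist_norm norm_triangle_ineq3)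
      finally have "L * \<bar>min b (norm u) - min b (norm v)\<bar> \<le> L * dist u v" using L by simp
      moreover have "f T u - f T v = s T * (L * (min b (norm u) - min b (norm v)))"
        unfolding f_def scaled_min by (simp add: algebra_simps)
      ultimately show "\<bar>f T u - f T v\<bar> \<le> L * dist u v"
        using L by (simp only: abs_s) (simp add: abs_mult)
      show "\<bar>f T u\<bar> \<le> L * b" using L b unfolding f_def abs_s by (simp add: min_def)
    qed (use L in \<open>auto simp: density_weight_def\<close>)
  qed
  have bdd: "\<bar>y T j\<bar> \<le> M" for T j
  proof -
    have "0 \<le> L * b" using b L by simp
    then show ?thesis using b by (simp add: y_def abs_s)
  qed
  have lab: "f T (c j t) = y T j" for T j t using L b by (simp add: f_def c_def y_def np)
  have cube: "c j t \<in> cube" for j t using p_cube by (simp add: c_def)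
  note membership = mixture_regression_class[where c = c and f = "f T" and y = "y T" for T,
      OF fin cc cube bdd fm lab lip[unfolded P_def]]
  have reg: "is_regression (P T) (f T)" and lipc: "P T \<in> lipschitz_class K M 0 \<sigma> L" for T
    using membership[of T] by (auto simp: P_def)
  have "P T \<in> covering_class K M C1 \<xi> n 0 \<sigma> L" for T
  proof -
    interpret path_weight "density_weight K (P T) 0 \<sigma>"
      by (rule path_weight_density_weight[OF K \<sigma> _ prob]) auto
    have "covering_number K (P T) 0 \<sigma> \<epsilon> \<le> card {0 :: real^'d}" if "real n powr (- 1 / (2 + \<xi>)) \<le> \<epsilon>" for \<epsilon>
    proof (rule covering_number_le)
      fix z assume "z \<in> measure_support (marginal_X (P T))"
      then have "z \<in> (\<Union>j. c j ` {0..1})"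
        using measure_support_curve_mixture[where c = c, OF fin(1) cc] unfolding P_def by blast
      then have "z = 0 \<or> z = p" by (auto simp: c_def split: if_splits)
      then have "dist 0 z \<le> b" using np b by auto
      then have "density_dist K (P T) 0 \<sigma> 0 z \<le> \<epsilon>"
        using weighted_dist_le_dist[of 0 z] that b unfolding density_dist_eq_weighted by linarith
      then show "\<exists>x\<in>{0}. density_dist K (P T) 0 \<sigma> x z \<le> \<epsilon>" by simp
    qed (use p_cube in auto)
    then have "real (covering_number K (P T) 0 \<sigma> \<epsilon>) \<le> 1" if "real n powr (- 1 / (2 + \<xi>)) \<le> \<epsilon>" for \<epsilon>
      using that by force
    then show ?thesis unfolding covering_class_def using lipc by (auto intro: max.coboundedI1)
  qed
  then have PP: "P T \<in> \<P>" for T using \<P> by blast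
  let ?\<kappa> = "\<lambda>_::unit. scale_measure (ennreal (1 / 2)) (return borel p)"
  have "of_nat (card (UNIV :: unit set)) * (ennreal ((L * b)\<^sup>2) * ennreal (1 / 2) * ennreal (1 / 2) ^ n)
      \<le> supervised_minimax_risk n m \<P>"
  proof (rule assouad_bound[where P = P and f = f and \<kappa> = ?\<kappa>])
    show "finite_measure (?\<kappa> g)" for g
      by (intro finite_measureI) (simp add: space_scale_measure)
    show "(\<Sum>g\<in>(UNIV :: unit set). \<integral>\<^sup>+x. \<phi> x \<partial>?\<kappa> g) \<le> (\<integral>\<^sup>+x. \<phi> x \<partial>marginal_X (P T))"
      if [measurable]: "\<phi> \<in> borel_measurable borel" for T \<phi>
    proof -
      have "(\<integral>\<^sup>+x. \<phi> x \<partial>marginal_X (P T)) = (\<Sum>j\<in>UNIV. ennreal (1 / 2) * \<phi> (c j 0))"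
      proof -
        have "(\<integral>\<^sup>+t. \<phi> (c j t) * indicator {0..1} t \<partial>lborel) = \<phi> (c j 0)" for j
        proof -
          have "(\<integral>\<^sup>+t. \<phi> (c j t) * indicator {0..1} t \<partial>lborel) = (\<integral>\<^sup>+t. \<phi> (c j 0) * indicator {0..1::real} t \<partial>lborel)"
            by (simp add: c_def)
          also have "\<dots> = \<phi> (c j 0)" by (subst nn_integral_cmult_indicator) auto
          finally show ?thesis .
        qed
        then show ?thesis
          unfolding P_def by (subst nn_integral_marginal_mixture[OF fin(1) cm]) (simp_all only: that card_UNIV_bool of_nat_numeral)
      qed
      also have "\<dots> = ennreal (1 / 2) * \<phi> 0 + ennreal (1 / 2) * \<phi> p"
        by (simp add: UNIV_bool c_def)
      finally show ?thesis by (simp add: nn_integral_atom)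
    qed
    show "AE x in ?\<kappa> g. f T x = (if g \<in> T then L * b else - (L * b))" for T g
    proof -
      have "f T p = (if g \<in> T then L * b else - (L * b))" using L b np by (simp add: f_def s_def)
      moreover have "{x. f T x \<noteq> (if g \<in> T then L * b else - (L * b))} \<in> sets borel"
        using fm[of T] by measurable
      ultimately show ?thesis
        by (intro AE_I[of _ _ "{x. f T x \<noteq> (if g \<in> T then L * b else - (L * b))}"])
          (auto simp: space_scale_measure)
    qed
    show "\<exists>R. sets R = sets borel \<and> R \<le> P T \<and> R \<le> P (insert g T) \<and> ennreal (1 / 2) \<le> emeasure R UNIV" for T g
    proof (intro exI conjI)
      let ?R = "curve_mixture (1 / card (UNIV :: bool set)) {False} c (\<lambda>_. 0)"
      show "?R \<le> P T" "?R \<le> P (insert g T)"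
        unfolding P_def by (auto intro!: curve_mixture_mono cm simp: y_def)
      show "ennreal (1 / 2) \<le> emeasure ?R UNIV"
        by (subst emeasure_curve_mixture_UNIV) (auto simp: cm card_UNIV_bool)
    qed simp
  qed (use PP prob reg in auto)
  also have "of_nat (card (UNIV :: unit set)) * (ennreal ((L * b)\<^sup>2) * ennreal (1 / 2) * ennreal (1 / 2) ^ n)
      = ennreal ((L * b)\<^sup>2 / 2 * (1 / 2) ^ n)"
  proof -
    have "ennreal (a * e * e ^ n) = ennreal a * ennreal e * ennreal e ^ n" if "0 \<le> a" "0 \<le> e" for a e :: real
      using that by (simp add: ennreal_mult ennreal_power)
    from this[of "(L * b)\<^sup>2" "1 / 2"] show ?thesis by simp
  qed
  finally show ?thesis .
qed

section \<open>Rates and the minimax bound\<close>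

text \<open>The lower bound on \<open>\<sigma>\<close> gives \<open>m * \<sigma> ^ d \<ge> m powr (2 * \<beta>)\<close>, and the logarithm costs at most a factor of
  order \<open>m powr \<beta>\<close>. The rate therefore decays like a power of \<open>m\<close>, which leaves room for values of
  \<open>\<alpha>\<close> that grow like a power of \<open>n\<close>.\<close>

lemma eps_rate_bounds:
  assumes d: "d \<ge> 1" and "\<gamma> > 0" "C2 > 0" and m: "m \<ge> 2"
    and \<sigma>: "(1 / real m) powr (1 / (real d * (1 + \<gamma>))) \<le> \<sigma>" and \<beta>: "\<beta> = \<gamma> / (2 * (1 + \<gamma>))"
  shows "0 < eps_rate d C2 m \<sigma>" "eps_rate d C2 m \<sigma> \<le> sqrt (C2 / \<beta>) * real m powr (- \<beta> / 2)"
proof -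
  have m0: "real m > 1" using m by simp
  have \<beta>0: "\<beta> > 0" using assms by simp
  have \<sigma>0: "\<sigma> > 0"
    using \<sigma> m0 by (intro less_le_trans[OF _ \<sigma>]) simp
  have "real m powr (- 1 / (1 + \<gamma>)) = ((1 / real m) powr (1 / (real d * (1 + \<gamma>)))) ^ d"
  proof -
    have "((1 / real m) powr (1 / (real d * (1 + \<gamma>)))) ^ d = (1 / real m) powr (1 / (real d * (1 + \<gamma>)) * real d)"
      using m0 by (simp add: powr_realpow[symmetric] powr_powr)
    also have "1 / (real d * (1 + \<gamma>)) * real d = 1 / (1 + \<gamma>)" using d by simp
    also have "(1 / real m) powr (1 / (1 + \<gamma>)) = real m powr (- 1 / (1 + \<gamma>))"
      using m0 by (simp add: powr_divide powr_minus_divide)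
    finally show ?thesis ..
  qed
  also have "\<dots> \<le> \<sigma> ^ d" using \<sigma> by (intro power_mono) auto
  finally have "real m powr 1 * real m powr (- 1 / (1 + \<gamma>)) \<le> real m * \<sigma> ^ d"
    using m0 by (simp add: mult_left_mono)
  then have "real m powr (1 + - 1 / (1 + \<gamma>)) \<le> real m * \<sigma> ^ d" by (simp only: powr_add)
  moreover have "1 + - 1 / (1 + \<gamma>) = 2 * \<beta>" using assms(2) by (simp add: \<beta> field_simps)
  ultimately have vol: "real m powr (2 * \<beta>) \<le> real m * \<sigma> ^ d" by simp
  have lnm: "0 < ln (real m)" using m0 by simp
  show "0 < eps_rate d C2 m \<sigma>"
    unfolding eps_rate_def using lnm m0 \<sigma>0 assms(3) by simp
  have "C2 * ln (real m) / (real m * \<sigma> ^ d) \<le> C2 * (real m powr \<beta> / \<beta>) / real m powr (2 * \<beta>)"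
    using vol lnm m0 assms(3) \<beta>0 ln_powr_bound[of "real m" \<beta>]
    by (intro frac_le mult_left_mono) auto
  also have "\<dots> = C2 / \<beta> * real m powr (- \<beta>)"
  proof -
    have "real m powr (2 * \<beta>) = real m powr \<beta> * real m powr \<beta>"
      unfolding powr_add[symmetric] by simp
    moreover have "real m powr \<beta> > 0" using m0 by simp
    ultimately show ?thesis using \<beta>0 by (simp add: powr_minus_divide)
  qed
  finally have "eps_rate d C2 m \<sigma> \<le> sqrt (C2 / \<beta> * real m powr (- \<beta>))"
    unfolding eps_rate_def by (rule real_sqrt_le_mono)
  also have "\<dots> = sqrt (C2 / \<beta>) * real m powr (- \<beta> / 2)"
    unfolding real_sqrt_mult by (subst powr_half_sqrt[symmetric]) (simp_all add: powr_powr)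
  finally show "eps_rate d C2 m \<sigma> \<le> sqrt (C2 / \<beta>) * real m powr (- \<beta> / 2)" .
qed

lemma exists_threshold:
  fixes d :: nat
  assumes "d \<ge> 2" "c > 0" "\<beta> > 0" "B > 0"
  obtains n0 :: nat where "\<And>n. n \<ge> n0 \<Longrightarrow> n \<ge> 1 \<and> 3 \<le> real n powr (1 / (real d - 1)) \<and>
      real d * exp (- (c * real n powr \<beta>)) \<le> 1 / real n \<and>
      1 / real n powr (1 / (real d - 1)) + (real d + 1) * exp (- (c * real n powr \<beta>)) \<le> B"
proof -
  define e where "e = 1 / (real d - 1)"
  have e: "e > 0" using assms(1) by (simp add: e_def)
  have "eventually (\<lambda>n::nat. n \<ge> 1) at_top" by (rule eventually_ge_at_top)
  moreover have "eventually (\<lambda>n::nat. 3 \<le> real n powr e) at_top"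
    using e by real_asymp
  moreover have "eventually (\<lambda>n::nat. real d * exp (- (c * real n powr \<beta>)) \<le> 1 / real n) at_top"
    using assms(1,2,3) by real_asymp
  moreover have "eventually (\<lambda>n::nat. 1 / real n powr e + (real d + 1) * exp (- (c * real n powr \<beta>)) < B) at_top"
  proof -
    have "((\<lambda>n::nat. 1 / real n powr e + (real d + 1) * exp (- (c * real n powr \<beta>))) \<longlongrightarrow> 0) at_top"
      using assms e by real_asymp
    from order_tendstoD(2)[OF this assms(4)] show ?thesis .
  qed
  ultimately have "eventually (\<lambda>n::nat. n \<ge> 1 \<and> 3 \<le> real n powr e \<and>
      real d * exp (- (c * real n powr \<beta>)) \<le> 1 / real n \<and>
      1 / real n powr e + (real d + 1) * exp (- (c * real n powr \<beta>)) \<le> B) at_top"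
    by eventually_elim auto
  then show thesis using that unfolding eventually_at_top_linorder e_def by blast
qed

lemma inverse_le_powr_neg:
  assumes "n \<ge> 1" "\<xi> > 0"
  shows "1 / real n \<le> real n powr (- 1 / (2 + \<xi>))"
proof -
  have "1 / real n = real n powr (- 1)" using assms by (simp add: powr_minus_divide)
  also have "\<dots> \<le> real n powr (- 1 / (2 + \<xi>))"
    using assms by (intro powr_mono) (auto simp: field_simps)
  finally show ?thesis .
qed

text \<open>With \<open>q = \<lceil>x\<rceil>\<close>, where \<open>x ^ (d - 1) = n\<close> and \<open>x \<le> q \<le> 2 * x\<close>, the upper bound on \<open>\<sigma>\<close> serves twice: it
  bounds the smoothing radius by \<open>1 / (4 * q)\<close>, and since each segment has weight of order
  \<open>1 / n\<close> it makes the smoothed density on the segments at least a constant \<open>\<rho>\<close>.\<close>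

lemma spiked_minimax_large:
  fixes K :: "real \<Rightarrow> real" and \<P> :: "((real^'d) \<times> real) measure set"
  defines "d \<equiv> CARD('d)" and "C0 \<equiv> diameter (kernel_support (radial K :: real^'d \<Rightarrow> real))"
  assumes K: "is_kernel (radial K :: real^'d \<Rightarrow> real)" and d: "d \<ge> 2"
    and pos: "M > 0" "L > 0" "\<xi> > 0" "C1 > 0" and n: "n \<ge> 1"
    and \<sigma>: "\<sigma> > 0" "\<sigma> \<le> 1 / (4 * C0) * (1 / real n) powr (1 / (real d - 1))" and \<alpha>: "\<alpha> \<ge> 0"
    and \<kappa>: "\<kappa> > 0" "ennreal \<kappa> \<le> half_line_mass K"
    and \<rho>: "\<rho> = \<kappa> * (4 * C0) ^ (d - 1) / (2 * real d * 2 ^ (d - 1))"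
    and x: "x = real n powr (1 / (real d - 1))" "3 \<le> x"
    and fine: "real d * exp (- (\<alpha> * \<rho>)) \<le> real n powr (- 1 / (2 + \<xi>))"
    and coarse: "1 / x + (real d + 1) * exp (- (\<alpha> * \<rho>)) \<le> C1 * 2 powr (- 1 / \<xi>)"
    and \<P>: "covering_class K M C1 \<xi> n \<alpha> \<sigma> L \<subseteq> \<P>"
  shows "ennreal ((min (L / 4) M)\<^sup>2 / (24 * real d) / x\<^sup>2) \<le> supervised_minimax_risk n m \<P>"
proof -
  define v :: 'd where "v = undefined"
  define q where "q = nat \<lceil>x\<rceil>"
  define h where "h = min (L / 4) M / real q"
  have qx: "x \<le> real q" "real q \<le> 2 * x" using x(2) unfolding q_def by linarith+
  then have q: "q \<ge> 3" using x(2) by linarith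
  have C0: "C0 > 0" unfolding C0_def by (rule kernel_diameter_pos[OF K])
  have xd: "x ^ (d - 1) = real n"
    using n d by (simp add: x powr_realpow[symmetric] powr_powr of_nat_diff)
  have nq: "real n \<le> real q ^ (d - 1)" unfolding xd[symmetric] using qx x by (intro power_mono) auto
  have \<sigma>x: "\<sigma> \<le> 1 / (4 * C0 * x)"
    using \<sigma>(2) n by (simp add: x(1) powr_divide)
  have \<sigma>C: "\<sigma> * C0 \<le> 1 / (2 * real q)"
  proof -
    have "\<sigma> * C0 \<le> 1 / (4 * C0 * x) * C0" using \<sigma>x C0 by (intro mult_right_mono) auto
    also have "\<dots> = 1 / (2 * (2 * x))" using C0 by simp
    also have "\<dots> \<le> 1 / (2 * real q)" using qx q by (intro divide_left_mono) auto
    finally show ?thesis .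
  qed
  have h0: "0 \<le> h" "4 * real q * h \<le> L" "h \<le> M"
  proof -
    show "0 \<le> h" using pos by (simp add: h_def)
    have "4 * real q * h = 4 * min (L / 4) M" using q by (simp add: h_def)
    then show "4 * real q * h \<le> L" by simp
    have "h \<le> min (L / 4) M / 1" unfolding h_def using q pos by (intro divide_left_mono) auto
    then show "h \<le> M" by simp
  qed
  have ex: "\<exists>i. i \<noteq> v"
  proof (rule ccontr)
    assume "\<nexists>i. i \<noteq> v"
    then have "UNIV = {v}" by blast
    then have "CARD('d) = card {v}" by simp
    then show False using d by (simp add: d_def)
  qed
  have \<rho>0: "0 \<le> \<rho>" using \<kappa> C0 by (simp add: \<rho>)
  have dens: "ennreal \<rho> \<le> ennreal (1 / card (edges v q)) * (ennreal (\<sigma> / \<sigma> ^ CARD('d)) * half_line_mass K)"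
  proof -
    have N: "real (card (edges v q)) = 2 * real d * real q ^ (d - 1)"
      using q by (simp add: card_edges d_def)
    have "(4 * C0) ^ (d - 1) * real n \<le> \<sigma> / \<sigma> ^ d"
    proof -
      have "4 * C0 * x \<le> 1 / \<sigma>" using \<sigma>x \<sigma>(1) C0 x(2) by (simp add: field_simps)
      then have "(4 * C0 * x) ^ (d - 1) \<le> (1 / \<sigma>) ^ (d - 1)"
        using C0 x(2) by (intro power_mono) auto
      moreover have "(1 / \<sigma>) ^ (d - 1) = \<sigma> / \<sigma> ^ d"
        using d \<sigma>(1) by (cases d) (auto simp: power_divide)
      moreover have "(4 * C0 * x) ^ (d - 1) = (4 * C0) ^ (d - 1) * real n"
        by (simp only: power_mult_distrib xd)
      ultimately show ?thesis by (simp only:)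
    qed
    moreover have "1 / (2 * real d * 2 ^ (d - 1) * real n) \<le> 1 / card (edges v q)"
    proof -
      have "real q ^ (d - 1) \<le> (2 * x) ^ (d - 1)" using qx by (intro power_mono) auto
      then have "real q ^ (d - 1) \<le> 2 ^ (d - 1) * real n" by (simp only: power_mult_distrib xd)
      then have "2 * real d * real q ^ (d - 1) \<le> 2 * real d * (2 ^ (d - 1) * real n)"
        by (intro mult_left_mono) auto
      then show ?thesis unfolding N using d q n by (intro divide_left_mono) (auto simp: mult_ac)
    qed
    ultimately have "1 / (2 * real d * 2 ^ (d - 1) * real n) * ((4 * C0) ^ (d - 1) * real n) * \<kappa>
        \<le> 1 / card (edges v q) * (\<sigma> / \<sigma> ^ d) * \<kappa>"
      using C0 \<kappa> by (intro mult_right_mono mult_mono) auto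
    moreover have "1 / (2 * real d * 2 ^ (d - 1) * real n) * ((4 * C0) ^ (d - 1) * real n) * \<kappa> = \<rho>"
      using n by (simp add: \<rho>)
    ultimately have "ennreal \<rho> \<le> ennreal (1 / card (edges v q) * (\<sigma> / \<sigma> ^ d) * \<kappa>)"
      by (intro ennreal_leI) simp
    also have "\<dots> = ennreal (1 / card (edges v q)) * (ennreal (\<sigma> / \<sigma> ^ d) * ennreal \<kappa>)"
      using \<sigma>(1) \<kappa>(1) by (simp add: ennreal_mult[symmetric])
    also have "\<dots> \<le> ennreal (1 / card (edges v q)) * (ennreal (\<sigma> / \<sigma> ^ d) * half_line_mass K)"
      by (intro mult_left_mono \<kappa>(2)) auto
    finally show ?thesis by (simp add: d_def)
  qed
  have "1 / real q \<le> 1 / x" using qx x(2) by (intro divide_left_mono) auto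
  then have coarse': "1 / real q + (real d + 1) * exp (- \<alpha> * \<rho>) \<le> C1 * 2 powr (- 1 / \<xi>)"
    using coarse by simp
  have "ennreal (h\<^sup>2 / (6 * real CARD('d))) \<le> supervised_minimax_risk n m \<P>"
  proof (rule spiked_minimax_bound[where v = v and q = q and L = L])
    show "spiked v q h T \<in> \<P>" for T
      using \<P> spiked_covering_class[OF K \<sigma>(1) \<alpha> ex _ pos(2) h0 \<sigma>C[unfolded C0_def] \<rho>0 dens n pos(3,4), of T]
        fine coarse' q unfolding d_def by auto
    show "is_regression (spiked v q h T) (spiked_regression v q L h T)" for T
      using spiked_class(1)[OF K \<sigma>(1) \<alpha> ex _ pos(2) h0 \<sigma>C[unfolded C0_def], of T] q by auto
  qed (use d q pos h0 nq in \<open>auto simp: d_def\<close>)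
  note bound = this
  have "(min (L / 4) M)\<^sup>2 / (24 * real d) / x\<^sup>2 \<le> h\<^sup>2 / (6 * real CARD('d))"
  proof -
    have "(real q)\<^sup>2 \<le> (2 * x)\<^sup>2" using qx by (intro power_mono) auto
    then have "(real q)\<^sup>2 \<le> 4 * x\<^sup>2" by (simp add: power_mult_distrib)
    then have "6 * real d * (real q)\<^sup>2 \<le> 6 * real d * (4 * x\<^sup>2)" by (intro mult_left_mono) auto
    then have "(min (L / 4) M)\<^sup>2 / (6 * real d * (4 * x\<^sup>2)) \<le> (min (L / 4) M)\<^sup>2 / (6 * real d * (real q)\<^sup>2)"
      using q d x(2) by (intro divide_left_mono mult_pos_pos) auto
    then show ?thesis by (simp add: h_def d_def power_divide mult_ac)
  qed
  then show ?thesis by (rule order_trans[OF ennreal_leI bound])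
qed

lemma covering_class_subset:
  fixes K :: "real \<Rightarrow> real"
  assumes "(\<alpha>, \<sigma>) \<in> tuning_pairs CARD('d) (diameter (kernel_support (radial K :: real^'d \<Rightarrow> real))) C2 \<gamma> n m"
  shows "(covering_class K M C1 \<xi> n \<alpha> \<sigma> L :: ((real^'d) \<times> real) measure set)
    \<subseteq> distribution_class K M L \<xi> \<gamma> C1 C2 n m"
  using assms unfolding distribution_class_def by blast

theorem theorem5p1:
  fixes K :: "real \<Rightarrow> real" and M L \<xi> \<gamma> C1 C2 :: real
  assumes kernel: "is_kernel (radial K :: real^'d \<Rightarrow> real)"
    and "M > 0" and "L > 0" and "\<gamma> > 0" and "C1 > 0" and "C2 > 0"
    and "0 < \<xi>" and "\<xi> < real CARD('d) - 3"
  shows "\<exists>C>0. \<forall>n m. n \<ge> 1 \<longrightarrow>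
      real m \<ge> real n powr (real CARD('d) * (1 + \<gamma>) / (real CARD('d) - 1)) \<longrightarrow>
      tuning_pairs CARD('d) (diameter (kernel_support (radial K :: real^'d \<Rightarrow> real))) C2 \<gamma> n m
        \<noteq> {} \<longrightarrow>
      supervised_minimax_risk n m
          (distribution_class K M L \<xi> \<gamma> C1 C2 n m :: ((real^'d) \<times> real) measure set)
        \<ge> ennreal ((C / real n) powr (2 / (real CARD('d) - 1)))"
proof -
  define d where "d = CARD('d)"
  define C0 where "C0 = diameter (kernel_support (radial K :: real^'d \<Rightarrow> real))"
  have d: "d \<ge> 2" "real d > 3" using assms(7,8) by (auto simp: d_def)
  have C0: "C0 > 0" unfolding C0_def by (rule kernel_diameter_pos[OF kernel])
  obtain \<kappa> where \<kappa>: "\<kappa> > 0" "ennreal \<kappa> \<le> half_line_mass K"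
  proof (cases "half_line_mass K")
    case (real r)
    then show thesis using that[of r] half_line_mass_pos[OF kernel] by auto
  next
    case top
    then show thesis using that[of 1] by simp
  qed
  define \<rho> where "\<rho> = \<kappa> * (4 * C0) ^ (d - 1) / (2 * real d * 2 ^ (d - 1))"
  have \<rho>: "\<rho> > 0" using \<kappa> C0 d by (simp add: \<rho>_def)
  define \<beta> where "\<beta> = \<gamma> / (2 * (1 + \<gamma>))"
  have \<beta>: "\<beta> > 0" using assms by (simp add: \<beta>_def)
  \<comment> \<open>chosen so that the largest admissible \<open>\<alpha>\<close> satisfies \<open>\<alpha> * \<rho> \<ge> c * n powr (\<beta> / 2)\<close>\<close>
  define c where "c = \<rho> * (ln 2 / sqrt (C2 / \<beta>))"
  have c: "c > 0" using \<rho> \<beta> assms by (simp add: c_def)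
  obtain n0 :: nat where n0: "\<And>n. n \<ge> n0 \<Longrightarrow> n \<ge> 1 \<and> 3 \<le> real n powr (1 / (real d - 1)) \<and>
      real d * exp (- (c * real n powr (\<beta> / 2))) \<le> 1 / real n \<and>
      1 / real n powr (1 / (real d - 1)) + (real d + 1) * exp (- (c * real n powr (\<beta> / 2))) \<le> C1 * 2 powr (- 1 / \<xi>)"
    by (rule exists_threshold[OF d(1) c, of "\<beta> / 2" "C1 * 2 powr (- 1 / \<xi>)"]) (use \<beta> assms in auto)
  \<comment> \<open>the distance of the two atoms; a fixed \<open>b\<close> must serve all \<open>n < n0\<close>\<close>
  define b where "b = min (1 / (real n0 + 1)) (M / L)"
  have b: "0 < b" "b \<le> 1" "L * b \<le> M"
  proof -
    show "0 < b" using assms by (simp add: b_def)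
    show "b \<le> 1" by (simp add: b_def min_le_iff_disj)
    have "L * b \<le> L * (M / L)" using assms by (intro mult_left_mono) (auto simp: b_def)
    then show "L * b \<le> M" using assms by simp
  qed
  define A1 where "A1 = (min (L / 4) M)\<^sup>2 / (24 * real d)"
  define A2 where "A2 = (L * b)\<^sup>2 / 2 * (1 / 2) ^ n0"
  have A: "A1 > 0" "A2 > 0" using assms d b by (auto simp: A1_def A2_def)
  \<comment> \<open>\<open>A1\<close> is the constant for large \<open>n\<close>, \<open>A2\<close> the one for the remaining \<open>n\<close>\<close>
  define C where "C = min A1 A2 powr ((real d - 1) / 2)"
  have C: "C > 0" using A by (simp add: C_def)
  have Cpow: "(C / real n) powr (2 / (real d - 1)) = min A1 A2 / (real n powr (1 / (real d - 1)))\<^sup>2" if "n \<ge> 1" for n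
  proof -
    have "(C / real n) powr (2 / (real d - 1)) = C powr (2 / (real d - 1)) / real n powr (2 / (real d - 1))"
      using C that by (simp add: powr_divide)
    moreover have "C powr (2 / (real d - 1)) = min A1 A2"
    proof -
      have "(real d - 1) / 2 * (2 / (real d - 1)) = 1" using d by simp
      then show ?thesis using A by (simp only: C_def powr_powr) simp
    qed
    moreover have "real n powr (2 / (real d - 1)) = (real n powr (1 / (real d - 1)))\<^sup>2"
      using that by (simp add: powr_realpow[symmetric] powr_powr)
    ultimately show ?thesis by simp
  qed
  have "ennreal ((C / real n) powr (2 / (real d - 1)))
      \<le> supervised_minimax_risk n m (distribution_class K M L \<xi> \<gamma> C1 C2 n m :: ((real^'d) \<times> real) measure set)"
    if n: "n \<ge> 1" and m: "real m \<ge> real n powr (real d * (1 + \<gamma>) / (real d - 1))"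
      and tp: "tuning_pairs d C0 C2 \<gamma> n m \<noteq> {}" for n m
  proof -
    obtain \<alpha>0 \<sigma> where "(\<alpha>0, \<sigma>) \<in> tuning_pairs d C0 C2 \<gamma> n m" using tp by auto
    then have \<sigma>: "\<sigma> > 0" "(1 / real m) powr (1 / (real d * (1 + \<gamma>))) \<le> \<sigma>"
      "\<sigma> \<le> 1 / (4 * C0) * (1 / real n) powr (1 / (real d - 1))"
      by (auto simp: tuning_pairs_def)
    have in_pairs: "(\<alpha>, \<sigma>) \<in> tuning_pairs d C0 C2 \<gamma> n m" if "0 \<le> \<alpha>" "\<alpha> * eps_rate d C2 m \<sigma> \<le> ln 2" for \<alpha>
      using that \<sigma> by (simp add: tuning_pairs_def)
    define x where "x = real n powr (1 / (real d - 1))"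
    have x1: "1 \<le> x" using n d by (auto simp: x_def ge_one_powr_ge_zero)
    show ?thesis
    proof (cases "n \<ge> n0")
      case True
      note large = n0[OF True, folded x_def]
      have "3 \<le> x" using large by blast
      have "real n powr 1 \<le> real n powr (real d * (1 + \<gamma>) / (real d - 1))"
        using n d assms(4) by (intro powr_mono) (auto simp: field_simps)
      then have nm: "real n \<le> real m" using m n by simp
      have "n \<noteq> 1" using \<open>3 \<le> x\<close> by (auto simp: x_def)
      then have m2: "m \<ge> 2" using nm n by linarith
      note eps = eps_rate_bounds[OF _ assms(4,6) m2 \<sigma>(2) \<beta>_def]
      have eps0: "0 < eps_rate d C2 m \<sigma>" using eps(1) d by simp
      define \<alpha> where "\<alpha> = ln 2 / eps_rate d C2 m \<sigma>"
      have \<alpha>: "\<alpha> \<ge> 0" "\<alpha> * eps_rate d C2 m \<sigma> \<le> ln 2" using eps0 by (auto simp: \<alpha>_def)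
      have "c * real n powr (\<beta> / 2) \<le> \<alpha> * \<rho>"
      proof -
        have "real n powr (\<beta> / 2) \<le> real m powr (\<beta> / 2)" using nm \<beta> by (intro powr_mono2) auto
        then have "ln 2 / sqrt (C2 / \<beta>) * real n powr (\<beta> / 2) \<le> ln 2 / sqrt (C2 / \<beta>) * real m powr (\<beta> / 2)"
          using \<beta> assms(6) by (intro mult_left_mono) auto
        also have "\<dots> = ln 2 / (sqrt (C2 / \<beta>) * real m powr (- \<beta> / 2))"
          by (simp add: powr_minus_divide)
        also have "\<dots> \<le> \<alpha>"
          unfolding \<alpha>_def using eps d eps0 by (intro divide_left_mono) (auto intro!: mult_pos_pos)
        finally have "\<rho> * (ln 2 / sqrt (C2 / \<beta>) * real n powr (\<beta> / 2)) \<le> \<rho> * \<alpha>"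
          using \<rho> by (intro mult_left_mono) auto
        then show ?thesis by (simp only: c_def mult_ac)
      qed
      then have e: "exp (- (\<alpha> * \<rho>)) \<le> exp (- (c * real n powr (\<beta> / 2)))" by simp
      have bound: "ennreal ((min (L / 4) M)\<^sup>2 / (24 * real d) / x\<^sup>2)
        \<le> supervised_minimax_risk n m (distribution_class K M L \<xi> \<gamma> C1 C2 n m :: ((real^'d) \<times> real) measure set)"
      proof (rule spiked_minimax_large[where 'd = 'd and K = K and \<alpha> = \<alpha> and \<sigma> = \<sigma> and \<rho> = \<rho> and \<kappa> = \<kappa>, folded d_def C0_def])
        show "real d * exp (- (\<alpha> * \<rho>)) \<le> real n powr (- 1 / (2 + \<xi>))"
          using mult_left_mono[OF e, of "real d"] large inverse_le_powr_neg[OF n assms(7)] by auto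
        show "1 / x + (real d + 1) * exp (- (\<alpha> * \<rho>)) \<le> C1 * 2 powr (- 1 / \<xi>)"
        proof -
          have "(real d + 1) * exp (- (\<alpha> * \<rho>)) \<le> (real d + 1) * exp (- (c * real n powr (\<beta> / 2)))"
            using e by (rule mult_left_mono) simp
          moreover have "1 / x + (real d + 1) * exp (- (c * real n powr (\<beta> / 2))) \<le> C1 * 2 powr (- 1 / \<xi>)"
            using large by blast
          ultimately show ?thesis by linarith
        qed
        show "covering_class K M C1 \<xi> n \<alpha> \<sigma> L \<subseteq> (distribution_class K M L \<xi> \<gamma> C1 C2 n m :: ((real^'d) \<times> real) measure set)"
          by (rule covering_class_subset[where 'd = 'd and K = K, folded d_def C0_def]) (rule in_pairs[OF \<alpha>])
      qed (use kernel d assms n \<sigma> \<alpha> \<kappa> \<rho>_def x_def \<open>3 \<le> x\<close> in auto)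
      have "min A1 A2 / x\<^sup>2 \<le> A1 / x\<^sup>2" by (intro divide_right_mono) auto
      then show ?thesis
        unfolding Cpow[OF n] x_def[symmetric] by (rule order_trans[OF ennreal_leI bound[folded A1_def]])
    next
      case False
      have bn: "b \<le> real n powr (- 1 / (2 + \<xi>))"
      proof -
        have "b \<le> 1 / (real n0 + 1)" by (simp add: b_def)
        also have "\<dots> \<le> 1 / real n" using False n by (intro divide_left_mono) auto
        finally show ?thesis using inverse_le_powr_neg[OF n assms(7)] by simp
      qed
      have bound: "ennreal ((L * b)\<^sup>2 / 2 * (1 / 2) ^ n)
        \<le> supervised_minimax_risk n m (distribution_class K M L \<xi> \<gamma> C1 C2 n m :: ((real^'d) \<times> real) measure set)"
        by (rule two_atom_minimax_bound[where ?C1.0 = C1, OF kernel \<sigma>(1) assms(3) b bn])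
          (rule covering_class_subset[where 'd = 'd and K = K, folded d_def C0_def], rule in_pairs, auto)
      have "min A1 A2 / x\<^sup>2 \<le> (L * b)\<^sup>2 / 2 * (1 / 2) ^ n"
      proof -
        have "1 \<le> x\<^sup>2" using x1 by simp
        then have "min A1 A2 / x\<^sup>2 \<le> min A1 A2 / 1" using A by (intro divide_left_mono) auto
        also have "\<dots> \<le> A2" by simp
        also have "\<dots> \<le> (L * b)\<^sup>2 / 2 * (1 / 2) ^ n"
          unfolding A2_def using False by (intro mult_left_mono power_decreasing) auto
        finally show ?thesis .
      qed
      then show ?thesis
        unfolding Cpow[OF n] x_def[symmetric] by (rule order_trans[OF ennreal_leI bound])
    qed
  qed
  then show ?thesis using C unfolding d_def C0_def by blast
qed

end
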